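(* Let $F$ be a field, let $H\leq G$ be groups and let $W$ be an irreducible $H$-module (over $F$) satisfying $$(W,W)_H=1$$ and $$(W,{}^xW)_{H\cap xHx^{-1}}=0,\quad x\in G\setminus H.$$ Suppose at least one of the following conditions holds: (D1) There is a normal subgroup $N$ of $G$ contained in $H$ and an irreducible $N$-module $W_0$ such that $W$ lies over $W_0$ and $H=I_G(W_0)$ (this is automatic if $H\unlhd G$). (D2) $G$ is finite and $\mathrm{char}(F)\nmid|G|$. (D3) $H$ is a strongly ascendant subgroup of $G$. Then $\mathrm{ind}_H^GW$ is an irreducible $G$-module and $(\mathrm{ind}_H^GW,\mathrm{ind}_H^GW)_G=1$.
   Context: Groups may be infinite and modules (over the arbitrary field $F$) may be infinite dimensional. $(X,Y)_G=\dim_F\mathrm{Hom}_{FG}(X,Y)$ and $\mathrm{ind}_H^GW=FG\otimes_{FH}W$. For $x\in G$, ${}^xW$ is the vector space $W$ viewed as an $H\cap xHx^{-1}$-module via $h\cdot w=(x^{-1}hx)w$; in $(W,{}^xW)_{H\cap xHx^{-1}}$ the first $W$ is restricted to $H\cap xHx^{-1}$. For $N\unlhd G$, an $N$-module $W_0$ and $g\in G$, $W_0^g$ is the $N$-module with underlying space $W_0$ and action $x\cdot w=(gxg^{-1})w$, $x\in N$; the inertia group is $I_G(W_0)=\{g\in G:W_0^g\cong W_0\}$. $W$ lies over $W_0$ if $W_0$ is isomorphic to a submodule of the restriction of $W$ to $N$. A subgroup $S$ of a group $T$ is strongly ascendant (relative to $\mathrm{char}(F)$) if there is a well-ordered set $(X,\leq)$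 with first element $x_0$ and last element $x_1$, and subgroups $S_x$, $x\in X$, of $T$ such that: $S_{x_0}=S$; $S_{x_1}=T$; for every $x\in X$, $x\neq x_1$, with successor $x'\in X$, $S_x$ is normal of finite index in $S_{x'}$ with $\mathrm{char}(F)\nmid[S_{x'}:S_x]$ (vacuous in characteristic $0$); and if $x\in X$, $x\neq x_0$, has no immediate predecessor in $X$, then $S_x=\bigcup_{y<x}S_y$. *)

theory Defs
  imports
    "HOL-Algebra.Free_Abelian_Groups"
    "HOL-Algebra.Multiplicative_Group"
    "HOL-Library.Extended_Nat"
    "Jordan_Normal_Form.Missing_VectorSpace"
begin

section \<open>Modules over group algebras\<close>

text \<open>
  An \<open>FG\<close>-module is an \<open>F\<close>-vector space with a linear action of \<open>G\<close>. Only the values of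
  \<^term>\<open>gact\<close> on the carrier of \<open>G\<close> matter, so restriction to a subgroup \<open>H\<close> leaves the record
  unchanged and is expressed by taking \<^term>\<open>G\<lparr>carrier := H\<rparr>\<close> as the acting group.
\<close>

record ('g, 'f, 'v) gmodule = "('f, 'v) module" +
  gact :: "'g \<Rightarrow> 'v \<Rightarrow> 'v"

locale gmodule =
  fixes F :: "('f, 'm) ring_scheme"
    and G :: "('g, 'n) monoid_scheme"
    and V :: "('g, 'f, 'v, 'k) gmodule_scheme"
  assumes group: "group G"
    and vectorspace: "vectorspace F V"
    and gact_linear: "g \<in> carrier G \<Longrightarrow> gact V g \<in> module_hom F V V"
    and gact_one: "v \<in> carrier V \<Longrightarrow> gact V \<one>\<^bsub>G\<^esub> v = v"
    and gact_mult: "\<lbrakk>g \<in> carrier G; h \<in> carrier G; v \<in> carrier V\<rbrakk>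
        \<Longrightarrow> gact V (g \<otimes>\<^bsub>G\<^esub> h) v = gact V g (gact V h v)"

definition gsubmodule ::
  "('f, 'm) ring_scheme \<Rightarrow> ('g, 'n) monoid_scheme \<Rightarrow> 'v set \<Rightarrow> ('g, 'f, 'v, 'k) gmodule_scheme \<Rightarrow> bool"
  where "gsubmodule F G U V \<longleftrightarrow>
    subspace F U V \<and> (\<forall>g\<in>carrier G. \<forall>u\<in>U. gact V g u \<in> U)"

definition irreducible_gmodule ::
  "('f, 'm) ring_scheme \<Rightarrow> ('g, 'n) monoid_scheme \<Rightarrow> ('g, 'f, 'v, 'k) gmodule_scheme \<Rightarrow> bool"
  where "irreducible_gmodule F G V \<longleftrightarrow>
    gmodule F G V \<and> carrier V \<noteq> {\<zero>\<^bsub>V\<^esub>} \<and>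
    (\<forall>U. gsubmodule F G U V \<longrightarrow> U = {\<zero>\<^bsub>V\<^esub>} \<or> U = carrier V)"

text \<open>
  Homomorphisms are taken to be \<^const>\<open>extensional\<close>, so that equality in the \<open>F\<close>-vector space
  \<open>Hom\<^sub>F\<^sub>G(U,V)\<close> is equality of maps on the carrier. The multiplicative fields of the record
  are unused.
\<close>

definition ghom_space ::
  "('f, 'm) ring_scheme \<Rightarrow> ('g, 'n) monoid_scheme \<Rightarrow> ('g, 'f, 'v, 'k) gmodule_scheme
    \<Rightarrow> ('g, 'f, 'w, 'l) gmodule_scheme \<Rightarrow> ('f, 'v \<Rightarrow> 'w) module"
  where "ghom_space F G U V =
   \<lparr>carrier = {f \<in> module_hom F U V \<inter> extensional (carrier U).
        \<forall>g\<in>carrier G. \<forall>x\<in>carrier U. f (gact U g x) = gact V g (f x)},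
    mult = undefined,
    one = undefined,
    zero = (\<lambda>x\<in>carrier U. \<zero>\<^bsub>V\<^esub>),
    add = (\<lambda>f h. \<lambda>x\<in>carrier U. f x \<oplus>\<^bsub>V\<^esub> h x),
    smult = (\<lambda>c f. \<lambda>x\<in>carrier U. c \<odot>\<^bsub>V\<^esub> f x)\<rparr>"

text \<open>
  \<open>(U,V)\<^sub>G\<close>. The library's \<^const>\<open>vectorspace.dim\<close> is meaningful only for finite-dimensional
  spaces; all infinite dimensions are recorded as \<^term>\<open>\<infinity>::enat\<close>.
\<close>

definition intertwining_number ::
  "('f, 'm) ring_scheme \<Rightarrow> ('g, 'n) monoid_scheme \<Rightarrow> ('g, 'f, 'v, 'k) gmodule_scheme
    \<Rightarrow> ('g, 'f, 'w, 'l) gmodule_scheme \<Rightarrow> enat"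
  where "intertwining_number F G U V =
    (if vectorspace.fin_dim F (ghom_space F G U V)
     then enat (vectorspace.dim F (ghom_space F G U V)) else \<infinity>)"

definition gmodule_iso ::
  "('f, 'm) ring_scheme \<Rightarrow> ('g, 'n) monoid_scheme \<Rightarrow> ('g, 'f, 'v, 'k) gmodule_scheme
    \<Rightarrow> ('g, 'f, 'w, 'l) gmodule_scheme \<Rightarrow> bool"
  where "gmodule_iso F G U V \<longleftrightarrow>
    (\<exists>f \<in> carrier (ghom_space F G U V). bij_betw f (carrier U) (carrier V))"


section \<open>Conjugate modules, inertia groups\<close>

text \<open>\<open>\<^sup>xW\<close>, on which \<open>h\<close> acts as \<open>x\<^sup>-\<^sup>1hx\<close>.\<close>

definition left_conj ::
  "('g, 'n) monoid_scheme \<Rightarrow> 'g \<Rightarrow> ('g, 'f, 'v, 'k) gmodule_scheme \<Rightarrow> ('g, 'f, 'v, 'k) gmodule_scheme"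
  where "left_conj G x W = W\<lparr>gact := \<lambda>h. gact W (inv\<^bsub>G\<^esub> x \<otimes>\<^bsub>G\<^esub> h \<otimes>\<^bsub>G\<^esub> x)\<rparr>"

text \<open>\<open>W\<^sup>g\<close>, on which \<open>x\<close> acts as \<open>gxg\<^sup>-\<^sup>1\<close>.\<close>

definition right_conj ::
  "('g, 'n) monoid_scheme \<Rightarrow> ('g, 'f, 'v, 'k) gmodule_scheme \<Rightarrow> 'g \<Rightarrow> ('g, 'f, 'v, 'k) gmodule_scheme"
  where "right_conj G W g = W\<lparr>gact := \<lambda>x. gact W (g \<otimes>\<^bsub>G\<^esub> x \<otimes>\<^bsub>G\<^esub> inv\<^bsub>G\<^esub> g)\<rparr>"

definition inertia_group ::
  "('f, 'm) ring_scheme \<Rightarrow> ('g, 'n) monoid_scheme \<Rightarrow> 'g set \<Rightarrow> ('g, 'f, 'v, 'k) gmodule_scheme \<Rightarrow> 'g set"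
  where "inertia_group F G N W\<^sub>0 =
    {g \<in> carrier G. gmodule_iso F (G\<lparr>carrier := N\<rparr>) (right_conj G W\<^sub>0 g) W\<^sub>0}"

definition lies_over ::
  "('f, 'm) ring_scheme \<Rightarrow> ('g, 'n) monoid_scheme \<Rightarrow> 'g set \<Rightarrow> ('g, 'f, 'w, 'k) gmodule_scheme
    \<Rightarrow> ('g, 'f, 'v, 'l) gmodule_scheme \<Rightarrow> bool"
  where "lies_over F G N W W\<^sub>0 \<longleftrightarrow>
    (\<exists>U. gsubmodule F (G\<lparr>carrier := N\<rparr>) U W \<and>
         gmodule_iso F (G\<lparr>carrier := N\<rparr>) W\<^sub>0 (W\<lparr>carrier := U\<rparr>))"


section \<open>Induced modules\<close>

definition galg_basis :: "('f, 'm) ring_scheme \<Rightarrow> 'g \<Rightarrow> 'g \<Rightarrow> 'f"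
  where "galg_basis F g = (\<lambda>x. if x = g then \<one>\<^bsub>F\<^esub> else \<zero>\<^bsub>F\<^esub>)"

text \<open>
  Elements of \<open>FG\<close> are finitely supported functions that vanish outside \<open>G\<close>. In this way \<open>FH\<close> is
  literally a subset of \<open>FG\<close> when \<open>H\<close> is a subgroup of \<open>G\<close>.
\<close>

definition group_algebra ::
  "('f, 'm) ring_scheme \<Rightarrow> ('g, 'n) monoid_scheme \<Rightarrow> ('f, 'g \<Rightarrow> 'f) module"
  where "group_algebra F G =
   \<lparr>carrier = {a. (\<forall>g. a g \<in> carrier F) \<and> (\<forall>g. g \<notin> carrier G \<longrightarrow> a g = \<zero>\<^bsub>F\<^esub>) \<and>
        finite {g. a g \<noteq> \<zero>\<^bsub>F\<^esub>}},
    mult = (\<lambda>a b g. if g \<in> carrier G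
        then \<Oplus>\<^bsub>F\<^esub>x\<in>{x. a x \<noteq> \<zero>\<^bsub>F\<^esub>}. a x \<otimes>\<^bsub>F\<^esub> b (inv\<^bsub>G\<^esub> x \<otimes>\<^bsub>G\<^esub> g) else \<zero>\<^bsub>F\<^esub>),
    one = galg_basis F \<one>\<^bsub>G\<^esub>,
    zero = (\<lambda>g. \<zero>\<^bsub>F\<^esub>),
    add = (\<lambda>a b g. a g \<oplus>\<^bsub>F\<^esub> b g),
    smult = (\<lambda>c a g. c \<otimes>\<^bsub>F\<^esub> a g)\<rparr>"

definition galg_act ::
  "('f, 'm) ring_scheme \<Rightarrow> ('g, 'f, 'w, 'k) gmodule_scheme \<Rightarrow> ('g \<Rightarrow> 'f) \<Rightarrow> 'w \<Rightarrow> 'w"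
  where "galg_act F W b w = (\<Oplus>\<^bsub>W\<^esub>g\<in>{g. b g \<noteq> \<zero>\<^bsub>F\<^esub>}. b g \<odot>\<^bsub>W\<^esub> gact W g w)"

text \<open>
  The tensor product of the right \<open>FH\<close>-module \<open>FG\<close> and the left \<open>FH\<close>-module \<open>W\<close> is the
  quotient of the free abelian group on \<open>FG \<times> W\<close> by biadditivity and \<open>FH\<close>-balancedness.
\<close>

definition tensor_free ::
  "('f, 'm) ring_scheme \<Rightarrow> ('g, 'n) monoid_scheme \<Rightarrow> ('g, 'f, 'w, 'k) gmodule_scheme
    \<Rightarrow> (('g \<Rightarrow> 'f) \<times> 'w \<Rightarrow>\<^sub>0 int) monoid"
  where "tensor_free F G W = free_Abelian_group (carrier (group_algebra F G) \<times> carrier W)"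

definition tensor_relations ::
  "('f, 'm) ring_scheme \<Rightarrow> ('g, 'n) monoid_scheme \<Rightarrow> 'g set \<Rightarrow> ('g, 'f, 'w, 'k) gmodule_scheme
    \<Rightarrow> (('g \<Rightarrow> 'f) \<times> 'w \<Rightarrow>\<^sub>0 int) set"
  where "tensor_relations F G H W = generate (tensor_free F G W)
   (let A = group_algebra F G; B = group_algebra F (G\<lparr>carrier := H\<rparr>) in
     {frag_of (a \<oplus>\<^bsub>A\<^esub> a', w) - frag_of (a, w) - frag_of (a', w) | a a' w.
        a \<in> carrier A \<and> a' \<in> carrier A \<and> w \<in> carrier W} \<union>
     {frag_of (a, w \<oplus>\<^bsub>W\<^esub> w') - frag_of (a, w) - frag_of (a, w') | a w w'.
        a \<in> carrier A \<and> w \<in> carrier W \<and> w' \<in> carrier W} \<union>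
     {frag_of (a \<otimes>\<^bsub>A\<^esub> b, w) - frag_of (a, galg_act F W b w) | a b w.
        a \<in> carrier A \<and> b \<in> carrier B \<and> w \<in> carrier W})"

text \<open>
  Left multiplication by \<open>s \<in> FG\<close>, that is, \<open>s \<cdot> (a \<otimes> w) = sa \<otimes> w\<close>, on cosets: apply it to all
  representatives and add the subgroup of relations.
\<close>

definition tensor_lmult ::
  "('f, 'm) ring_scheme \<Rightarrow> ('g, 'n) monoid_scheme \<Rightarrow> 'g set \<Rightarrow> ('g, 'f, 'w, 'k) gmodule_scheme
    \<Rightarrow> ('g \<Rightarrow> 'f) \<Rightarrow> (('g \<Rightarrow> 'f) \<times> 'w \<Rightarrow>\<^sub>0 int) set \<Rightarrow> (('g \<Rightarrow> 'f) \<times> 'w \<Rightarrow>\<^sub>0 int) set"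
  where "tensor_lmult F G H W s C =
    tensor_relations F G H W <#>\<^bsub>tensor_free F G W\<^esub>
      frag_extend (\<lambda>(a, w). frag_of (s \<otimes>\<^bsub>group_algebra F G\<^esub> a, w)) ` C"

text \<open>\<open>F\<close> acts on \<open>FG \<otimes>\<^bsub>FH\<^esub> W\<close> through \<open>F \<cdot> 1 \<subseteq> FG\<close>, and \<open>G\<close> through its inclusion in \<open>FG\<close>.\<close>

definition induced ::
  "('f, 'm) ring_scheme \<Rightarrow> ('g, 'n) monoid_scheme \<Rightarrow> 'g set \<Rightarrow> ('g, 'f, 'w, 'k) gmodule_scheme
    \<Rightarrow> ('g, 'f, (('g \<Rightarrow> 'f) \<times> 'w \<Rightarrow>\<^sub>0 int) set) gmodule"
  where "induced F G H W =
   (let A = group_algebra F G; T = tensor_free F G W Mod tensor_relations F G H W in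
    \<lparr>carrier = carrier T,
     mult = undefined,
     one = undefined,
     zero = \<one>\<^bsub>T\<^esub>,
     add = mult T,
     smult = (\<lambda>c. tensor_lmult F G H W (c \<odot>\<^bsub>A\<^esub> \<one>\<^bsub>A\<^esub>)),
     gact = (\<lambda>g. tensor_lmult F G H W (galg_basis F g))\<rparr>)"


section \<open>Strongly ascendant subgroups\<close>

text \<open>The order of \<open>1\<close> in the additive group; \<^const>\<open>group.ord\<close> is \<open>0\<close> for infinite order.\<close>

definition ring_char :: "('f, 'm) ring_scheme \<Rightarrow> nat"
  where "ring_char R = group.ord (add_monoid R) \<one>\<^bsub>R\<^esub>"

definition immediate_succ :: "'i rel \<Rightarrow> 'i \<Rightarrow> 'i \<Rightarrow> bool"
  where "immediate_succ r x y \<longleftrightarrow>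
    (x, y) \<in> r \<and> x \<noteq> y \<and> (\<forall>z. (x, z) \<in> r \<and> (z, y) \<in> r \<longrightarrow> z = x \<or> z = y)"

text \<open>
  The family \<open>C\<close>, indexed by the set \<open>J\<close> with reflexive well-order \<open>r\<close>, witnesses that \<open>S\<close> is strongly
  ascendant in \<open>T\<close>. The index type cannot be quantified over inside a definition, so the witness
  is a parameter.
\<close>

definition strongly_ascendant_series ::
  "('f, 'm) ring_scheme \<Rightarrow> ('g, 'n) monoid_scheme \<Rightarrow> 'g set \<Rightarrow> 'i set \<Rightarrow> 'i rel \<Rightarrow> ('i \<Rightarrow> 'g set) \<Rightarrow> bool"
  where "strongly_ascendant_series F T S J r C \<longleftrightarrow>
    well_order_on J r \<and> (\<forall>x\<in>J. subgroup (C x) T) \<and>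
    (\<exists>x\<^sub>0\<in>J. \<exists>x\<^sub>1\<in>J.
      (\<forall>x\<in>J. (x\<^sub>0, x) \<in> r) \<and> (\<forall>x\<in>J. (x, x\<^sub>1) \<in> r) \<and>
      C x\<^sub>0 = S \<and> C x\<^sub>1 = carrier T \<and>
      (\<forall>x\<in>J. \<forall>x'\<in>J. x \<noteq> x\<^sub>1 \<and> immediate_succ r x x' \<longrightarrow>
        C x \<lhd> T\<lparr>carrier := C x'\<rparr> \<and>
        finite (rcosets\<^bsub>T\<lparr>carrier := C x'\<rparr>\<^esub> C x) \<and>
        \<not> ring_char F dvd card (rcosets\<^bsub>T\<lparr>carrier := C x'\<rparr>\<^esub> C x)) \<and>
      (\<forall>x\<in>J. x \<noteq> x\<^sub>0 \<and> \<not> (\<exists>y\<in>J. immediate_succ r y x) \<longrightarrow>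
        C x = (\<Union>y\<in>underS r x. C y)))"

end

theory Submission
  imports Defs
begin

text \<open>
  The coordinate \<open>\<pi>\<^sub>x : ind W \<rightarrow> W\<close> of an element of the induced module at \<open>x \<in> G\<close> is its component in
  \<open>x \<otimes> W\<close>, and it is equivariant for \<open>H \<inter> xHx\<^sup>-\<^sup>1\<close> with values in \<open>\<^sup>xW\<close>. Hence the hypothesis on
  \<open>(W, \<^sup>xW)\<close> says that every \<open>H\<close>-homomorphism from \<open>W\<close> to \<open>ind W\<close> has image in \<open>1 \<otimes> W\<close>, and
  \<open>(ind W, ind W)\<^sub>G = (W, W)\<^sub>H = 1\<close>.

  For irreducibility, take a nonzero submodule \<open>U\<close> and an element of \<open>U\<close> with as few nonzero
  components as possible. If \<open>K\<close> is normal in \<open>L\<close>, then the elements of \<open>U\<close> with no larger support form a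
  \<open>K\<close>-module on which each component map is injective. For (D1) the components of such an element at two
  cosets of \<open>H\<close> would relate \<open>W\<^sub>0\<close> to a conjugate by an element outside its inertia group. For (D3) one
  shows by transfinite induction along the series that the submodule of \<open>ind W\<close> supported on \<open>S\<^sub>x\<close> is
  irreducible; at a successor the inverse of the component map is a homomorphism from \<open>W\<close>, which
  therefore has image in \<open>1 \<otimes> W\<close>. For (D2) average a linear projection onto \<open>U\<close>: the result is a
  scalar, by the first part.
\<close>

section \<open>Homomorphisms of modules over group algebras\<close>

text \<open>For (D1) and (D3) neither a finite basis nor complete reducibility is at hand:
  \<open>G\<close> may be infinite and \<open>W\<close> infinite dimensional, so a submodule cannot
  be controlled by counting dimensions. What replaces this is that an element of the induced module
  has nonzero components at finitely many cosets only. If two elements have supports inside a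
  minimal one and the same component at a coset of it, their difference has smaller support and is
  zero. This is the source of every injectivity claim, and the maps so inverted are produced from
  their graphs by \<open>exists_ghom_of_relation\<close>. At a step where \<open>K\<close> is normal
  in \<open>L\<close>, supports are counted in cosets of \<open>K\<close>: within \<open>L\<close>,
  the group \<open>K\<close> fixes each of its own cosets, whereas it may permute those of
  \<open>H\<close>. All these arguments rest on the axioms of the locale
  \<open>induced_gmodule\<close>; the quotient of a free abelian group that defines the tensor
  product is shown afterwards to satisfy them.\<close>

lemma ghom_space_carrier_iff:
  "f \<in> carrier (ghom_space F G U V) \<longleftrightarrow>
    f \<in> module_hom F U V \<and> f \<in> extensional (carrier U) \<and>
    (\<forall>g\<in>carrier G. \<forall>x\<in>carrier U. f (gact U g x) = gact V g (f x))"
  by (auto simp: ghom_space_def)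

text \<open>Dropping \<open>extensional\<close> from \<open>ghom_space\<close> lets compositions and
  pointwise defined maps be homomorphisms as they stand; \<open>ghom_restrict\<close> translates
  back when a dimension is involved.\<close>

definition ghom ::
  "('f, 'm) ring_scheme \<Rightarrow> ('g, 'n) monoid_scheme \<Rightarrow> ('g, 'f, 'v, 'k) gmodule_scheme
    \<Rightarrow> ('g, 'f, 'w, 'l) gmodule_scheme \<Rightarrow> ('v \<Rightarrow> 'w) set"
  where "ghom F G U V = {f \<in> module_hom F U V.
    \<forall>g\<in>carrier G. \<forall>x\<in>carrier U. f (gact U g x) = gact V g (f x)}"

sublocale gmodule \<subseteq> vectorspace F V
  by (rule vectorspace)

section \<open>Elementary calculus in a group module and its submodules\<close>

context gmodule
begin

lemma act_closed [simp, intro]: "g \<in> carrier G \<Longrightarrow> v \<in> carrier V \<Longrightarrow> gact V g v \<in> carrier V"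
  using gact_linear[of g] by (auto simp: module_hom_def)

lemma act_add: "g \<in> carrier G \<Longrightarrow> v \<in> carrier V \<Longrightarrow> w \<in> carrier V \<Longrightarrow>
    gact V g (v \<oplus>\<^bsub>V\<^esub> w) = gact V g v \<oplus>\<^bsub>V\<^esub> gact V g w"
  using gact_linear[of g] by (auto simp: module_hom_def)

lemma act_smult: "g \<in> carrier G \<Longrightarrow> v \<in> carrier V \<Longrightarrow> c \<in> carrier F \<Longrightarrow>
    gact V g (c \<odot>\<^bsub>V\<^esub> v) = c \<odot>\<^bsub>V\<^esub> gact V g v"
  using gact_linear[of g] by (auto simp: module_hom_def)

lemma act_zero [simp]: "g \<in> carrier G \<Longrightarrow> gact V g \<zero>\<^bsub>V\<^esub> = \<zero>\<^bsub>V\<^esub>"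
  using act_smult[of g "\<zero>\<^bsub>V\<^esub>" "\<zero>\<^bsub>F\<^esub>"] by simp

lemma act_inv_act [simp]: "g \<in> carrier G \<Longrightarrow> v \<in> carrier V \<Longrightarrow> gact V (inv\<^bsub>G\<^esub> g) (gact V g v) = v"
  using gact_mult[of "inv\<^bsub>G\<^esub> g" g v] gact_one[of v] group
  by (simp add: group.l_inv)

lemma act_act_inv [simp]: "g \<in> carrier G \<Longrightarrow> v \<in> carrier V \<Longrightarrow> gact V g (gact V (inv\<^bsub>G\<^esub> g) v) = v"
  using gact_mult[of g "inv\<^bsub>G\<^esub> g" v] gact_one[of v] group
  by (simp add: group.r_inv)

lemma gsubmoduleI:
  assumes "U \<subseteq> carrier V" "\<zero>\<^bsub>V\<^esub> \<in> U"
    "\<And>u v. u \<in> U \<Longrightarrow> v \<in> U \<Longrightarrow> u \<oplus>\<^bsub>V\<^esub> v \<in> U"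
    "\<And>c u. c \<in> carrier F \<Longrightarrow> u \<in> U \<Longrightarrow> c \<odot>\<^bsub>V\<^esub> u \<in> U"
    "\<And>g u. g \<in> carrier G \<Longrightarrow> u \<in> U \<Longrightarrow> gact V g u \<in> U"
  shows "gsubmodule F G U V"
  unfolding gsubmodule_def subspace_def submodule_def
  using assms vectorspace module_axioms by auto

lemma gsubmoduleD:
  assumes "gsubmodule F G U V"
  shows "U \<subseteq> carrier V" "\<zero>\<^bsub>V\<^esub> \<in> U"
    "\<And>u v. u \<in> U \<Longrightarrow> v \<in> U \<Longrightarrow> u \<oplus>\<^bsub>V\<^esub> v \<in> U"
    "\<And>c u. c \<in> carrier F \<Longrightarrow> u \<in> U \<Longrightarrow> c \<odot>\<^bsub>V\<^esub> u \<in> U"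
    "\<And>g u. g \<in> carrier G \<Longrightarrow> u \<in> U \<Longrightarrow> gact V g u \<in> U"
  using assms by (auto simp: gsubmodule_def subspace_def submodule_def)

lemma minus_eq_smult: "v \<in> carrier V \<Longrightarrow> \<ominus>\<^bsub>V\<^esub> v = (\<ominus>\<^bsub>F\<^esub> \<one>\<^bsub>F\<^esub>) \<odot>\<^bsub>V\<^esub> v"
  by (simp add: smult_l_minus)

lemma gsubmodule_minus:
  assumes "gsubmodule F G U V" "u \<in> U" "v \<in> U"
  shows "u \<ominus>\<^bsub>V\<^esub> v \<in> U"
proof -
  have "v \<in> carrier V" using gsubmoduleD(1)[OF assms(1)] assms(3) by auto
  then have "u \<ominus>\<^bsub>V\<^esub> v = u \<oplus>\<^bsub>V\<^esub> (\<ominus>\<^bsub>F\<^esub> \<one>\<^bsub>F\<^esub>) \<odot>\<^bsub>V\<^esub> v"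
    by (simp add: a_minus_def minus_eq_smult)
  then show ?thesis using gsubmoduleD(3,4)[OF assms(1)] assms by simp
qed

lemma eq_if_minus_eq_zero:
  assumes "u \<in> carrier V" "v \<in> carrier V" "u \<ominus>\<^bsub>V\<^esub> v = \<zero>\<^bsub>V\<^esub>"
  shows "u = v"
proof -
  have "u \<oplus>\<^bsub>V\<^esub> \<ominus>\<^bsub>V\<^esub> v = \<zero>\<^bsub>V\<^esub>" using assms(3) by (simp add: a_minus_def)
  then have "\<ominus>\<^bsub>V\<^esub> (\<ominus>\<^bsub>V\<^esub> v) = u" using assms by (intro M.minus_equality) auto
  then show ?thesis using assms by simp
qed

lemma gsubmodule_Int:
  assumes T: "gsubmodule F G T V" and U: "gsubmodule F G U V"
  shows "gsubmodule F G (T \<inter> U) V"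
proof (rule gsubmoduleI)
  show "T \<inter> U \<subseteq> carrier V" using gsubmoduleD(1)[OF T] by blast
  show "\<zero>\<^bsub>V\<^esub> \<in> T \<inter> U" using gsubmoduleD(2)[OF T] gsubmoduleD(2)[OF U] by simp
  show "u \<oplus>\<^bsub>V\<^esub> v \<in> T \<inter> U" if "u \<in> T \<inter> U" "v \<in> T \<inter> U" for u v
    using gsubmoduleD(3)[OF T, of u v] gsubmoduleD(3)[OF U, of u v] that by simp
  show "c \<odot>\<^bsub>V\<^esub> u \<in> T \<inter> U" if "c \<in> carrier F" "u \<in> T \<inter> U" for c u
    using gsubmoduleD(4)[OF T, of c u] gsubmoduleD(4)[OF U, of c u] that by simp
  show "gact V g u \<in> T \<inter> U" if "g \<in> carrier G" "u \<in> T \<inter> U" for g u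
    using gsubmoduleD(5)[OF T, of g u] gsubmoduleD(5)[OF U, of g u] that by simp
qed

lemma smult_left_imp_zero:
  assumes "c \<in> carrier F" "v \<in> carrier V" "c \<odot>\<^bsub>V\<^esub> v = \<zero>\<^bsub>V\<^esub>" "v \<noteq> \<zero>\<^bsub>V\<^esub>"
  shows "c = \<zero>\<^bsub>F\<^esub>"
proof (rule ccontr)
  assume c: "c \<noteq> \<zero>\<^bsub>F\<^esub>"
  then have "inv\<^bsub>F\<^esub> c \<in> carrier F" "inv\<^bsub>F\<^esub> c \<otimes>\<^bsub>F\<^esub> c = \<one>\<^bsub>F\<^esub>"
    using assms(1) field_Units by auto
  then have "v = inv\<^bsub>F\<^esub> c \<odot>\<^bsub>V\<^esub> (c \<odot>\<^bsub>V\<^esub> v)"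
    using assms smult_assoc1[of "inv\<^bsub>F\<^esub> c" c v] by simp
  then show False using assms \<open>inv\<^bsub>F\<^esub> c \<in> carrier F\<close> by simp
qed

lemma smult_comm:
  "c \<in> carrier F \<Longrightarrow> d \<in> carrier F \<Longrightarrow> v \<in> carrier V \<Longrightarrow>
    c \<odot>\<^bsub>V\<^esub> (d \<odot>\<^bsub>V\<^esub> v) = d \<odot>\<^bsub>V\<^esub> (c \<odot>\<^bsub>V\<^esub> v)"
  using cring.cring_simprules(14)[of F c d] smult_assoc1[of c d v] smult_assoc1[of d c v]
    module.axioms(1)[OF module_axioms] by simp

lemma restrict_group:
  assumes "subgroup K G"
  shows "gmodule F (G\<lparr>carrier := K\<rparr>) V"
proof -
  have "K \<subseteq> carrier G" using assms subgroup.subset by blast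
  then show ?thesis
    using subgroup.subgroup_is_group[OF assms group] vectorspace gact_linear gact_one gact_mult
    by (intro gmodule.intro) (auto simp: subset_iff)
qed

end

lemma gsubmodule_mono:
  "gsubmodule F (G\<lparr>carrier := L\<rparr>) U V \<Longrightarrow> K \<subseteq> L \<Longrightarrow> gsubmodule F (G\<lparr>carrier := K\<rparr>) U V"
  unfolding gsubmodule_def by simp blast

section \<open>Homomorphisms and their construction from graphs\<close>

lemma module_hom_eqs:
  assumes "f \<in> module_hom F U V"
  shows "u \<in> carrier U \<Longrightarrow> f u \<in> carrier V"
    "u \<in> carrier U \<Longrightarrow> v \<in> carrier U \<Longrightarrow> f (u \<oplus>\<^bsub>U\<^esub> v) = f u \<oplus>\<^bsub>V\<^esub> f v"
    "c \<in> carrier F \<Longrightarrow> u \<in> carrier U \<Longrightarrow> f (c \<odot>\<^bsub>U\<^esub> u) = c \<odot>\<^bsub>V\<^esub> f u"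
  using assms by (auto simp: module_hom_def)

lemma ghomD:
  assumes "f \<in> ghom F G U V"
  shows "u \<in> carrier U \<Longrightarrow> f u \<in> carrier V"
    "u \<in> carrier U \<Longrightarrow> v \<in> carrier U \<Longrightarrow> f (u \<oplus>\<^bsub>U\<^esub> v) = f u \<oplus>\<^bsub>V\<^esub> f v"
    "c \<in> carrier F \<Longrightarrow> u \<in> carrier U \<Longrightarrow> f (c \<odot>\<^bsub>U\<^esub> u) = c \<odot>\<^bsub>V\<^esub> f u"
    "g \<in> carrier G \<Longrightarrow> u \<in> carrier U \<Longrightarrow> f (gact U g u) = gact V g (f u)"
  using assms by (auto simp: ghom_def module_hom_def)

lemma ghomI:
  assumes "\<And>u. u \<in> carrier U \<Longrightarrow> f u \<in> carrier V"
    "\<And>u v. u \<in> carrier U \<Longrightarrow> v \<in> carrier U \<Longrightarrow> f (u \<oplus>\<^bsub>U\<^esub> v) = f u \<oplus>\<^bsub>V\<^esub> f v"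
    "\<And>c u. c \<in> carrier F \<Longrightarrow> u \<in> carrier U \<Longrightarrow> f (c \<odot>\<^bsub>U\<^esub> u) = c \<odot>\<^bsub>V\<^esub> f u"
    "\<And>g u. g \<in> carrier G \<Longrightarrow> u \<in> carrier U \<Longrightarrow> f (gact U g u) = gact V g (f u)"
  shows "f \<in> ghom F G U V"
  using assms by (auto simp: ghom_def module_hom_def)

lemma ghom_zero:
  assumes "gmodule F G U" "gmodule F G V" "f \<in> ghom F G U V"
  shows "f \<zero>\<^bsub>U\<^esub> = \<zero>\<^bsub>V\<^esub>"
proof -
  interpret U: gmodule F G U by fact
  interpret V: gmodule F G V by fact
  have "f (\<zero>\<^bsub>F\<^esub> \<odot>\<^bsub>U\<^esub> \<zero>\<^bsub>U\<^esub>) = \<zero>\<^bsub>F\<^esub> \<odot>\<^bsub>V\<^esub> f \<zero>\<^bsub>U\<^esub>"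
    by (rule ghomD(3)[OF assms(3)]) auto
  then show ?thesis using ghomD(1)[OF assms(3)] by simp
qed

lemma ghom_restrict:
  assumes "gmodule F G U"
  shows "restrict f (carrier U) \<in> carrier (ghom_space F G U V) \<longleftrightarrow> f \<in> ghom F G U V"
proof -
  interpret U: gmodule F G U by fact
  show ?thesis by (auto simp: ghom_space_carrier_iff ghom_def module_hom_def Pi_iff)
qed

lemma ghom_space_subset: "f \<in> carrier (ghom_space F G U V) \<Longrightarrow> f \<in> ghom F G U V"
  by (auto simp: ghom_space_carrier_iff ghom_def)

text \<open>\<open>R\<close> plays the part of a submodule of \<open>U \<oplus> V\<close> that
  projects onto \<open>U\<close> and meets \<open>V\<close> only in zero, hence of the graph of a
  homomorphism. Inverses of injective homomorphisms, lifts through them and the projection along a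
  complement are all obtained this way.\<close>

lemma exists_ghom_of_relation:
  assumes U: "gmodule F K U" and V: "gmodule F K V"
    and total: "\<And>u. u \<in> carrier U \<Longrightarrow> \<exists>v. R u v"
    and closed: "\<And>u v. R u v \<Longrightarrow> v \<in> carrier V"
    and kernel: "\<And>v. R \<zero>\<^bsub>U\<^esub> v \<Longrightarrow> v = \<zero>\<^bsub>V\<^esub>"
    and add: "\<And>u u' v v'. u \<in> carrier U \<Longrightarrow> u' \<in> carrier U \<Longrightarrow> R u v \<Longrightarrow> R u' v' \<Longrightarrow>
      R (u \<oplus>\<^bsub>U\<^esub> u') (v \<oplus>\<^bsub>V\<^esub> v')"
    and smult: "\<And>c u v. c \<in> carrier F \<Longrightarrow> u \<in> carrier U \<Longrightarrow> R u v \<Longrightarrow>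
      R (c \<odot>\<^bsub>U\<^esub> u) (c \<odot>\<^bsub>V\<^esub> v)"
    and act: "\<And>g u v. g \<in> carrier K \<Longrightarrow> u \<in> carrier U \<Longrightarrow> R u v \<Longrightarrow>
      R (gact U g u) (gact V g v)"
  shows "\<exists>f\<in>ghom F K U V. \<forall>u\<in>carrier U. R u (f u)"
proof -
  interpret U: gmodule F K U by fact
  interpret V: gmodule F K V by fact
  \<comment> \<open>Two values over the same \<open>u\<close> differ by a value over zero, so
    \<open>kernel\<close> makes the relation single-valued; each law for the chosen function then
    follows from uniqueness.\<close>
  have unique: "v = v'" if "u \<in> carrier U" "R u v" "R u v'" for u v v'
  proof (rule V.eq_if_minus_eq_zero)
    have "R (u \<oplus>\<^bsub>U\<^esub> (\<ominus>\<^bsub>F\<^esub> \<one>\<^bsub>F\<^esub>) \<odot>\<^bsub>U\<^esub> u) (v \<oplus>\<^bsub>V\<^esub> (\<ominus>\<^bsub>F\<^esub> \<one>\<^bsub>F\<^esub>) \<odot>\<^bsub>V\<^esub> v')"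
      using that by (intro add smult) auto
    then show "v \<ominus>\<^bsub>V\<^esub> v' = \<zero>\<^bsub>V\<^esub>"
      using that closed
      by (intro kernel) (simp add: U.minus_eq_smult[symmetric] V.minus_eq_smult[symmetric] U.M.r_neg a_minus_def)
  qed (use that closed in auto)
  define f where "f u = (SOME v. R u v)" for u
  have f: "R u (f u)" if "u \<in> carrier U" for u
    unfolding f_def using total[OF that] by (rule someI_ex)
  have "f \<in> ghom F K U V"
  proof (rule ghomI)
    show "f (u \<oplus>\<^bsub>U\<^esub> v) = f u \<oplus>\<^bsub>V\<^esub> f v" if "u \<in> carrier U" "v \<in> carrier U" for u v
      by (rule unique[OF _ f add]) (use that f in auto)
    show "f (c \<odot>\<^bsub>U\<^esub> u) = c \<odot>\<^bsub>V\<^esub> f u" if "c \<in> carrier F" "u \<in> carrier U" for c u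
      by (rule unique[OF _ f smult]) (use that f in auto)
    show "f (gact U g u) = gact V g (f u)" if "g \<in> carrier K" "u \<in> carrier U" for g u
      by (rule unique[OF _ f act]) (use that f in auto)
  qed (use f closed in auto)
  then show ?thesis using f by blast
qed

section \<open>The vector space of homomorphisms and its dimension\<close>

lemma vectorspace_ghom_space:
  assumes U: "gmodule F G U" and V: "gmodule F G V"
  shows "vectorspace F (ghom_space F G U V)"
proof -
  interpret U: gmodule F G U by fact
  interpret V: gmodule F G V by fact
  let ?X = "ghom_space F G U V"
  have ext: "f = h" if "f \<in> carrier ?X" "h \<in> extensional (carrier U)" "\<And>x. x \<in> carrier U \<Longrightarrow> f x = h x" for f h
    using that by (intro extensionalityI[of f "carrier U"]) (auto simp: ghom_space_carrier_iff)
  have z: "\<zero>\<^bsub>?X\<^esub> = (\<lambda>x\<in>carrier U. \<zero>\<^bsub>V\<^esub>)" and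
    a: "\<And>f h. f \<oplus>\<^bsub>?X\<^esub> h = (\<lambda>x\<in>carrier U. f x \<oplus>\<^bsub>V\<^esub> h x)" and
    s: "\<And>c f. c \<odot>\<^bsub>?X\<^esub> f = (\<lambda>x\<in>carrier U. c \<odot>\<^bsub>V\<^esub> f x)"
    by (simp_all add: ghom_space_def)
  note D = ghomD[OF ghom_space_subset]
  have zc: "\<zero>\<^bsub>?X\<^esub> \<in> carrier ?X"
    unfolding z ghom_restrict[OF U] by (rule ghomI) auto
  have ac: "f \<oplus>\<^bsub>?X\<^esub> h \<in> carrier ?X" if "f \<in> carrier ?X" "h \<in> carrier ?X" for f h
    unfolding a ghom_restrict[OF U]
    by (rule ghomI)
      (use that in \<open>auto simp: D V.M.add.m_ac V.smult_r_distr V.act_add\<close>)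
  have sc: "c \<odot>\<^bsub>?X\<^esub> h \<in> carrier ?X" if "c \<in> carrier F" "h \<in> carrier ?X" for c h
    unfolding s ghom_restrict[OF U]
    by (rule ghomI)
      (use that in \<open>auto simp: D V.smult_r_distr V.act_smult V.smult_comm[of c]\<close>)
  have neg: "\<exists>h\<in>carrier ?X. f \<oplus>\<^bsub>?X\<^esub> h = \<zero>\<^bsub>?X\<^esub>" if f: "f \<in> carrier ?X" for f
  proof (rule bexI)
    show "(\<ominus>\<^bsub>F\<^esub> \<one>\<^bsub>F\<^esub>) \<odot>\<^bsub>?X\<^esub> f \<in> carrier ?X" using sc f by simp
    show "f \<oplus>\<^bsub>?X\<^esub> ((\<ominus>\<^bsub>F\<^esub> \<one>\<^bsub>F\<^esub>) \<odot>\<^bsub>?X\<^esub> f) = \<zero>\<^bsub>?X\<^esub>"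
      using f by (auto simp: a s z D V.smult_l_minus V.M.r_neg intro!: restrict_ext)
  qed
  show ?thesis
  proof (rule vs_criteria)
    show "field F" using V.vectorspace by (simp add: vectorspace_def)
  next
    show "\<forall>v w. v \<in> carrier ?X \<and> w \<in> carrier ?X \<longrightarrow> v \<oplus>\<^bsub>?X\<^esub> w = w \<oplus>\<^bsub>?X\<^esub> v"
      by (auto simp: a D V.M.add.m_comm intro!: restrict_ext)
  next
    show "\<forall>v w x. v \<in> carrier ?X \<and> w \<in> carrier ?X \<and> x \<in> carrier ?X \<longrightarrow>
      v \<oplus>\<^bsub>?X\<^esub> w \<oplus>\<^bsub>?X\<^esub> x = v \<oplus>\<^bsub>?X\<^esub> (w \<oplus>\<^bsub>?X\<^esub> x)"
      by (auto simp: a D V.M.add.m_assoc intro!: restrict_ext)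
  next
    show "\<forall>v\<in>carrier ?X. v \<oplus>\<^bsub>?X\<^esub> \<zero>\<^bsub>?X\<^esub> = v"
      by (auto simp: a z D intro!: ext[symmetric])
  next
    show "\<forall>v\<in>carrier ?X. \<one>\<^bsub>F\<^esub> \<odot>\<^bsub>?X\<^esub> v = v"
      by (auto simp: s D intro!: ext[symmetric])
  qed (use zc ac sc neg in \<open>auto simp: a s D V.smult_assoc1 V.smult_l_distr V.smult_r_distr intro!: restrict_ext\<close>)
qed

text \<open>The value \<open>0\<close> rules out the branch \<open>\<infinity>\<close>, so the Hom
  space has a finite basis, necessarily empty, and the empty set spans only zero.\<close>

lemma ghom_eq_zero:
  assumes U: "gmodule F G U" and V: "gmodule F G V" and i: "intertwining_number F G U V = 0"
    and f: "f \<in> ghom F G U V" and x: "x \<in> carrier U"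
  shows "f x = \<zero>\<^bsub>V\<^esub>"
proof -
  let ?X = "ghom_space F G U V"
  interpret X: vectorspace F ?X by (rule vectorspace_ghom_space[OF U V])
  have fd: "X.fin_dim" and d: "X.dim = 0"
    using i by (auto simp: intertwining_number_def zero_enat_def split: if_splits)
  obtain B where B: "finite B" "X.basis B" using X.finite_basis_exists[OF fd] by blast
  then have "B = {}" using X.dim_basis d by auto
  then have "carrier ?X = X.span {}" using B by (simp add: X.basis_def)
  also have "\<dots> = {\<zero>\<^bsub>?X\<^esub>}" by (auto simp: X.span_def X.lincomb_def)
  finally have "restrict f (carrier U) = \<zero>\<^bsub>?X\<^esub>" using f ghom_restrict[OF U, of f V] by auto
  then have "restrict f (carrier U) x = \<zero>\<^bsub>?X\<^esub> x" by simp
  then show ?thesis using x by (simp add: ghom_space_def)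
qed

text \<open>The basis vector \<open>b\<close> obtained from the dimension need not be the identity.
  Both the identity and \<open>f\<close> are multiples of \<open>b\<close>, and the factor of the
  identity can be divided out because \<open>U\<close> is nonzero.\<close>

lemma ghom_scalar:
  assumes U: "gmodule F G U" and i: "intertwining_number F G U U = 1"
    and f: "f \<in> ghom F G U U" and ne: "carrier U \<noteq> {\<zero>\<^bsub>U\<^esub>}"
  shows "\<exists>c\<in>carrier F. \<forall>x\<in>carrier U. f x = c \<odot>\<^bsub>U\<^esub> x"
proof -
  interpret U: gmodule F G U by fact
  let ?X = "ghom_space F G U U"
  interpret X: vectorspace F ?X by (rule vectorspace_ghom_space[OF U U])
  have fd: "X.fin_dim" and d: "X.dim = 1"
    using i by (auto simp: intertwining_number_def one_enat_def split: if_splits)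
  obtain B where B: "finite B" "X.basis B" using X.finite_basis_exists[OF fd] by blast
  then have "card B = 1" using X.dim_basis d by auto
  then obtain b where b: "B = {b}" by (auto simp: card_1_singleton_iff)
  have bX: "b \<in> carrier ?X" and X: "carrier ?X = X.span {b}" using B by (auto simp: X.basis_def b)
  have "\<exists>c\<in>carrier F. \<forall>x\<in>carrier U. h x = c \<odot>\<^bsub>U\<^esub> b x" if h: "h \<in> ghom F G U U" for h
  proof -
    have "restrict h (carrier U) \<in> X.span {b}" using h ghom_restrict[OF U, of h U] X by simp
    then obtain c where c: "c \<in> {b} \<rightarrow> carrier F" "restrict h (carrier U) = X.lincomb c {b}"
      using X.finite_span[of "{b}"] bX by auto
    then have "restrict h (carrier U) = c b \<odot>\<^bsub>?X\<^esub> b"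
      using bX by (simp add: X.lincomb_def)
    then have "restrict h (carrier U) x = (c b \<odot>\<^bsub>?X\<^esub> b) x" for x by simp
    then have "\<forall>x\<in>carrier U. h x = c b \<odot>\<^bsub>U\<^esub> b x"
      by (simp add: ghom_space_def) metis
    then show ?thesis using c by auto
  qed note * = this
  have "(\<lambda>x. x) \<in> ghom F G U U" by (rule ghomI) auto
  from *[OF this] obtain c where c: "c \<in> carrier F" "\<And>x. x\<in>carrier U \<Longrightarrow> x = c \<odot>\<^bsub>U\<^esub> b x" by blast
  from *[OF f] obtain d where d: "d \<in> carrier F" "\<And>x. x\<in>carrier U \<Longrightarrow> f x = d \<odot>\<^bsub>U\<^esub> b x" by blast
  have bc: "b x \<in> carrier U" if "x \<in> carrier U" for x
    using ghomD(1)[OF ghom_space_subset[OF bX] that] .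
  have c0: "c \<noteq> \<zero>\<^bsub>F\<^esub>"
  proof
    assume "c = \<zero>\<^bsub>F\<^esub>"
    then have "x = \<zero>\<^bsub>U\<^esub>" if "x \<in> carrier U" for x using c(2)[OF that] bc[OF that] by simp
    then show False using ne by auto
  qed
  then have ci: "inv\<^bsub>F\<^esub> c \<in> carrier F" "inv\<^bsub>F\<^esub> c \<otimes>\<^bsub>F\<^esub> c = \<one>\<^bsub>F\<^esub>" using c(1) U.field_Units by auto
  have "f x = (d \<otimes>\<^bsub>F\<^esub> inv\<^bsub>F\<^esub> c) \<odot>\<^bsub>U\<^esub> x" if x: "x \<in> carrier U" for x
  proof -
    have "(d \<otimes>\<^bsub>F\<^esub> inv\<^bsub>F\<^esub> c) \<odot>\<^bsub>U\<^esub> x = (d \<otimes>\<^bsub>F\<^esub> inv\<^bsub>F\<^esub> c) \<odot>\<^bsub>U\<^esub> (c \<odot>\<^bsub>U\<^esub> b x)" using c(2)[OF x] by simp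
    also have "\<dots> = (d \<otimes>\<^bsub>F\<^esub> inv\<^bsub>F\<^esub> c \<otimes>\<^bsub>F\<^esub> c) \<odot>\<^bsub>U\<^esub> b x"
      using c(1) d(1) ci(1) bc[OF x] by (intro U.smult_assoc1[symmetric]) auto
    also have "\<dots> = d \<odot>\<^bsub>U\<^esub> b x" using c(1) d(1) ci by (simp add: U.R.m_assoc)
    finally show ?thesis using d(2)[OF x] by simp
  qed
  then show ?thesis using d(1) ci(1) by (intro bexI[of _ "d \<otimes>\<^bsub>F\<^esub> inv\<^bsub>F\<^esub> c"]) auto
qed

text \<open>Converse of \<open>ghom_scalar\<close>: the identity, cut down to the carrier, spans by
  \<open>sc\<close> and is independent because some vector is nonzero, so it forms a basis.\<close>

lemma intertwining_number_eq_1: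
  assumes U: "gmodule F G U" and ne: "carrier U \<noteq> {\<zero>\<^bsub>U\<^esub>}"
    and sc: "\<And>f. f \<in> ghom F G U U \<Longrightarrow> \<exists>c\<in>carrier F. \<forall>x\<in>carrier U. f x = c \<odot>\<^bsub>U\<^esub> x"
  shows "intertwining_number F G U U = 1"
proof -
  interpret U: gmodule F G U by fact
  let ?X = "ghom_space F G U U"
  interpret X: vectorspace F ?X by (rule vectorspace_ghom_space[OF U U])
  let ?b = "restrict (\<lambda>x. x) (carrier U)"
  have bX: "?b \<in> carrier ?X" unfolding ghom_restrict[OF U] by (rule ghomI) auto
  have lc: "X.lincomb c {?b} = c ?b \<odot>\<^bsub>?X\<^esub> ?b" if "c ?b \<in> carrier F" for c
    using bX that by (simp add: X.lincomb_def)
  have gen: "X.span {?b} = carrier ?X"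
  proof
    show "X.span {?b} \<subseteq> carrier ?X" using bX by (auto simp: X.span_def)
  next
    show "carrier ?X \<subseteq> X.span {?b}"
    proof
      fix f assume f: "f \<in> carrier ?X"
      obtain c where c: "c \<in> carrier F" "\<forall>x\<in>carrier U. f x = c \<odot>\<^bsub>U\<^esub> x"
        using sc[OF ghom_space_subset[OF f]] by blast
      have "f = c \<odot>\<^bsub>?X\<^esub> ?b"
        using f c by (intro extensionalityI[of _ "carrier U"])
          (auto simp: ghom_space_carrier_iff, simp_all add: ghom_space_def)
      also have "\<dots> = X.lincomb (\<lambda>_. c) {?b}" using lc[of "\<lambda>_. c"] c by simp
      finally show "f \<in> X.span {?b}" unfolding X.span_def using c(1) by blast
    qed
  qed
  have li: "X.lin_indpt {?b}"
  proof (rule X.finite_lin_indpt2)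
    fix a assume a: "a \<in> {?b} \<rightarrow> carrier F" "X.lincomb a {?b} = \<zero>\<^bsub>?X\<^esub>"
    obtain x where x: "x \<in> carrier U" "x \<noteq> \<zero>\<^bsub>U\<^esub>" using ne U.M.zero_closed by blast
    have "(a ?b \<odot>\<^bsub>?X\<^esub> ?b) x = \<zero>\<^bsub>?X\<^esub> x" using a lc[of a] by auto
    then have "a ?b \<odot>\<^bsub>U\<^esub> x = \<zero>\<^bsub>U\<^esub>" using x by (simp add: ghom_space_def)
    then show "\<forall>v\<in>{?b}. a v = \<zero>\<^bsub>F\<^esub>" using U.smult_left_imp_zero x a by auto
  qed (use bX in auto)
  have "X.basis {?b}" using gen li bX by (auto simp: X.basis_def)
  then have "X.dim = 1" using X.dim_basis[of "{?b}"] by simp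
  moreover have "X.fin_dim" unfolding X.fin_dim_def using gen bX by blast
  ultimately show ?thesis by (simp add: intertwining_number_def one_enat_def)
qed

section \<open>Coordinates of an induced module\<close>

sublocale gmodule \<subseteq> grp: group G
  by (rule group)

section \<open>Left cosets of a subgroup\<close>

lemma (in group) mult_inv_mult_cancel:
  assumes "x \<in> carrier G" "y \<in> carrier G"
  shows "x \<otimes> (inv x \<otimes> y) = y" "inv x \<otimes> (x \<otimes> y) = y"
  using assms by (simp_all add: m_assoc[symmetric])

lemma (in group) mem_l_coset_iff:
  assumes "subgroup K G" "x \<in> carrier G"
  shows "y \<in> x <# K \<longleftrightarrow> y \<in> carrier G \<and> inv x \<otimes> y \<in> K"
proof -
  have K: "K \<subseteq> carrier G" using assms(1) by (rule subgroup.subset)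
  show ?thesis
  proof
    assume "y \<in> x <# K"
    then obtain k where "k \<in> K" "y = x \<otimes> k" by (auto simp: l_coset_def)
    then show "y \<in> carrier G \<and> inv x \<otimes> y \<in> K"
      using K assms(2) by (auto simp: m_assoc[symmetric] subset_iff)
  next
    assume y: "y \<in> carrier G \<and> inv x \<otimes> y \<in> K"
    then have "y = x \<otimes> (inv x \<otimes> y)" using assms(2) by (simp add: m_assoc[symmetric])
    then show "y \<in> x <# K" using y unfolding l_coset_def by blast
  qed
qed

lemma (in group) l_coset_eq_iff:
  assumes "subgroup K G" "x \<in> carrier G" "y \<in> carrier G"
  shows "x <# K = y <# K \<longleftrightarrow> inv x \<otimes> y \<in> K"
proof
  assume "x <# K = y <# K"
  moreover have "y \<in> y <# K"
    using assms by (simp add: mem_l_coset_iff subgroup.one_closed)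
  ultimately have "y \<in> x <# K" by simp
  then show "inv x \<otimes> y \<in> K" using assms by (simp add: mem_l_coset_iff)
next
  assume "inv x \<otimes> y \<in> K"
  then have "y \<in> x <# K" using assms by (simp add: mem_l_coset_iff)
  then show "x <# K = y <# K" using assms l_repr_independence by blast
qed

lemma (in group) l_coset_one:
  assumes "subgroup K G" "x \<in> carrier G"
  shows "x <# K = \<one> <# K \<longleftrightarrow> x \<in> K"
proof -
  have "\<one> <# K = x <# K \<longleftrightarrow> x \<in> K" using assms by (simp add: l_coset_eq_iff)
  then show ?thesis by auto
qed

text \<open>These axioms determine \<open>V\<close> up to isomorphism as the induced module: the
  translates of the image of \<open>\<iota>\<close> generate it, and the coordinates leave no
  relations between different cosets. Only additivity of \<open>\<pi>\<close> is assumed; its other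
  laws are checked on generators by \<open>generated\<close>, which has the form of an induction
  rule for this purpose.\<close>

locale induced_gmodule =
  V: gmodule F G V + W: gmodule F "G\<lparr>carrier := H\<rparr>" W
  for F :: "('f, 'm) ring_scheme" and G :: "('g, 'n) monoid_scheme" (structure)
    and V :: "('g, 'f, 'v, 'k) gmodule_scheme"
    and H :: "'g set" and W :: "('g, 'f, 'w, 'l) gmodule_scheme" +
  fixes \<iota> :: "'w \<Rightarrow> 'v" and \<pi> :: "'g \<Rightarrow> 'v \<Rightarrow> 'w"
  assumes subgroup_H: "subgroup H G"
    and emb_ghom: "\<iota> \<in> ghom F (G\<lparr>carrier := H\<rparr>) W V"
    and coord_closed [simp, intro]: "x \<in> carrier G \<Longrightarrow> v \<in> carrier V \<Longrightarrow> \<pi> x v \<in> carrier W"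
    and coord_add: "x \<in> carrier G \<Longrightarrow> u \<in> carrier V \<Longrightarrow> v \<in> carrier V \<Longrightarrow>
      \<pi> x (u \<oplus>\<^bsub>V\<^esub> v) = \<pi> x u \<oplus>\<^bsub>W\<^esub> \<pi> x v"
    and coord_act_emb: "x \<in> carrier G \<Longrightarrow> g \<in> carrier G \<Longrightarrow> w \<in> carrier W \<Longrightarrow>
      \<pi> x (gact V g (\<iota> w)) = (if inv x \<otimes> g \<in> H then gact W (inv x \<otimes> g) w else \<zero>\<^bsub>W\<^esub>)"
    and generated [consumes 1, case_names emb add]: "v \<in> carrier V \<Longrightarrow>
      (\<And>g w. g \<in> carrier G \<Longrightarrow> w \<in> carrier W \<Longrightarrow> P (gact V g (\<iota> w))) \<Longrightarrow>
      (\<And>u v. u \<in> carrier V \<Longrightarrow> v \<in> carrier V \<Longrightarrow> P u \<Longrightarrow> P v \<Longrightarrow> P (u \<oplus>\<^bsub>V\<^esub> v)) \<Longrightarrow> P v"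
begin

section \<open>Calculus of the coordinates\<close>

lemma H_sub [simp]: "h \<in> H \<Longrightarrow> h \<in> carrier G"
  using subgroup.subset[OF subgroup_H] by auto

lemma H_one [simp]: "\<one> \<in> H" using subgroup_H by (rule subgroup.one_closed)
lemma H_mult [simp]: "h \<in> H \<Longrightarrow> k \<in> H \<Longrightarrow> h \<otimes> k \<in> H"
  using subgroup_H by (rule subgroup.m_closed)
lemma H_inv [simp]: "h \<in> H \<Longrightarrow> inv h \<in> H" using subgroup_H by (rule subgroup.m_inv_closed)

lemma actH_closed [simp, intro]: "h \<in> H \<Longrightarrow> w \<in> carrier W \<Longrightarrow> gact W h w \<in> carrier W"
  using W.act_closed[of h w] by simp

lemma actH_mult: "h \<in> H \<Longrightarrow> k \<in> H \<Longrightarrow> w \<in> carrier W \<Longrightarrow>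
    gact W (h \<otimes> k) w = gact W h (gact W k w)"
  using W.gact_mult[of h k w] by simp

lemma actH_one: "w \<in> carrier W \<Longrightarrow> gact W \<one> w = w"
  using W.gact_one[of w] by simp

lemma emb_closed [simp, intro]: "w \<in> carrier W \<Longrightarrow> \<iota> w \<in> carrier V"
  using ghomD(1)[OF emb_ghom] .

lemma emb_add: "u \<in> carrier W \<Longrightarrow> w \<in> carrier W \<Longrightarrow> \<iota> (u \<oplus>\<^bsub>W\<^esub> w) = \<iota> u \<oplus>\<^bsub>V\<^esub> \<iota> w"
  using ghomD(2)[OF emb_ghom] .

lemma emb_smult: "c \<in> carrier F \<Longrightarrow> w \<in> carrier W \<Longrightarrow> \<iota> (c \<odot>\<^bsub>W\<^esub> w) = c \<odot>\<^bsub>V\<^esub> \<iota> w"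
  using ghomD(3)[OF emb_ghom] .

lemma emb_act: "h \<in> H \<Longrightarrow> w \<in> carrier W \<Longrightarrow> \<iota> (gact W h w) = gact V h (\<iota> w)"
  using ghomD(4)[OF emb_ghom, of h w] by simp

lemma emb_zero: "\<iota> \<zero>\<^bsub>W\<^esub> = \<zero>\<^bsub>V\<^esub>"
  using emb_smult[of "\<zero>\<^bsub>F\<^esub>" "\<zero>\<^bsub>W\<^esub>"] by simp

lemma coord_smult:
  assumes "v \<in> carrier V" and x: "x \<in> carrier G" and c: "c \<in> carrier F"
  shows "\<pi> x (c \<odot>\<^bsub>V\<^esub> v) = c \<odot>\<^bsub>W\<^esub> \<pi> x v"
  using assms(1)
proof (induction rule: generated)
  case (emb g w)
  have "c \<odot>\<^bsub>V\<^esub> gact V g (\<iota> w) = gact V g (\<iota> (c \<odot>\<^bsub>W\<^esub> w))"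
    using emb c by (simp add: emb_smult V.act_smult)
  then show ?case using emb x c W.act_smult[of "inv x \<otimes> g" w c] by (simp add: coord_act_emb)
next
  case (add u v)
  then show ?case using x c by (simp add: V.smult_r_distr W.smult_r_distr coord_add)
qed

lemma coord_act:
  assumes "v \<in> carrier V" and x: "x \<in> carrier G" and g: "g \<in> carrier G"
  shows "\<pi> x (gact V g v) = \<pi> (inv g \<otimes> x) v"
  using assms(1)
proof (induction rule: generated)
  case (emb k w)
  have "inv (inv g \<otimes> x) \<otimes> k = inv x \<otimes> (g \<otimes> k)"
    using x g emb by (simp add: V.grp.inv_mult_group V.grp.m_assoc)
  moreover have "gact V g (gact V k (\<iota> w)) = gact V (g \<otimes> k) (\<iota> w)"
    using g emb by (simp add: V.gact_mult)
  ultimately show ?case using emb x g by (simp add: coord_act_emb)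
next
  case (add u v)
  then show ?case using x g by (simp add: V.act_add coord_add)
qed

text \<open>Passing to another representative of a coset twists the component by an element of
  \<open>H\<close>; so whether a component vanishes depends on the coset alone.\<close>

lemma coord_right:
  assumes "v \<in> carrier V" and x: "x \<in> carrier G" and h: "h \<in> H"
  shows "\<pi> (x \<otimes> h) v = gact W (inv h) (\<pi> x v)"
  using assms(1)
proof (induction rule: generated)
  case (emb g w)
  have eq: "inv (x \<otimes> h) \<otimes> g = inv h \<otimes> (inv x \<otimes> g)"
    using x h emb by (simp add: V.grp.inv_mult_group V.grp.m_assoc)
  have "inv x \<otimes> g = h \<otimes> (inv h \<otimes> (inv x \<otimes> g))"
    using x h emb by (simp add: V.grp.m_assoc[symmetric])
  then have iff: "inv h \<otimes> (inv x \<otimes> g) \<in> H \<longleftrightarrow> inv x \<otimes> g \<in> H"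
    using h by (metis H_inv H_mult)
  show ?case
    using emb x h W.act_zero[of "inv h"] by (simp add: coord_act_emb eq iff actH_mult)
next
  case (add u v)
  then show ?case using x h W.act_add[of "inv h"] by (simp add: coord_add)
qed

text \<open>The condition on \<open>n\<close> says that \<open>n\<close> fixes the coset of
  \<open>x\<close>: \<open>coord_act\<close> moves the index inside this coset and
  \<open>coord_right\<close> brings it back.\<close>

lemma coord_act_conj:
  assumes "v \<in> carrier V" and x: "x \<in> carrier G" and n: "n \<in> carrier G" "inv x \<otimes> n \<otimes> x \<in> H"
  shows "\<pi> x (gact V n v) = gact W (inv x \<otimes> n \<otimes> x) (\<pi> x v)"
proof -
  have "inv n \<otimes> x = x \<otimes> inv (inv x \<otimes> n \<otimes> x)"
    using n x by (simp add: V.grp.inv_mult_group V.grp.m_assoc V.grp.mult_inv_mult_cancel)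
  then have "\<pi> x (gact V n v) = \<pi> (x \<otimes> inv (inv x \<otimes> n \<otimes> x)) v"
    using assms by (simp add: coord_act)
  also have "\<dots> = gact W (inv (inv (inv x \<otimes> n \<otimes> x))) (\<pi> x v)"
    using assms H_inv[OF n(2)] by (intro coord_right) auto
  also have "inv (inv (inv x \<otimes> n \<otimes> x)) = inv x \<otimes> n \<otimes> x" using n x by simp
  finally show ?thesis .
qed

lemma coord_zero [simp]: "x \<in> carrier G \<Longrightarrow> \<pi> x \<zero>\<^bsub>V\<^esub> = \<zero>\<^bsub>W\<^esub>"
  using coord_smult[of "\<zero>\<^bsub>V\<^esub>" x "\<zero>\<^bsub>F\<^esub>"] by simp

lemma coord_minus: "x \<in> carrier G \<Longrightarrow> u \<in> carrier V \<Longrightarrow> v \<in> carrier V \<Longrightarrow>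
    \<pi> x (u \<ominus>\<^bsub>V\<^esub> v) = \<pi> x u \<ominus>\<^bsub>W\<^esub> \<pi> x v"
  by (simp add: a_minus_def V.minus_eq_smult W.minus_eq_smult coord_add coord_smult)

lemma coord_emb: "x \<in> carrier G \<Longrightarrow> w \<in> carrier W \<Longrightarrow>
    \<pi> x (\<iota> w) = (if x \<in> H then gact W (inv x) w else \<zero>\<^bsub>W\<^esub>)"
proof -
  assume a: "x \<in> carrier G" "w \<in> carrier W"
  have "inv x \<in> H \<longleftrightarrow> x \<in> H" using H_inv[of "inv x"] a by auto
  then show ?thesis using coord_act_emb[of x \<one> w] a by (simp add: V.gact_one)
qed

lemma coord_one_emb [simp]: "w \<in> carrier W \<Longrightarrow> \<pi> \<one> (\<iota> w) = w"
  by (simp add: coord_emb actH_one)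

text \<open>The \<open>x\<close> with a nonzero component fill whole cosets of \<open>H\<close> and
  may be infinite in number. Their image in the cosets of a subgroup \<open>K\<close> that contains
  \<open>H\<close> is finite, which permits minimal choices.\<close>

definition csupp :: "'g set \<Rightarrow> 'v \<Rightarrow> 'g set set"
  where "csupp K v = (\<lambda>x. x <# K) ` {x \<in> carrier G. \<pi> x v \<noteq> \<zero>\<^bsub>W\<^esub>}"

lemma finite_csupp:
  assumes K: "subgroup K G" "H \<subseteq> K" and v: "v \<in> carrier V"
  shows "finite (csupp K v)"
  using v
proof (induction rule: generated)
  case (emb g w)
  have "csupp K (gact V g (\<iota> w)) \<subseteq> {g <# K}"
  proof
    fix C assume "C \<in> csupp K (gact V g (\<iota> w))"
    then obtain x where x: "x \<in> carrier G" "C = x <# K" "inv x \<otimes> g \<in> H"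
      using emb by (auto simp: csupp_def coord_act_emb split: if_splits)
    then have "C = g <# K" using V.grp.l_coset_eq_iff[OF K(1) x(1) emb(1)] K(2) by auto
    then show "C \<in> {g <# K}" by simp
  qed
  then show ?case by (rule finite_subset) simp
next
  case (add u v)
  have "csupp K (u \<oplus>\<^bsub>V\<^esub> v) \<subseteq> csupp K u \<union> csupp K v"
    using add by (auto simp: csupp_def coord_add)
  then show ?case using add by (auto intro: finite_subset)
qed

text \<open>Over a system of representatives of the cosets of \<open>H\<close>, every
  \<open>v\<close> is a finite sum of terms \<open>gact V r (\<iota> (\<pi> r v))\<close>, so
  \<open>v\<close> is recovered from its coordinates.\<close>

lemma eq_zeroI:
  assumes v: "v \<in> carrier V" and 0: "\<And>x. x \<in> carrier G \<Longrightarrow> \<pi> x v = \<zero>\<^bsub>W\<^esub>"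
  shows "v = \<zero>\<^bsub>V\<^esub>"
proof -
  \<comment> \<open>The choice depends on the coset as a set, so equal cosets get equal
    representatives.\<close>
  define rep where "rep x = (SOME y. y \<in> x <# H)" for x
  have rep: "rep x \<in> x <# H" if "x \<in> carrier G" for x
    unfolding rep_def
  proof (rule someI)
    show "x \<in> x <# H" using V.grp.mem_l_coset_iff[OF subgroup_H that, of x] that by simp
  qed
  have repG: "rep x \<in> carrier G" "inv x \<otimes> rep x \<in> H" if "x \<in> carrier G" for x
    using rep[OF that] V.grp.mem_l_coset_iff[OF subgroup_H that] by auto
  have rep_eq: "rep x <# H = x <# H" if "x \<in> carrier G" for x
    using repG[OF that] that V.grp.l_coset_eq_iff[OF subgroup_H, of x "rep x"] by auto
  have rep_cong: "rep x = rep y" if "x <# H = y <# H" for x y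
    using that by (simp add: rep_def)
  define T where "T = rep ` carrier G"
  have T: "T \<subseteq> carrier G" using repG by (auto simp: T_def)
  have repT: "rep t = t" if "t \<in> T" for t
    using that by (auto simp: T_def intro!: rep_cong rep_eq)
  \<comment> \<open>The identity is claimed for every finite set of representatives that is large
    enough, not just for one: adding the identities for \<open>u\<close> and \<open>v\<close> takes
    a common set.\<close>
  have "\<exists>R0. finite R0 \<and> R0 \<subseteq> T \<and>
      (\<forall>R. finite R \<longrightarrow> R0 \<subseteq> R \<longrightarrow> R \<subseteq> T \<longrightarrow> v = (\<Oplus>\<^bsub>V\<^esub>r\<in>R. gact V r (\<iota> (\<pi> r v))))"
    using v
  proof (induction rule: generated)
    case (emb g w)
    let ?v = "gact V g (\<iota> w)"
    show ?case
    proof (intro exI[of _ "{rep g}"] conjI allI impI)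
      show "{rep g} \<subseteq> T" using emb by (auto simp: T_def)
    next
      fix R assume R: "finite R" "{rep g} \<subseteq> R" "R \<subseteq> T"
      have "gact V r (\<iota> (\<pi> r ?v)) = (if rep g = r then ?v else \<zero>\<^bsub>V\<^esub>)" if r: "r \<in> R" for r
      proof (cases "inv r \<otimes> g \<in> H")
        case True
        have rG: "r \<in> carrier G" using r R T by auto
        have "r <# H = g <# H" using V.grp.l_coset_eq_iff[OF subgroup_H rG] True emb by simp
        then have "rep g = r" using rep_cong[of r g] repT[of r] r R by auto
        moreover have "gact V r (\<iota> (gact W (inv r \<otimes> g) w)) = gact V (r \<otimes> (inv r \<otimes> g)) (\<iota> w)"
          using True emb rG V.gact_mult[of r "inv r \<otimes> g" "\<iota> w"] by (simp add: emb_act)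
        moreover have "r \<otimes> (inv r \<otimes> g) = g" using rG emb by (simp add: V.grp.m_assoc[symmetric])
        ultimately show ?thesis using True emb rG by (simp add: coord_act_emb)
      next
        case False
        have rG: "r \<in> carrier G" using r R T by auto
        have "rep g \<noteq> r"
        proof
          assume "rep g = r"
          then have "r <# H = g <# H" using rep_eq emb by auto
          then show False using V.grp.l_coset_eq_iff[OF subgroup_H rG] False emb by simp
        qed
        then show ?thesis using emb_zero False emb rG by (simp add: coord_act_emb)
      qed
      then have "(\<Oplus>\<^bsub>V\<^esub>r\<in>R. gact V r (\<iota> (\<pi> r ?v))) = (\<Oplus>\<^bsub>V\<^esub>r\<in>R. if rep g = r then ?v else \<zero>\<^bsub>V\<^esub>)"
        using emb by (intro V.M.finsum_cong') auto
      also have "\<dots> = ?v" using R emb by (intro V.M.add.finprod_singleton) auto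
      finally show "?v = (\<Oplus>\<^bsub>V\<^esub>r\<in>R. gact V r (\<iota> (\<pi> r ?v)))" by simp
    qed simp
  next
    case (add u v)
    obtain R0 where R0: "finite R0" "R0 \<subseteq> T"
      "\<And>R. finite R \<Longrightarrow> R0 \<subseteq> R \<Longrightarrow> R \<subseteq> T \<Longrightarrow> u = (\<Oplus>\<^bsub>V\<^esub>r\<in>R. gact V r (\<iota> (\<pi> r u)))"
      using add.IH(1) by blast
    obtain R1 where R1: "finite R1" "R1 \<subseteq> T"
      "\<And>R. finite R \<Longrightarrow> R1 \<subseteq> R \<Longrightarrow> R \<subseteq> T \<Longrightarrow> v = (\<Oplus>\<^bsub>V\<^esub>r\<in>R. gact V r (\<iota> (\<pi> r v)))"
      using add.IH(2) by blast
    show ?case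
    proof (intro exI[of _ "R0 \<union> R1"] conjI allI impI)
      fix R assume R: "finite R" "R0 \<union> R1 \<subseteq> R" "R \<subseteq> T"
      have "(\<Oplus>\<^bsub>V\<^esub>r\<in>R. gact V r (\<iota> (\<pi> r (u \<oplus>\<^bsub>V\<^esub> v)))) =
        (\<Oplus>\<^bsub>V\<^esub>r\<in>R. gact V r (\<iota> (\<pi> r u)) \<oplus>\<^bsub>V\<^esub> gact V r (\<iota> (\<pi> r v)))"
        using add R T by (intro V.M.finsum_cong') (auto simp: coord_add emb_add V.act_add subset_iff)
      also have "\<dots> = (\<Oplus>\<^bsub>V\<^esub>r\<in>R. gact V r (\<iota> (\<pi> r u))) \<oplus>\<^bsub>V\<^esub> (\<Oplus>\<^bsub>V\<^esub>r\<in>R. gact V r (\<iota> (\<pi> r v)))"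
        using add R T by (intro V.M.finsum_addf) (auto simp: subset_iff)
      also have "\<dots> = u \<oplus>\<^bsub>V\<^esub> v" using R0(3)[of R] R1(3)[of R] R by simp
      finally show "u \<oplus>\<^bsub>V\<^esub> v = (\<Oplus>\<^bsub>V\<^esub>r\<in>R. gact V r (\<iota> (\<pi> r (u \<oplus>\<^bsub>V\<^esub> v))))" by simp
    qed (use R0 R1 in auto)
  qed
  then obtain R where "finite R" "R \<subseteq> T" "v = (\<Oplus>\<^bsub>V\<^esub>r\<in>R. gact V r (\<iota> (\<pi> r v)))" by blast
  moreover have "(\<Oplus>\<^bsub>V\<^esub>r\<in>R. gact V r (\<iota> (\<pi> r v))) = (\<Oplus>\<^bsub>V\<^esub>r\<in>R. \<zero>\<^bsub>V\<^esub>)"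
  proof (intro V.M.finsum_cong')
    show "gact V r (\<iota> (\<pi> r v)) = \<zero>\<^bsub>V\<^esub>" if "r \<in> R" for r
      using emb_zero that \<open>R \<subseteq> T\<close> T 0 by auto
  qed auto
  ultimately show ?thesis by simp
qed

lemma eqI:
  assumes "u \<in> carrier V" "v \<in> carrier V" "\<And>x. x \<in> carrier G \<Longrightarrow> \<pi> x u = \<pi> x v"
  shows "u = v"
proof (rule V.eq_if_minus_eq_zero)
  show "u \<ominus>\<^bsub>V\<^esub> v = \<zero>\<^bsub>V\<^esub>"
    using assms by (intro eq_zeroI) (simp_all add: coord_minus)
qed (use assms in auto)

text \<open>On \<open>H\<close> all coordinates are determined by the one at \<open>\<one>\<close>,
  since \<open>x = \<one> \<otimes> x\<close> there; off \<open>H\<close> those of an element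
  \<open>\<iota> w\<close> vanish as well.\<close>

lemma eq_emb:
  assumes "v \<in> carrier V" "\<And>x. x \<in> carrier G \<Longrightarrow> x \<notin> H \<Longrightarrow> \<pi> x v = \<zero>\<^bsub>W\<^esub>"
  shows "v = \<iota> (\<pi> \<one> v)"
proof (rule eqI)
  fix x assume x: "x \<in> carrier G"
  show "\<pi> x v = \<pi> x (\<iota> (\<pi> \<one> v))"
    using x assms coord_right[of v \<one> x] by (simp add: coord_emb)
qed (use assms in auto)

text \<open>The coset of \<open>H\<close> that carries a generator lies in \<open>K\<close> or is
  disjoint from it, so truncation to \<open>K\<close> keeps a generator or kills it, and additivity
  does the rest.\<close>

lemma exists_trunc:
  assumes K: "subgroup K G" "H \<subseteq> K" and v: "v \<in> carrier V"
  shows "\<exists>u\<in>carrier V. \<forall>x\<in>carrier G. \<pi> x u = (if x \<in> K then \<pi> x v else \<zero>\<^bsub>W\<^esub>)"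
  using v
proof (induction rule: generated)
  case (emb g w)
  have *: "x \<in> K \<longleftrightarrow> g \<in> K" if "inv x \<otimes> g \<in> H" "x \<in> carrier G" for x
  proof -
    have "x <# K = g <# K" using K that emb V.grp.l_coset_eq_iff[of K x g] by auto
    then show ?thesis
      using V.grp.l_coset_one[OF K(1) that(2)] V.grp.l_coset_one[OF K(1) emb(1)] by simp
  qed
  show ?case
  proof (cases "g \<in> K")
    case True
    then have "x \<in> K" if "inv x \<otimes> g \<in> H" "x \<in> carrier G" for x using *[OF that] by simp
    then show ?thesis using emb by (intro bexI[of _ "gact V g (\<iota> w)"]) (auto simp: coord_act_emb)
  next
    case False
    then have "x \<notin> K" if "inv x \<otimes> g \<in> H" "x \<in> carrier G" for x using *[OF that] by simp
    then show ?thesis using emb by (intro bexI[of _ "\<zero>\<^bsub>V\<^esub>"]) (auto simp: coord_act_emb)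
  qed
next
  case (add u v)
  then obtain u' v' where "u' \<in> carrier V" "v' \<in> carrier V"
    "\<forall>x\<in>carrier G. \<pi> x u' = (if x \<in> K then \<pi> x u else \<zero>\<^bsub>W\<^esub>)"
    "\<forall>x\<in>carrier G. \<pi> x v' = (if x \<in> K then \<pi> x v else \<zero>\<^bsub>W\<^esub>)" by blast
  then show ?case using add by (intro bexI[of _ "u' \<oplus>\<^bsub>V\<^esub> v'"]) (auto simp: coord_add)
qed

section \<open>Submodules, supports and minimal elements\<close>

lemma generated_by_emb:
  assumes U: "gsubmodule F G U V" and "\<iota> ` carrier W \<subseteq> U"
  shows "U = carrier V"
proof
  show "U \<subseteq> carrier V" using V.gsubmoduleD(1)[OF U] .
  show "carrier V \<subseteq> U"
  proof
    fix v assume "v \<in> carrier V" then show "v \<in> U"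
      by (induction rule: generated) (use V.gsubmoduleD[OF U] assms(2) in auto)
  qed
qed

lemma csupp_subset_iff:
  "csupp K v \<subseteq> S \<longleftrightarrow> (\<forall>x\<in>carrier G. \<pi> x v \<noteq> \<zero>\<^bsub>W\<^esub> \<longrightarrow> x <# K \<in> S)"
  by (auto simp: csupp_def)

text \<open>For a subgroup \<open>K\<close> that contains \<open>H\<close> this is the copy of the
  module induced to \<open>K\<close> inside the module induced to \<open>G\<close>.\<close>

definition supported :: "'g set \<Rightarrow> 'v set"
  where "supported K = {v \<in> carrier V. \<forall>x\<in>carrier G - K. \<pi> x v = \<zero>\<^bsub>W\<^esub>}"

text \<open>A nonzero element with the fewest cosets in its support is translated by
  \<open>inv x\<close>, for some \<open>x\<close> at which its component is nonzero, to make the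
  component at \<open>\<one>\<close> nonzero. Minimality is stated by proper inclusion of supports,
  the form in which it is applied.\<close>

lemma minimal_support:
  assumes K: "subgroup K G" "H \<subseteq> K" and L: "subgroup L G"
    and U: "gsubmodule F (G\<lparr>carrier := L\<rparr>) U V" "U \<subseteq> supported L" "U \<noteq> {\<zero>\<^bsub>V\<^esub>}"
  obtains u where "u \<in> U" "\<pi> \<one> u \<noteq> \<zero>\<^bsub>W\<^esub>" "\<And>m. m \<in> U \<Longrightarrow> csupp K m \<subset> csupp K u \<Longrightarrow> m = \<zero>\<^bsub>V\<^esub>"
proof -
  interpret VL: gmodule F "G\<lparr>carrier := L\<rparr>" V by (rule V.restrict_group[OF L])
  have UV: "U \<subseteq> carrier V" using VL.gsubmoduleD(1)[OF U(1)] .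
  have "\<exists>u. u \<in> U \<and> u \<noteq> \<zero>\<^bsub>V\<^esub>" using U VL.gsubmoduleD(2)[OF U(1)] by auto
  then obtain u where u: "u \<in> U" "u \<noteq> \<zero>\<^bsub>V\<^esub>" and
    min: "\<And>m. m \<in> U \<and> m \<noteq> \<zero>\<^bsub>V\<^esub> \<Longrightarrow> card (csupp K u) \<le> card (csupp K m)"
    using ex_has_least_nat[of "\<lambda>u. u \<in> U \<and> u \<noteq> \<zero>\<^bsub>V\<^esub>" _ "\<lambda>u. card (csupp K u)"] by blast
  obtain x where x: "x \<in> carrier G" "\<pi> x u \<noteq> \<zero>\<^bsub>W\<^esub>" using eq_zeroI[of u] u UV by auto
  \<comment> \<open>\<open>U\<close> is stable under \<open>L\<close>, so the translation is
    legitimate once \<open>x\<close> is in \<open>L\<close>; the inclusion in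
    \<open>supported L\<close> provides this.\<close>
  have xL: "x \<in> L" using x u U(2) by (auto simp: supported_def)
  let ?u = "gact V (inv x) u"
  have uV: "u \<in> carrier V" using u UV by auto
  show thesis
  proof (rule that)
    show "?u \<in> U" using VL.gsubmoduleD(5)[OF U(1), of "inv x" u] u xL L
      by (simp add: subgroup.m_inv_closed)
    show "\<pi> \<one> ?u \<noteq> \<zero>\<^bsub>W\<^esub>" using x uV by (simp add: coord_act)
  next
    fix m assume m: "m \<in> U" "csupp K m \<subset> csupp K ?u"
    \<comment> \<open>Translation carries cosets to cosets, so the number of cosets does not grow
      and the translate is again minimal.\<close>
    have "csupp K ?u \<subseteq> (\<lambda>C. inv x <# C) ` csupp K u"
    proof
      fix C assume "C \<in> csupp K ?u"
      then obtain y where y: "y \<in> carrier G" "C = y <# K" "\<pi> (x \<otimes> y) u \<noteq> \<zero>\<^bsub>W\<^esub>"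
        using x uV by (auto simp: csupp_def coord_act)
      then have "(x \<otimes> y) <# K \<in> csupp K u" using x by (auto simp: csupp_def)
      moreover have "C = inv x <# ((x \<otimes> y) <# K)"
        using x y subgroup.subset[OF K(1)] by (simp add: V.grp.lcos_m_assoc V.grp.m_assoc[symmetric])
      ultimately show "C \<in> (\<lambda>C. inv x <# C) ` csupp K u" by blast
    qed
    then have "card (csupp K ?u) \<le> card (csupp K u)"
      using finite_csupp[OF K uV] by (meson card_image_le card_mono finite_imageI order_trans)
    moreover have "card (csupp K m) < card (csupp K ?u)"
      using m(2) finite_csupp[OF K] uV x by (intro psubset_card_mono) auto
    ultimately show "m = \<zero>\<^bsub>V\<^esub>" using min[of m] m(1) by auto
  qed
qed

text \<open>The hypothesis \<open>conj\<close> says that \<open>N\<close> fixes every coset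
  \<open>x <# K\<close> with \<open>x\<close> in \<open>L\<close>, so acting by \<open>N\<close>
  does not move supports. It is applied with \<open>N = K\<close> normal in \<open>L\<close>, and
  with \<open>K = H\<close>, \<open>L = G\<close> and \<open>N\<close> normal in
  \<open>G\<close>.\<close>

lemma gsubmodule_csupp:
  assumes K: "subgroup K G" and L: "subgroup L G" and N: "subgroup N G" "N \<subseteq> L"
    and conj: "\<And>n x. n \<in> N \<Longrightarrow> x \<in> L \<Longrightarrow> inv x \<otimes> n \<otimes> x \<in> K"
    and U: "gsubmodule F (G\<lparr>carrier := L\<rparr>) U V" "U \<subseteq> supported L"
  shows "gsubmodule F (G\<lparr>carrier := N\<rparr>) {m \<in> U. csupp K m \<subseteq> S} V"
proof -
  interpret VL: gmodule F "G\<lparr>carrier := L\<rparr>" V by (rule V.restrict_group[OF L])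
  interpret VN: gmodule F "G\<lparr>carrier := N\<rparr>" V by (rule V.restrict_group[OF N(1)])
  note D = VL.gsubmoduleD[OF U(1)]
  have UV: "u \<in> carrier V" if "u \<in> U" for u using D(1) that by auto
  have NG: "n \<in> carrier G" if "n \<in> N" for n using that subgroup.subset[OF N(1)] by auto
  show ?thesis
  proof (rule VN.gsubmoduleI)
    fix g u assume g: "g \<in> carrier (G\<lparr>carrier := N\<rparr>)" and u: "u \<in> {m \<in> U. csupp K m \<subseteq> S}"
    then have gN: "g \<in> N" and gL: "g \<in> L" and gG: "g \<in> carrier G" using N NG by auto
    have "x <# K \<in> S" if x: "x \<in> carrier G" "\<pi> x (gact V g u) \<noteq> \<zero>\<^bsub>W\<^esub>" for x
    proof -
      \<comment> \<open>\<open>conj\<close> speaks of elements of \<open>L\<close>. That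
        \<open>x\<close> is one follows from \<open>inv g \<otimes> x\<close>, where an element of
        \<open>supported L\<close> has a nonzero component.\<close>
      have nz: "\<pi> (inv g \<otimes> x) u \<noteq> \<zero>\<^bsub>W\<^esub>" using x u UV gG by (auto simp: coord_act)
      then have "inv g \<otimes> x \<in> L" using u x U(2) gG by (auto simp: supported_def)
      then have "g \<otimes> (inv g \<otimes> x) \<in> L" using gL L by (simp add: subgroup.m_closed)
      then have xL: "x \<in> L" using gG x by (simp add: V.grp.m_assoc[symmetric])
      have "inv (inv g \<otimes> x) \<otimes> x = inv x \<otimes> g \<otimes> x"
        using gG x by (simp add: V.grp.inv_mult_group)
      then have "(inv g \<otimes> x) <# K = x <# K"
        using conj[OF gN xL] V.grp.l_coset_eq_iff[OF K] gG x by simp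
      moreover have "(inv g \<otimes> x) <# K \<in> S" using u nz gG x by (auto simp: csupp_subset_iff)
      ultimately show ?thesis by simp
    qed
    then show "gact V g u \<in> {m \<in> U. csupp K m \<subseteq> S}"
      using D(5)[of g u] gL u by (auto simp: csupp_subset_iff)
  next
    fix u v assume "u \<in> {m \<in> U. csupp K m \<subseteq> S}" "v \<in> {m \<in> U. csupp K m \<subseteq> S}"
    moreover from this have "csupp K (u \<oplus>\<^bsub>V\<^esub> v) \<subseteq> csupp K u \<union> csupp K v"
      using UV by (auto simp: csupp_def coord_add)
    ultimately show "u \<oplus>\<^bsub>V\<^esub> v \<in> {m \<in> U. csupp K m \<subseteq> S}"
      using D(3)[of u v] by blast
  next
    fix c u assume "c \<in> carrier F" "u \<in> {m \<in> U. csupp K m \<subseteq> S}"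
    moreover from this have "csupp K (c \<odot>\<^bsub>V\<^esub> u) \<subseteq> csupp K u"
      using UV by (auto simp: csupp_def coord_smult)
    ultimately show "c \<odot>\<^bsub>V\<^esub> u \<in> {m \<in> U. csupp K m \<subseteq> S}"
      using D(4)[of c u] by blast
  qed (use D UV in \<open>auto simp: csupp_subset_iff\<close>)
qed

end

section \<open>Mackey's hypothesis\<close>

lemma vectorspace_gact_update: "vectorspace F (W\<lparr>gact := a\<rparr>) \<longleftrightarrow> vectorspace F W"
  by (simp add: vectorspace_def module_def module_axioms_def abelian_group_def
      abelian_group_axioms_def abelian_monoid_def)

lemma gmodule_left_conj:
  assumes W: "gmodule F (G\<lparr>carrier := H\<rparr>) W" and G: "group G" and H: "subgroup H G"
    and K: "subgroup K G" and x: "x \<in> carrier G"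
    and conj: "\<And>k. k \<in> K \<Longrightarrow> inv\<^bsub>G\<^esub> x \<otimes>\<^bsub>G\<^esub> k \<otimes>\<^bsub>G\<^esub> x \<in> H"
  shows "gmodule F (G\<lparr>carrier := K\<rparr>) (left_conj G x W)"
proof -
  interpret W: gmodule F "G\<lparr>carrier := H\<rparr>" W by fact
  interpret G: group G by fact
  have KG: "k \<in> carrier G" if "k \<in> K" for k using that subgroup.subset[OF K] by auto
  show ?thesis
  proof (rule gmodule.intro)
    show "group (G\<lparr>carrier := K\<rparr>)" using K G by (rule subgroup.subgroup_is_group)
    show "vectorspace F (left_conj G x W)"
      unfolding left_conj_def vectorspace_gact_update by (rule W.vectorspace)
    show "gact (left_conj G x W) g \<in> module_hom F (left_conj G x W) (left_conj G x W)"
      if "g \<in> carrier (G\<lparr>carrier := K\<rparr>)" for g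
      using W.gact_linear[of "inv\<^bsub>G\<^esub> x \<otimes>\<^bsub>G\<^esub> g \<otimes>\<^bsub>G\<^esub> x"] conj that
      by (simp add: left_conj_def module_hom_def)
    show "gact (left_conj G x W) \<one>\<^bsub>G\<lparr>carrier := K\<rparr>\<^esub> v = v" if "v \<in> carrier (left_conj G x W)" for v
      using W.gact_one[of v] that x by (simp add: left_conj_def)
    fix g h v
    assume *: "g \<in> carrier (G\<lparr>carrier := K\<rparr>)" "h \<in> carrier (G\<lparr>carrier := K\<rparr>)"
      "v \<in> carrier (left_conj G x W)"
    have "inv\<^bsub>G\<^esub> x \<otimes>\<^bsub>G\<^esub> (g \<otimes>\<^bsub>G\<^esub> h) \<otimes>\<^bsub>G\<^esub> x =
      (inv\<^bsub>G\<^esub> x \<otimes>\<^bsub>G\<^esub> g \<otimes>\<^bsub>G\<^esub> x) \<otimes>\<^bsub>G\<^esub> (inv\<^bsub>G\<^esub> x \<otimes>\<^bsub>G\<^esub> h \<otimes>\<^bsub>G\<^esub> x)"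
      using * KG x by (simp add: G.m_assoc G.mult_inv_mult_cancel)
    then show "gact (left_conj G x W) (g \<otimes>\<^bsub>G\<lparr>carrier := K\<rparr>\<^esub> h) v =
        gact (left_conj G x W) g (gact (left_conj G x W) h v)"
      using * conj W.gact_mult by (simp add: left_conj_def)
  qed
qed

lemma right_conj_eq_left_conj:
  assumes "group G" "g \<in> carrier G"
  shows "right_conj G W g = left_conj G (inv\<^bsub>G\<^esub> g) W"
  using assms by (simp add: right_conj_def left_conj_def)

lemma (in group) mem_conj_iff:
  assumes H: "subgroup H G" and x: "x \<in> carrier G" and k: "k \<in> carrier G"
  shows "k \<in> x <# H #> inv x \<longleftrightarrow> inv x \<otimes> k \<otimes> x \<in> H"
proof
  assume "k \<in> x <# H #> inv x"
  then obtain h where h: "h \<in> H" "k = x \<otimes> h \<otimes> inv x" by (auto simp: l_coset_def r_coset_def)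
  then have "h \<in> carrier G" using subgroup.subset[OF H] by auto
  then have "inv x \<otimes> k \<otimes> x = h" using h(2) x by (simp add: m_assoc mult_inv_mult_cancel)
  then show "inv x \<otimes> k \<otimes> x \<in> H" using h by simp
next
  assume h: "inv x \<otimes> k \<otimes> x \<in> H"
  have "k = x \<otimes> (inv x \<otimes> k \<otimes> x) \<otimes> inv x"
    using x k by (simp add: m_assoc mult_inv_mult_cancel)
  then show "k \<in> x <# H #> inv x" using h unfolding l_coset_def r_coset_def by blast
qed

lemma (in group) subgroup_Int_conj:
  assumes H: "subgroup H G" and x: "x \<in> carrier G"
  shows "subgroup (H \<inter> (x <# H #> inv x)) G"
proof -
  have HG: "h \<in> carrier G" if "h \<in> H" for h using that subgroup.subset[OF H] by auto
  have eq: "H \<inter> (x <# H #> inv x) = {k \<in> H. inv x \<otimes> k \<otimes> x \<in> H}"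
    using mem_conj_iff[OF H x] HG by blast
  show ?thesis unfolding eq
  proof (rule subgroupI)
    show "{k \<in> H. inv x \<otimes> k \<otimes> x \<in> H} \<noteq> {}"
      using subgroup.one_closed[OF H] x by (intro ex_in_conv[THEN iffD1] exI[of _ \<one>]) simp
    fix a assume a: "a \<in> {k \<in> H. inv x \<otimes> k \<otimes> x \<in> H}"
    then have "inv (inv x \<otimes> a \<otimes> x) \<in> H" using H by (simp add: subgroup.m_inv_closed)
    moreover have "inv (inv x \<otimes> a \<otimes> x) = inv x \<otimes> inv a \<otimes> x"
      using a x HG by (simp add: inv_mult_group m_assoc)
    ultimately show "inv a \<in> {k \<in> H. inv x \<otimes> k \<otimes> x \<in> H}"
      using a H by (simp add: subgroup.m_inv_closed)
    fix b assume b: "b \<in> {k \<in> H. inv x \<otimes> k \<otimes> x \<in> H}"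
    have eq: "(inv x \<otimes> a \<otimes> x) \<otimes> (inv x \<otimes> b \<otimes> x) = inv x \<otimes> (a \<otimes> b) \<otimes> x"
      using a b x HG by (simp add: m_assoc mult_inv_mult_cancel)
    have "inv x \<otimes> (a \<otimes> b) \<otimes> x \<in> H"
      unfolding eq[symmetric] using a b by (simp add: subgroup.m_closed[OF H])
    then show "a \<otimes> b \<in> {k \<in> H. inv x \<otimes> k \<otimes> x \<in> H}"
      using a b H by (simp add: subgroup.m_closed)
  qed (use HG in auto)
qed

locale mackey_gmodule = induced_gmodule F G V H W \<iota> \<pi>
  for F :: "('f, 'm) ring_scheme" and G :: "('g, 'n) monoid_scheme" (structure)
    and V :: "('g, 'f, 'v, 'k) gmodule_scheme"
    and H :: "'g set" and W :: "('g, 'f, 'w, 'l) gmodule_scheme"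
    and \<iota> :: "'w \<Rightarrow> 'v" and \<pi> :: "'g \<Rightarrow> 'v \<Rightarrow> 'w" +
  assumes irreducible_W: "irreducible_gmodule F (G\<lparr>carrier := H\<rparr>) W"
    and endomorphisms_W: "intertwining_number F (G\<lparr>carrier := H\<rparr>) W W = 1"
    and mackey: "x \<in> carrier G - H \<Longrightarrow>
      intertwining_number F (G\<lparr>carrier := H \<inter> ((x <# H) #> inv x)\<rparr>) W (left_conj G x W) = 0"
begin

section \<open>Homomorphisms from \<open>W\<close> and endomorphisms of the induced module\<close>

lemma W_nonzero: "carrier W \<noteq> {\<zero>\<^bsub>W\<^esub>}"
  using irreducible_W by (simp add: irreducible_gmodule_def)

text \<open>Mackey's hypothesis in terms of elements: membership in the conjugate of
  \<open>H\<close> becomes \<open>inv x \<otimes> k \<otimes> x \<in> H\<close>, and the conjugated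
  module becomes a twisted equation, the form that \<open>coord_act_conj\<close> delivers.\<close>

lemma mackey_hom_zero:
  assumes x: "x \<in> carrier G" "x \<notin> H" and f: "f \<in> module_hom F W W"
    and act: "\<And>k w. k \<in> H \<Longrightarrow> inv x \<otimes> k \<otimes> x \<in> H \<Longrightarrow> w \<in> carrier W \<Longrightarrow>
      f (gact W k w) = gact W (inv x \<otimes> k \<otimes> x) (f w)"
    and w: "w \<in> carrier W"
  shows "f w = \<zero>\<^bsub>W\<^esub>"
proof -
  let ?K = "H \<inter> (x <# H #> inv x)"
  have K: "subgroup ?K G" using V.grp.subgroup_Int_conj[OF subgroup_H x(1)] .
  have conj: "inv x \<otimes> k \<otimes> x \<in> H" if "k \<in> ?K" for k
    using that V.grp.mem_conj_iff[OF subgroup_H x(1)] by auto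
  have "subgroup ?K (G\<lparr>carrier := H\<rparr>)"
    using V.grp.subgroup_incl[OF K subgroup_H] by simp
  from W.restrict_group[OF this] have WK: "gmodule F (G\<lparr>carrier := ?K\<rparr>) W" by simp
  have lK: "gmodule F (G\<lparr>carrier := ?K\<rparr>) (left_conj G x W)"
    by (rule gmodule_left_conj[OF W.gmodule_axioms V.group subgroup_H K x(1) conj])
  have "f \<in> ghom F (G\<lparr>carrier := ?K\<rparr>) W (left_conj G x W)"
    using f act conj by (auto simp: ghom_def left_conj_def module_hom_def)
  then have "f w = \<zero>\<^bsub>left_conj G x W\<^esub>"
    using ghom_eq_zero[OF WK lK mackey _ w] x by simp
  then show ?thesis by (simp add: left_conj_def)
qed

lemma coord_hom_zero:
  assumes f: "f \<in> ghom F (G\<lparr>carrier := H\<rparr>) W V"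
    and x: "x \<in> carrier G" "x \<notin> H" and w: "w \<in> carrier W"
  shows "\<pi> x (f w) = \<zero>\<^bsub>W\<^esub>"
proof (rule mackey_hom_zero[where f = "\<lambda>w. \<pi> x (f w)", OF x _ _ w])
  note D = ghomD[OF f]
  show "(\<lambda>w. \<pi> x (f w)) \<in> module_hom F W W"
    using D x by (auto simp: module_hom_def coord_add coord_smult)
  fix k w assume k: "k \<in> H" "inv x \<otimes> k \<otimes> x \<in> H" and w: "w \<in> carrier W"
  show "\<pi> x (f (gact W k w)) = gact W (inv x \<otimes> k \<otimes> x) (\<pi> x (f w))"
    using D(1)[OF w] D(4)[of k w] coord_act_conj[of "f w" x k] k w x by simp
qed

text \<open>All components of \<open>f w\<close> off \<open>H\<close> vanish by
  \<open>coord_hom_zero\<close>, so \<open>f\<close> factors through \<open>\<iota>\<close>; the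
  component at \<open>\<one>\<close> is then an endomorphism of \<open>W\<close>, hence a
  scalar.\<close>

lemma hom_from_W_scalar:
  assumes f: "f \<in> ghom F (G\<lparr>carrier := H\<rparr>) W V"
  shows "\<exists>c\<in>carrier F. \<forall>w\<in>carrier W. f w = c \<odot>\<^bsub>V\<^esub> \<iota> w"
proof -
  note D = ghomD[OF f]
  have eq: "f w = \<iota> (\<pi> \<one> (f w))" if "w \<in> carrier W" for w
    using eq_emb[OF D(1)[OF that]] coord_hom_zero[OF f _ _ that] by blast
  have "(\<lambda>w. \<pi> \<one> (f w)) \<in> ghom F (G\<lparr>carrier := H\<rparr>) W W"
  proof (rule ghomI)
    fix g u assume "g \<in> carrier (G\<lparr>carrier := H\<rparr>)" and u: "u \<in> carrier W"
    then have g: "g \<in> H" by simp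
    show "\<pi> \<one> (f (gact W g u)) = gact W g (\<pi> \<one> (f u))"
      using D(1)[OF u] D(4)[of g u] coord_act_conj[of "f u" \<one> g] g u by simp
  qed (use D in \<open>auto simp: coord_add coord_smult\<close>)
  from ghom_scalar[OF W.gmodule_axioms endomorphisms_W this W_nonzero]
  obtain c where c: "c \<in> carrier F" "\<And>w. w \<in> carrier W \<Longrightarrow> \<pi> \<one> (f w) = c \<odot>\<^bsub>W\<^esub> w" by blast
  then have "f w = c \<odot>\<^bsub>V\<^esub> \<iota> w" if "w \<in> carrier W" for w
    using eq[OF that] that by (simp add: emb_smult)
  then show ?thesis using c by blast
qed

text \<open>Frobenius reciprocity: translates of the image of \<open>\<iota>\<close> generate
  \<open>V\<close>, so an endomorphism is determined on that image, where
  \<open>hom_from_W_scalar\<close> applies.\<close>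

lemma endomorphism_scalar:
  assumes f: "f \<in> ghom F G V V"
  shows "\<exists>c\<in>carrier F. \<forall>v\<in>carrier V. f v = c \<odot>\<^bsub>V\<^esub> v"
proof -
  note D = ghomD[OF f]
  have "(\<lambda>w. f (\<iota> w)) \<in> ghom F (G\<lparr>carrier := H\<rparr>) W V"
    by (rule ghomI) (auto simp: D emb_add emb_smult emb_act)
  from hom_from_W_scalar[OF this] obtain c
    where c: "c \<in> carrier F" "\<And>w. w \<in> carrier W \<Longrightarrow> f (\<iota> w) = c \<odot>\<^bsub>V\<^esub> \<iota> w" by blast
  have "f v = c \<odot>\<^bsub>V\<^esub> v" if "v \<in> carrier V" for v
    using that
    by (induction rule: generated) (use c D in \<open>auto simp: V.act_smult V.smult_r_distr\<close>)
  then show ?thesis using c by blast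
qed

lemma V_nonzero: "carrier V \<noteq> {\<zero>\<^bsub>V\<^esub>}"
proof
  assume V: "carrier V = {\<zero>\<^bsub>V\<^esub>}"
  have "w = \<zero>\<^bsub>W\<^esub>" if "w \<in> carrier W" for w
  proof -
    have "\<iota> w = \<zero>\<^bsub>V\<^esub>" using emb_closed[OF that] V by auto
    then show ?thesis using coord_one_emb[OF that] by simp
  qed
  then show False using W_nonzero by auto
qed

lemma intertwining_number_V: "intertwining_number F G V V = 1"
  by (rule intertwining_number_eq_1[OF V.gmodule_axioms V_nonzero endomorphism_scalar])

text \<open>Irreducibility of \<open>supported K\<close> over \<open>K\<close>, phrased inside
  \<open>V\<close> so that all members of a series of subgroups share one module. For a subgroup
  \<open>K\<close> that contains \<open>H\<close>, the translates by \<open>K\<close> of the image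
  of \<open>\<iota>\<close> generate \<open>supported K\<close>, so a submodule that contains this
  image is everything.\<close>

definition irr_over :: "'g set \<Rightarrow> bool"
  where "irr_over K \<longleftrightarrow> (\<forall>U. gsubmodule F (G\<lparr>carrier := K\<rparr>) U V \<longrightarrow> U \<subseteq> supported K \<longrightarrow>
    U \<noteq> {\<zero>\<^bsub>V\<^esub>} \<longrightarrow> \<iota> ` carrier W \<subseteq> U)"

section \<open>Irreducibility of the part supported on a subgroup\<close>

lemma irr_overD:
  "irr_over K \<Longrightarrow> gsubmodule F (G\<lparr>carrier := K\<rparr>) U V \<Longrightarrow> U \<subseteq> supported K \<Longrightarrow>
    U \<noteq> {\<zero>\<^bsub>V\<^esub>} \<Longrightarrow> w \<in> carrier W \<Longrightarrow> \<iota> w \<in> U"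
  by (auto simp: irr_over_def)

lemma irreducible_V:
  assumes "irr_over (carrier G)"
  shows "irreducible_gmodule F G V"
proof -
  have s: "supported (carrier G) = carrier V" by (auto simp: supported_def)
  have G: "G\<lparr>carrier := carrier G\<rparr> = G" by simp
  have "U = carrier V" if U: "gsubmodule F G U V" "U \<noteq> {\<zero>\<^bsub>V\<^esub>}" for U
    using generated_by_emb[OF U(1)] assms[unfolded irr_over_def s G] U V.gsubmoduleD(1)[OF U(1)]
    by blast
  then show ?thesis
    using V.gmodule_axioms V_nonzero by (auto simp: irreducible_gmodule_def)
qed

text \<open>By \<open>eq_emb\<close> the elements of \<open>supported H\<close> are the
  \<open>\<iota> w\<close>, so this is the irreducibility of \<open>W\<close>.\<close>

lemma irr_over_H: "irr_over H"
  unfolding irr_over_def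
proof (intro allI impI)
  fix U assume U: "gsubmodule F (G\<lparr>carrier := H\<rparr>) U V" "U \<subseteq> supported H" "U \<noteq> {\<zero>\<^bsub>V\<^esub>}"
  interpret VH: gmodule F "G\<lparr>carrier := H\<rparr>" V by (rule V.restrict_group[OF subgroup_H])
  note D = VH.gsubmoduleD[OF U(1)]
  let ?P = "{w \<in> carrier W. \<iota> w \<in> U}"
  have "gsubmodule F (G\<lparr>carrier := H\<rparr>) ?P W"
    by (rule W.gsubmoduleI) (use D emb_zero in \<open>auto simp: emb_add emb_smult emb_act\<close>)
  moreover have "?P \<noteq> {\<zero>\<^bsub>W\<^esub>}"
  proof
    assume P: "?P = {\<zero>\<^bsub>W\<^esub>}"
    have "u = \<zero>\<^bsub>V\<^esub>" if u: "u \<in> U" for u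
    proof -
      have uV: "u \<in> carrier V" using u D(1) by auto
      have e: "u = \<iota> (\<pi> \<one> u)" using u U(2) uV by (intro eq_emb) (auto simp: supported_def)
      then have "\<pi> \<one> u \<in> ?P" using u uV by auto
      then have "\<pi> \<one> u = \<zero>\<^bsub>W\<^esub>" using P by auto
      then show ?thesis using e emb_zero by simp
    qed
    then show False using U(3) D(2) by blast
  qed
  ultimately have "?P = carrier W" using irreducible_W by (auto simp: irreducible_gmodule_def)
  then show "\<iota> ` carrier W \<subseteq> U" by auto
qed

lemma gsubmodule_supported:
  assumes K: "subgroup K G"
  shows "gsubmodule F (G\<lparr>carrier := K\<rparr>) (supported K) V"
proof -
  interpret VK: gmodule F "G\<lparr>carrier := K\<rparr>" V by (rule V.restrict_group[OF K])
  have KG: "k \<in> carrier G" if "k \<in> K" for k using that subgroup.subset[OF K] by auto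
  have "inv k \<otimes> x \<notin> K" if "k \<in> K" "x \<in> carrier G" "x \<notin> K" for k x
  proof
    assume "inv k \<otimes> x \<in> K"
    then have "k \<otimes> (inv k \<otimes> x) \<in> K" using that K by (simp add: subgroup.m_closed)
    then show False using that KG by (simp add: V.grp.m_assoc[symmetric])
  qed
  then show ?thesis
    using KG by (intro VK.gsubmoduleI)
      (auto simp: supported_def coord_add coord_smult coord_act)
qed

text \<open>The hypothesis on \<open>Hom(W, \<^sup>xW)\<close> forces the element of \<open>U\<close> that agrees with \<open>\<iota> w\<close> on
  \<open>K\<close>, and whose support is no larger than that of a minimal element, to vanish off \<open>K\<close>.\<close>

lemma irr_over_normal:
  assumes K: "subgroup K G" "H \<subseteq> K" and L: "subgroup L G" "K \<subseteq> L"
    and conj: "\<And>k x. k \<in> K \<Longrightarrow> x \<in> L \<Longrightarrow> inv x \<otimes> k \<otimes> x \<in> K"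
    and irr: "irr_over K"
  shows "irr_over L"
  unfolding irr_over_def
proof (intro allI impI)
  fix U assume U: "gsubmodule F (G\<lparr>carrier := L\<rparr>) U V" "U \<subseteq> supported L" "U \<noteq> {\<zero>\<^bsub>V\<^esub>}"
  interpret VK: gmodule F "G\<lparr>carrier := K\<rparr>" V by (rule V.restrict_group[OF K(1)])
  interpret VH: gmodule F "G\<lparr>carrier := H\<rparr>" V by (rule V.restrict_group[OF subgroup_H])
  have KG: "k \<in> carrier G" if "k \<in> K" for k using that subgroup.subset[OF K(1)] by auto
  obtain u where u: "u \<in> U" "\<pi> \<one> u \<noteq> \<zero>\<^bsub>W\<^esub>"
    and min: "\<And>m. m \<in> U \<Longrightarrow> csupp K m \<subset> csupp K u \<Longrightarrow> m = \<zero>\<^bsub>V\<^esub>"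
    using minimal_support[OF K L(1) U] by blast
  \<comment> \<open>Since \<open>K\<close> is normal in \<open>L\<close>, these elements form a
    \<open>K\<close>-module; the bound on the support is what makes \<open>zero\<close> below
    true.\<close>
  define M where "M = {m \<in> U. csupp K m \<subseteq> csupp K u}"
  have M: "gsubmodule F (G\<lparr>carrier := K\<rparr>) M V"
    unfolding M_def by (rule gsubmodule_csupp[OF K(1) L(1) K(1) L(2) conj U(1,2)])
  note D = VK.gsubmoduleD[OF M]
  have MV: "m \<in> carrier V" if "m \<in> M" for m using that D(1) by auto
  have uM: "u \<in> M" using u by (simp add: M_def)
  \<comment> \<open>The coset \<open>K\<close> itself belongs to the support of \<open>u\<close>. An
    element of \<open>M\<close> without components on \<open>K\<close> therefore has smaller support
    and vanishes: truncation to \<open>K\<close> is injective on \<open>M\<close>.\<close>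
  have zero: "m = \<zero>\<^bsub>V\<^esub>" if m: "m \<in> M" "\<And>x. x \<in> K \<Longrightarrow> \<pi> x m = \<zero>\<^bsub>W\<^esub>" for m
  proof (rule min)
    show "m \<in> U" using m by (simp add: M_def)
    have "\<one> <# K \<in> csupp K u" using u by (auto simp: csupp_def)
    moreover have "\<one> <# K \<notin> csupp K m"
    proof
      assume "\<one> <# K \<in> csupp K m"
      then obtain x where x: "x \<in> carrier G" "\<pi> x m \<noteq> \<zero>\<^bsub>W\<^esub>" "x <# K = \<one> <# K"
        by (auto simp: csupp_def)
      then show False using V.grp.l_coset_one[OF K(1) x(1)] m(2) by auto
    qed
    ultimately show "csupp K m \<subset> csupp K u" using m(1) by (auto simp: M_def)
  qed
  \<comment> \<open>The truncations to \<open>K\<close> of elements of \<open>M\<close>. That of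
    \<open>u\<close> is nonzero, so irreducibility over \<open>K\<close> puts the image of
    \<open>\<iota>\<close> into \<open>A\<close>.\<close>
  define A where "A = {v \<in> supported K. \<exists>m\<in>M. \<forall>x\<in>K. \<pi> x m = \<pi> x v}"
  note S = VK.gsubmoduleD[OF gsubmodule_supported[OF K(1)]]
  have SV: "v \<in> carrier V" if "v \<in> supported K" for v using that S(1) by auto
  have inv_mult: "inv k \<otimes> x \<in> K" if "k \<in> K" "x \<in> K" for k x
    using that K(1) by (simp add: subgroup.m_closed subgroup.m_inv_closed)
  have A: "gsubmodule F (G\<lparr>carrier := K\<rparr>) A V"
  proof (rule VK.gsubmoduleI)
    show "A \<subseteq> carrier V" using SV by (auto simp: A_def)
    show "\<zero>\<^bsub>V\<^esub> \<in> A" using S(2) D(2) by (auto simp: A_def)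
  next
    fix v v' assume "v \<in> A" "v' \<in> A"
    then obtain m m' where "v \<in> supported K" "v' \<in> supported K" "m \<in> M" "m' \<in> M"
      "\<forall>x\<in>K. \<pi> x m = \<pi> x v" "\<forall>x\<in>K. \<pi> x m' = \<pi> x v'" by (auto simp: A_def)
    then show "v \<oplus>\<^bsub>V\<^esub> v' \<in> A" unfolding A_def
      using S(3) D(3) KG SV MV by (auto simp: coord_add intro!: bexI[of _ "m \<oplus>\<^bsub>V\<^esub> m'"])
  next
    fix c v assume "c \<in> carrier F" "v \<in> A"
    moreover from this obtain m where "v \<in> supported K" "m \<in> M" "\<forall>x\<in>K. \<pi> x m = \<pi> x v"
      by (auto simp: A_def)
    ultimately show "c \<odot>\<^bsub>V\<^esub> v \<in> A" unfolding A_def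
      using S(4) D(4) KG SV MV by (auto simp: coord_smult intro!: bexI[of _ "c \<odot>\<^bsub>V\<^esub> m"])
  next
    fix g v assume "g \<in> carrier (G\<lparr>carrier := K\<rparr>)" "v \<in> A"
    moreover from this obtain m where "v \<in> supported K" "m \<in> M" "\<forall>x\<in>K. \<pi> x m = \<pi> x v"
      by (auto simp: A_def)
    ultimately show "gact V g v \<in> A" unfolding A_def
      using S(5) D(5) KG SV MV inv_mult
      by (auto simp: coord_act intro!: bexI[of _ "gact V g m"])
  qed
  have "A \<noteq> {\<zero>\<^bsub>V\<^esub>}"
  proof -
    obtain v where v: "v \<in> carrier V" "\<forall>x\<in>carrier G. \<pi> x v = (if x \<in> K then \<pi> x u else \<zero>\<^bsub>W\<^esub>)"
      using exists_trunc[OF K, of u] MV[OF uM] by blast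
    then have "v \<in> A" using uM KG by (auto simp: A_def supported_def intro!: bexI[of _ u])
    moreover have "v \<noteq> \<zero>\<^bsub>V\<^esub>" using v(2)[rule_format, of \<one>] u(2) subgroup.one_closed[OF K(1)] by auto
    ultimately show ?thesis by auto
  qed
  then have embA: "\<iota> w \<in> A" if "w \<in> carrier W" for w
    using irr_overD[OF irr A _ _ that] by (auto simp: A_def)
  \<comment> \<open>The inverse of truncation, taken on the image of \<open>\<iota>\<close>: total
    by \<open>embA\<close>, single-valued by \<open>zero\<close>.\<close>
  define R where "R w m \<longleftrightarrow> m \<in> M \<and> (\<forall>x\<in>K. \<pi> x m = \<pi> x (\<iota> w))" for w m
  have "\<exists>f\<in>ghom F (G\<lparr>carrier := H\<rparr>) W V. \<forall>w\<in>carrier W. R w (f w)"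
  proof (rule exists_ghom_of_relation[OF W.gmodule_axioms VH.gmodule_axioms])
    show "\<exists>m. R w m" if "w \<in> carrier W" for w using embA[OF that] by (auto simp: A_def R_def)
    show "m = \<zero>\<^bsub>V\<^esub>" if "R \<zero>\<^bsub>W\<^esub> m" for m
    proof (rule zero)
      show "\<pi> x m = \<zero>\<^bsub>W\<^esub>" if "x \<in> K" for x
        using \<open>R \<zero>\<^bsub>W\<^esub> m\<close> that KG emb_zero by (simp add: R_def)
    qed (use that in \<open>simp add: R_def\<close>)
    show "R (gact W g w) (gact V g m)" if "g \<in> carrier (G\<lparr>carrier := H\<rparr>)" "w \<in> carrier W" "R w m" for g w m
      using that K(2) D(5)[of g m] KG MV inv_mult unfolding R_def
      by (auto simp: coord_act emb_act subset_iff)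
  qed (use D MV KG in \<open>auto simp: R_def coord_add coord_smult emb_add emb_smult\<close>)
  then obtain f where f: "f \<in> ghom F (G\<lparr>carrier := H\<rparr>) W V"
    and Rf: "\<And>w. w \<in> carrier W \<Longrightarrow> R w (f w)" by blast
  \<comment> \<open>On \<open>K\<close> the two agree by construction. Off \<open>K\<close>, hence
    off \<open>H\<close>, both have zero coordinates: \<open>f w\<close> by Mackey's hypothesis,
    \<open>\<iota> w\<close> by its definition.\<close>
  have "f w = \<iota> w" if w: "w \<in> carrier W" for w
  proof (rule eqI)
    fix x assume x: "x \<in> carrier G"
    show "\<pi> x (f w) = \<pi> x (\<iota> w)"
    proof (cases "x \<in> K")
      case True then show ?thesis using Rf[OF w] by (auto simp: R_def)
    next
      case False
      then have "x \<notin> H" using K(2) by auto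
      then show ?thesis using coord_hom_zero[OF f x _ w] x w by (simp add: coord_emb)
    qed
  qed (use ghomD(1)[OF f] w in auto)
  then show "\<iota> ` carrier W \<subseteq> U" using Rf by (auto simp: R_def M_def)
qed

end

section \<open>Sums of copies of an irreducible module\<close>

lemma irreducible_gmoduleD:
  assumes "irreducible_gmodule F G V"
  shows "gmodule F G V" "carrier V \<noteq> {\<zero>\<^bsub>V\<^esub>}"
    "gsubmodule F G U V \<Longrightarrow> u \<in> U \<Longrightarrow> u \<noteq> \<zero>\<^bsub>V\<^esub> \<Longrightarrow> U = carrier V"
  using assms by (auto simp: irreducible_gmodule_def)

lemma ghom_inj_onI:
  assumes U: "gmodule F N U" and W: "gmodule F N W" and j: "j \<in> ghom F N U W"
    and ker: "\<And>a. a \<in> carrier U \<Longrightarrow> j a = \<zero>\<^bsub>W\<^esub> \<Longrightarrow> a = \<zero>\<^bsub>U\<^esub>"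
  shows "inj_on j (carrier U)"
proof (rule inj_onI)
  interpret U: gmodule F N U by fact
  interpret W: gmodule F N W by fact
  note D = ghomD[OF j]
  fix a b assume ab: "a \<in> carrier U" "b \<in> carrier U" "j a = j b"
  have "j (a \<oplus>\<^bsub>U\<^esub> \<ominus>\<^bsub>U\<^esub> b) = \<zero>\<^bsub>W\<^esub>"
    using ab D(1)[of b] D(2)[of a "\<ominus>\<^bsub>U\<^esub> b"] D(3)[of "\<ominus>\<^bsub>F\<^esub> \<one>\<^bsub>F\<^esub>" b]
    by (simp add: U.minus_eq_smult[of b] W.minus_eq_smult[symmetric] W.M.r_neg)
  then have "a \<ominus>\<^bsub>U\<^esub> b = \<zero>\<^bsub>U\<^esub>" using ker ab by (simp add: a_minus_def)
  then show "a = b" using U.eq_if_minus_eq_zero ab by blast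
qed

lemma gsubmodule_image:
  assumes U: "gmodule F N U" and W: "gmodule F N W" and j: "j \<in> ghom F N U W"
  shows "gsubmodule F N (j ` carrier U) W"
proof -
  interpret U: gmodule F N U by fact
  interpret W: gmodule F N W by fact
  show ?thesis
  proof (rule W.gsubmoduleI)
    show "\<zero>\<^bsub>W\<^esub> \<in> j ` carrier U" using ghom_zero[OF U W j] by (metis U.M.zero_closed imageI)
  next
    fix u v assume "u \<in> j ` carrier U" "v \<in> j ` carrier U"
    then obtain a b where "a \<in> carrier U" "b \<in> carrier U" "u = j a" "v = j b" by blast
    then show "u \<oplus>\<^bsub>W\<^esub> v \<in> j ` carrier U"
      using ghomD(2)[OF j, of a b] by (metis U.M.a_closed imageI)
  next
    fix c u assume c: "c \<in> carrier F" and "u \<in> j ` carrier U"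
    then obtain a where "a \<in> carrier U" "u = j a" by blast
    then show "c \<odot>\<^bsub>W\<^esub> u \<in> j ` carrier U"
      using ghomD(3)[OF j c, of a] c by (metis U.smult_closed imageI)
  next
    fix g u assume g: "g \<in> carrier N" and "u \<in> j ` carrier U"
    then obtain a where "a \<in> carrier U" "u = j a" by blast
    then show "gact W g u \<in> j ` carrier U"
      using ghomD(4)[OF j g, of a] g by (metis U.act_closed imageI)
  qed (use ghomD(1)[OF j] in auto)
qed

lemma gsubmodule_vimage:
  assumes U: "gmodule F N U" and W: "gmodule F N W" and j: "j \<in> ghom F N U W"
    and T: "gsubmodule F N T W"
  shows "gsubmodule F N {a \<in> carrier U. j a \<in> T} U"
proof -
  interpret U: gmodule F N U by fact
  interpret W: gmodule F N W by fact
  show ?thesis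
    by (rule U.gsubmoduleI)
      (use W.gsubmoduleD[OF T] ghom_zero[OF U W j] in \<open>auto simp: ghomD[OF j]\<close>)
qed

definition embeddings ::
  "('f, 'm) ring_scheme \<Rightarrow> ('g, 'n) monoid_scheme \<Rightarrow> ('g, 'f, 'v, 'k) gmodule_scheme
    \<Rightarrow> ('g, 'f, 'w, 'l) gmodule_scheme \<Rightarrow> ('v \<Rightarrow> 'w) set"
  where "embeddings F N U W = {j \<in> ghom F N U W. inj_on j (carrier U)}"

text \<open>A finite sum of images, taken over a list so that induction can remove one summand at a
  time. The sum need not be direct, and maps may repeat.\<close>

fun image_sum :: "('f, 'w, 'k) module_scheme \<Rightarrow> 'v set \<Rightarrow> ('v \<Rightarrow> 'w) list \<Rightarrow> 'w set"
  where "image_sum W A [] = {\<zero>\<^bsub>W\<^esub>}"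
  | "image_sum W A (j # js) = {j a \<oplus>\<^bsub>W\<^esub> b | a b. a \<in> A \<and> b \<in> image_sum W A js}"

lemma gsubmodule_image_sum:
  assumes U: "gmodule F N U" and W: "gmodule F N W" and js: "set js \<subseteq> ghom F N U W"
  shows "gsubmodule F N (image_sum W (carrier U) js) W"
  using js
proof (induction js)
  case Nil
  interpret W: gmodule F N W by fact
  show ?case by (rule W.gsubmoduleI) auto
next
  case (Cons j js)
  interpret U: gmodule F N U by fact
  interpret W: gmodule F N W by fact
  let ?T = "image_sum W (carrier U) js"
  have T: "gsubmodule F N ?T W" using Cons by simp
  note TD = W.gsubmoduleD[OF T]
  have TW: "b \<in> carrier W" if "b \<in> ?T" for b using that TD(1) by auto
  have j: "j \<in> ghom F N U W" using Cons by simp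
  note D = ghomD[OF j]
  show ?case
  proof (rule W.gsubmoduleI)
    show "image_sum W (carrier U) (j # js) \<subseteq> carrier W" using D TW by auto
    have "\<zero>\<^bsub>W\<^esub> = j \<zero>\<^bsub>U\<^esub> \<oplus>\<^bsub>W\<^esub> \<zero>\<^bsub>W\<^esub>" using ghom_zero[OF U W j] by simp
    then show "\<zero>\<^bsub>W\<^esub> \<in> image_sum W (carrier U) (j # js)" using TD(2) U.M.zero_closed by auto
  next
    fix u v assume "u \<in> image_sum W (carrier U) (j # js)" "v \<in> image_sum W (carrier U) (j # js)"
    then obtain a b a' b' where *: "u = j a \<oplus>\<^bsub>W\<^esub> b" "v = j a' \<oplus>\<^bsub>W\<^esub> b'"
      "a \<in> carrier U" "a' \<in> carrier U" "b \<in> ?T" "b' \<in> ?T" by auto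
    then have "u \<oplus>\<^bsub>W\<^esub> v = j (a \<oplus>\<^bsub>U\<^esub> a') \<oplus>\<^bsub>W\<^esub> (b \<oplus>\<^bsub>W\<^esub> b')"
      using TW D by (simp add: W.M.a_ac)
    moreover have "a \<oplus>\<^bsub>U\<^esub> a' \<in> carrier U" "b \<oplus>\<^bsub>W\<^esub> b' \<in> ?T" using * TD(3) by auto
    ultimately show "u \<oplus>\<^bsub>W\<^esub> v \<in> image_sum W (carrier U) (j # js)" by auto
  next
    fix c u assume c: "c \<in> carrier F" and "u \<in> image_sum W (carrier U) (j # js)"
    then obtain a b where *: "u = j a \<oplus>\<^bsub>W\<^esub> b" "a \<in> carrier U" "b \<in> ?T" by auto
    then have "c \<odot>\<^bsub>W\<^esub> u = j (c \<odot>\<^bsub>U\<^esub> a) \<oplus>\<^bsub>W\<^esub> (c \<odot>\<^bsub>W\<^esub> b)"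
      using TW D c by (simp add: W.smult_r_distr)
    moreover have "c \<odot>\<^bsub>U\<^esub> a \<in> carrier U" "c \<odot>\<^bsub>W\<^esub> b \<in> ?T" using * TD(4) c by auto
    ultimately show "c \<odot>\<^bsub>W\<^esub> u \<in> image_sum W (carrier U) (j # js)" by auto
  next
    fix g u assume g: "g \<in> carrier N" and "u \<in> image_sum W (carrier U) (j # js)"
    then obtain a b where *: "u = j a \<oplus>\<^bsub>W\<^esub> b" "a \<in> carrier U" "b \<in> ?T" by auto
    then have "gact W g u = j (gact U g a) \<oplus>\<^bsub>W\<^esub> gact W g b"
      using TW D g by (simp add: W.act_add)
    moreover have "gact U g a \<in> carrier U" "gact W g b \<in> ?T" using * TD(5) g by auto
    ultimately show "gact W g u \<in> image_sum W (carrier U) (j # js)" by auto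
  qed
qed

text \<open>A nonzero submodule of \<open>j\<^sub>1(U) + \<dots> + j\<^sub>k(U)\<close> meets \<open>j\<^sub>2(U) + \<dots> + j\<^sub>k(U)\<close> nontrivially, or
  it embeds into the quotient of the two sums, which is isomorphic to \<open>U\<close>.\<close>

lemma embedding_into_submodule:
  assumes irr: "irreducible_gmodule F N U" and W: "gmodule F N W"
    and js: "set js \<subseteq> embeddings F N U W" and M: "gsubmodule F N M W"
    and m: "m \<in> M" "m \<in> image_sum W (carrier U) js" "m \<noteq> \<zero>\<^bsub>W\<^esub>"
  shows "\<exists>j\<in>embeddings F N U W. j ` carrier U \<subseteq> M"
  using js m
proof (induction js arbitrary: m)
  case Nil
  then show ?case by simp
next
  case (Cons j js)
  note U = irreducible_gmoduleD(1)[OF irr]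
  interpret U: gmodule F N U by (rule U)
  interpret W: gmodule F N W by fact
  let ?T = "image_sum W (carrier U) js"
  have T: "gsubmodule F N ?T W"
    using Cons.prems by (intro gsubmodule_image_sum[OF U W]) (auto simp: embeddings_def)
  note TD = W.gsubmoduleD[OF T] and MD = W.gsubmoduleD[OF M]
  have TW: "b \<in> carrier W" if "b \<in> ?T" for b using that TD(1) by auto
  have MW: "b \<in> carrier W" if "b \<in> M" for b using that MD(1) by auto
  have j: "j \<in> ghom F N U W" and inj: "inj_on j (carrier U)"
    using Cons.prems by (auto simp: embeddings_def)
  note D = ghomD[OF j]
  note j0 = ghom_zero[OF U W j]
  show ?case
  proof (cases "\<exists>m'\<in>M. m' \<in> ?T \<and> m' \<noteq> \<zero>\<^bsub>W\<^esub>")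
    case True
    then show ?thesis using Cons by auto
  next
    case False
    then have MT: "m' = \<zero>\<^bsub>W\<^esub>" if "m' \<in> M" "m' \<in> ?T" for m' using that by blast
    obtain a b where m: "m = j a \<oplus>\<^bsub>W\<^esub> b" "a \<in> carrier U" "b \<in> ?T" using Cons.prems by auto
    \<comment> \<open>If the preimage of \<open>?T\<close> under \<open>j\<close> were nonzero,
      irreducibility would make it all of \<open>U\<close>, and \<open>m\<close> would lie in
      \<open>?T\<close>, contrary to \<open>MT\<close>.\<close>
    have jT: "a' = \<zero>\<^bsub>U\<^esub>" if a': "a' \<in> carrier U" "j a' \<in> ?T" for a'
    proof (rule ccontr)
      assume "a' \<noteq> \<zero>\<^bsub>U\<^esub>"
      then have "{a \<in> carrier U. j a \<in> ?T} = carrier U"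
        using irreducible_gmoduleD(3)[OF irr gsubmodule_vimage[OF U W j T], of a'] a' by blast
      then have "j a \<in> ?T" using m by blast
      then have "m \<in> ?T" using m TD(3) by simp
      then show False using MT Cons.prems by blast
    qed
    \<comment> \<open>\<open>R a v\<close> says that \<open>v\<close> is an element of
      \<open>M\<close> congruent to \<open>j a\<close> modulo \<open>?T\<close>. As \<open>M\<close>
      meets \<open>?T\<close> only in zero, \<open>a\<close> determines \<open>v\<close>.\<close>
    define R where "R a v \<longleftrightarrow> v \<in> M \<and> (\<exists>b\<in>?T. v = j a \<oplus>\<^bsub>W\<^esub> b)" for a v
    have R_zero: "R \<zero>\<^bsub>U\<^esub> \<zero>\<^bsub>W\<^esub>"
      unfolding R_def using MD(2) TD(2) j0 by (auto intro!: bexI[of _ "\<zero>\<^bsub>W\<^esub>"])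
    have R_add: "R (a \<oplus>\<^bsub>U\<^esub> a') (v \<oplus>\<^bsub>W\<^esub> v')"
      if "a \<in> carrier U" "a' \<in> carrier U" and R: "R a v" "R a' v'" for a a' v v'
    proof -
      obtain b b' where *: "b \<in> ?T" "b' \<in> ?T" "v = j a \<oplus>\<^bsub>W\<^esub> b" "v' = j a' \<oplus>\<^bsub>W\<^esub> b'"
        using R by (auto simp: R_def)
      then have "v \<oplus>\<^bsub>W\<^esub> v' = j (a \<oplus>\<^bsub>U\<^esub> a') \<oplus>\<^bsub>W\<^esub> (b \<oplus>\<^bsub>W\<^esub> b')"
        using TW D that by (simp add: W.M.a_ac)
      then show ?thesis using R MD(3) TD(3) * unfolding R_def by blast
    qed
    have R_smult: "R (c \<odot>\<^bsub>U\<^esub> a) (c \<odot>\<^bsub>W\<^esub> v)" if "c \<in> carrier F" "a \<in> carrier U" and R: "R a v" for c a v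
    proof -
      obtain b where *: "b \<in> ?T" "v = j a \<oplus>\<^bsub>W\<^esub> b" using R by (auto simp: R_def)
      then have "c \<odot>\<^bsub>W\<^esub> v = j (c \<odot>\<^bsub>U\<^esub> a) \<oplus>\<^bsub>W\<^esub> (c \<odot>\<^bsub>W\<^esub> b)"
        using TW D that by (simp add: W.smult_r_distr)
      then show ?thesis using R MD(4) TD(4) * that unfolding R_def by blast
    qed
    have R_act: "R (gact U g a) (gact W g v)" if "g \<in> carrier N" "a \<in> carrier U" and R: "R a v" for g a v
    proof -
      obtain b where *: "b \<in> ?T" "v = j a \<oplus>\<^bsub>W\<^esub> b" using R by (auto simp: R_def)
      then have "gact W g v = j (gact U g a) \<oplus>\<^bsub>W\<^esub> gact W g b"
        using TW D that by (simp add: W.act_add)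
      then show ?thesis using R MD(5) TD(5) * that unfolding R_def by blast
    qed
    \<comment> \<open>The \<open>a\<close> that are related to some \<open>v\<close> form a
      submodule of \<open>U\<close>; it contains the nonzero \<open>a\<close> coming from
      \<open>m\<close>, so it is everything.\<close>
    have A: "gsubmodule F N {a \<in> carrier U. \<exists>v. R a v} U"
      by (rule U.gsubmoduleI) (use R_zero R_add R_smult R_act in blast)+
    have a: "a \<in> {a \<in> carrier U. \<exists>v. R a v}" using m Cons.prems by (auto simp: R_def)
    have "a \<noteq> \<zero>\<^bsub>U\<^esub>"
    proof
      assume "a = \<zero>\<^bsub>U\<^esub>"
      then have "m \<in> ?T" using m j0 TW by simp
      then show False using MT Cons.prems by blast
    qed
    then have total: "{a \<in> carrier U. \<exists>v. R a v} = carrier U"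
      using irreducible_gmoduleD(3)[OF irr A a] by blast
    have "\<exists>f\<in>ghom F N U W. \<forall>a\<in>carrier U. R a (f a)"
    proof (rule exists_ghom_of_relation[OF U W _ _ _ R_add R_smult R_act])
      show "\<exists>v. R a v" if "a \<in> carrier U" for a using that total by blast
      show "v \<in> carrier W" if "R a v" for a v using that MW unfolding R_def by blast
      show "v = \<zero>\<^bsub>W\<^esub>" if R0: "R \<zero>\<^bsub>U\<^esub> v" for v
      proof -
        obtain b where b: "b \<in> ?T" "v = j \<zero>\<^bsub>U\<^esub> \<oplus>\<^bsub>W\<^esub> b" "v \<in> M"
          using R0 unfolding R_def by (elim conjE bexE) (rule that)
        have "v = b" unfolding b(2) j0 using TW[OF b(1)] by (rule W.M.l_zero)
        then show ?thesis using MT b(1,3) by blast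
      qed
    qed
    then obtain f where f: "f \<in> ghom F N U W" and Rf: "\<And>a. a \<in> carrier U \<Longrightarrow> R a (f a)" by blast
    have "inj_on f (carrier U)"
    proof (rule ghom_inj_onI[OF U W f])
      fix a assume a: "a \<in> carrier U" "f a = \<zero>\<^bsub>W\<^esub>"
      then obtain b where b: "b \<in> ?T" "j a \<oplus>\<^bsub>W\<^esub> b = \<zero>\<^bsub>W\<^esub>" using Rf[OF a(1)] by (auto simp: R_def)
      then have "\<ominus>\<^bsub>W\<^esub> b = j a" using a D TW by (intro W.M.minus_equality) auto
      then have "j a \<in> ?T" using TD(4)[of "\<ominus>\<^bsub>F\<^esub> \<one>\<^bsub>F\<^esub>" b] b W.minus_eq_smult[OF TW[OF b(1)]] by simp
      then show "a = \<zero>\<^bsub>U\<^esub>" using jT a by blast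
    qed
    moreover have "f ` carrier U \<subseteq> M" using Rf by (auto simp: R_def)
    ultimately show ?thesis using f by (auto simp: embeddings_def)
  qed
qed

text \<open>Concatenation of lists makes the union of all finite sums of copies of \<open>U\<close>
  closed under addition.\<close>

lemma image_sum_append:
  assumes W: "gmodule F N W" and U: "gmodule F N U"
    and js: "set js \<subseteq> ghom F N U W" and ks: "set ks \<subseteq> ghom F N U W"
    and u: "u \<in> image_sum W (carrier U) js" and v: "v \<in> image_sum W (carrier U) ks"
  shows "u \<oplus>\<^bsub>W\<^esub> v \<in> image_sum W (carrier U) (js @ ks)"
proof -
  interpret W: gmodule F N W by fact
  have v': "v \<in> carrier W" using W.gsubmoduleD(1)[OF gsubmodule_image_sum[OF U W ks]] v by auto
  show ?thesis using js u
  proof (induction js arbitrary: u)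
    case Nil
    then show ?case using v v' by simp
  next
    case (Cons j js)
    then obtain a b where *: "u = j a \<oplus>\<^bsub>W\<^esub> b" "a \<in> carrier U" "b \<in> image_sum W (carrier U) js" by auto
    have "b \<in> carrier W"
      using W.gsubmoduleD(1)[OF gsubmodule_image_sum[OF U W, of js]] Cons.prems * by auto
    moreover have "j a \<in> carrier W" using Cons.prems * ghomD(1)[of j F N U W a] by auto
    ultimately have "u \<oplus>\<^bsub>W\<^esub> v = j a \<oplus>\<^bsub>W\<^esub> (b \<oplus>\<^bsub>W\<^esub> v)" using * v' by (simp add: W.M.a_assoc)
    moreover have "b \<oplus>\<^bsub>W\<^esub> v \<in> image_sum W (carrier U) (js @ ks)" using Cons * by auto
    ultimately show ?case using * by auto
  qed
qed

section \<open>Unions of chains and ascendant series\<close>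

context mackey_gmodule
begin

text \<open>Supports are finite, so a nonzero element of \<open>U\<close> is already supported on
  some \<open>C i\<close>, and irreducibility over \<open>C i\<close> applies to the intersection of
  \<open>U\<close> with \<open>supported (C i)\<close>.\<close>

lemma irr_over_Union:
  assumes I: "I \<noteq> {}" and C: "\<And>i. i \<in> I \<Longrightarrow> subgroup (C i) G" "\<And>i. i \<in> I \<Longrightarrow> H \<subseteq> C i"
    and chain: "\<And>i k. i \<in> I \<Longrightarrow> k \<in> I \<Longrightarrow> C i \<subseteq> C k \<or> C k \<subseteq> C i"
    and irr: "\<And>i. i \<in> I \<Longrightarrow> irr_over (C i)" and K: "subgroup (\<Union>i\<in>I. C i) G"
  shows "irr_over (\<Union>i\<in>I. C i)"
  unfolding irr_over_def
proof (intro allI impI)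
  let ?K = "\<Union>i\<in>I. C i"
  fix U assume U: "gsubmodule F (G\<lparr>carrier := ?K\<rparr>) U V" "U \<subseteq> supported ?K" "U \<noteq> {\<zero>\<^bsub>V\<^esub>}"
  interpret VK: gmodule F "G\<lparr>carrier := ?K\<rparr>" V by (rule V.restrict_group[OF K])
  note D = VK.gsubmoduleD[OF U(1)]
  obtain u where u: "u \<in> U" "u \<noteq> \<zero>\<^bsub>V\<^esub>" using U D(2) by blast
  have uV: "u \<in> carrier V" using u D(1) by blast
  have "finite (csupp H u)" using finite_csupp[OF subgroup_H _ uV] by simp
  \<comment> \<open>Finitely many representatives of the cosets of \<open>H\<close> in the support;
    since the \<open>C i\<close> form a chain, one of them will contain all of
    \<open>X\<close>.\<close>
  then obtain X where X: "finite X" "X \<subseteq> {x \<in> carrier G. \<pi> x u \<noteq> \<zero>\<^bsub>W\<^esub>}"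
    "csupp H u = (\<lambda>x. x <# H) ` X"
    using finite_subset_image[of "csupp H u" "\<lambda>x. x <# H" "{x \<in> carrier G. \<pi> x u \<noteq> \<zero>\<^bsub>W\<^esub>}"]
    by (auto simp: csupp_def)
  have "X \<subseteq> ?K"
  proof (rule subsetI, rule ccontr)
    fix x assume x: "x \<in> X" "x \<notin> ?K"
    have "u \<in> supported ?K" using u U(2) by blast
    then have "\<pi> x u = \<zero>\<^bsub>W\<^esub>" using x X(2) by (simp add: supported_def subset_iff)
    then show False using x X(2) by blast
  qed
  with X(1) have "\<exists>i\<in>I. X \<subseteq> C i"
  proof (induction X rule: finite_induct)
    case empty
    show ?case using I by auto
  next
    case (insert x X)
    then obtain i k where ik: "i \<in> I" "X \<subseteq> C i" "k \<in> I" "x \<in> C k" by blast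
    consider "C i \<subseteq> C k" | "C k \<subseteq> C i" using chain ik by blast
    then show ?case using ik by cases blast+
  qed
  then obtain i where i: "i \<in> I" "X \<subseteq> C i" by blast
  have "u \<in> supported (C i)"
    unfolding supported_def
  proof (intro CollectI conjI ballI uV, rule ccontr)
    fix x assume x: "x \<in> carrier G - C i" "\<pi> x u \<noteq> \<zero>\<^bsub>W\<^esub>"
    then have "x <# H \<in> csupp H u" by (auto simp: csupp_def)
    then obtain y where y: "y \<in> X" "x <# H = y <# H" using X by auto
    have yG: "y \<in> carrier G" using y X by auto
    \<comment> \<open>As \<open>C i\<close> contains \<open>H\<close>, it contains with
      \<open>y\<close> the whole coset \<open>y <# H\<close>.\<close>
    have "inv y \<otimes> x \<in> C i"
      using V.grp.l_coset_eq_iff[OF subgroup_H yG, of x] y x C(2)[OF i(1)] by auto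
    then have "y \<otimes> (inv y \<otimes> x) \<in> C i"
      using subgroup.m_closed[OF C(1)[OF i(1)], of y "inv y \<otimes> x"] y i(2) by blast
    then show False using x yG by (simp add: V.grp.mult_inv_mult_cancel)
  qed
  then have ne: "U \<inter> supported (C i) \<noteq> {\<zero>\<^bsub>V\<^esub>}" using u by blast
  interpret VC: gmodule F "G\<lparr>carrier := C i\<rparr>" V by (rule V.restrict_group[OF C(1)[OF i(1)]])
  have "gsubmodule F (G\<lparr>carrier := C i\<rparr>) (U \<inter> supported (C i)) V"
    using i(1) by (intro VC.gsubmodule_Int[OF gsubmodule_mono[OF U(1)]] gsubmodule_supported C) auto
  from irr_overD[OF irr[OF i(1)] this _ ne] show "\<iota> ` carrier W \<subseteq> U" by blast
qed

text \<open>Monotonicity of \<open>C\<close> is only implicit in the definition of the series, so it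
  is carried along in the transfinite induction. It yields \<open>H \<subseteq> C y\<close> at a
  successor step and the chain condition at a limit.\<close>

lemma irr_over_ascendant:
  assumes "strongly_ascendant_series F G H J r C"
  shows "irr_over (carrier G)"
proof -
  have wo: "well_order_on J r" and sub: "\<And>x. x \<in> J \<Longrightarrow> subgroup (C x) G"
    using assms by (auto simp: strongly_ascendant_series_def)
  obtain x0 x1 where ends: "x0 \<in> J" "x1 \<in> J" "\<forall>x\<in>J. (x0, x) \<in> r" "\<forall>x\<in>J. (x, x1) \<in> r"
    "C x0 = H" "C x1 = carrier G"
    and succ': "\<forall>x\<in>J. \<forall>x'\<in>J. x \<noteq> x1 \<and> immediate_succ r x x' \<longrightarrow>
      C x \<lhd> G\<lparr>carrier := C x'\<rparr> \<and> finite (rcosets\<^bsub>G\<lparr>carrier := C x'\<rparr>\<^esub> C x) \<and>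
      \<not> ring_char F dvd card (rcosets\<^bsub>G\<lparr>carrier := C x'\<rparr>\<^esub> C x)"
    and lim': "\<forall>x\<in>J. x \<noteq> x0 \<and> \<not> (\<exists>y\<in>J. immediate_succ r y x) \<longrightarrow>
      C x = (\<Union>y\<in>underS r x. C y)"
    using assms unfolding strongly_ascendant_series_def
    by (elim conjE bexE) (rule that)
  have x0: "x0 \<in> J" "\<And>x. x \<in> J \<Longrightarrow> (x0, x) \<in> r" "C x0 = H"
    and x1: "x1 \<in> J" "\<And>x. x \<in> J \<Longrightarrow> (x, x1) \<in> r" "C x1 = carrier G"
    using ends by simp_all
  have succ: "C x \<lhd> G\<lparr>carrier := C x'\<rparr>"
    if "x \<in> J" "x' \<in> J" "x \<noteq> x1" "immediate_succ r x x'" for x x'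
    using succ'[rule_format, of x x'] that by simp
  have lim: "C x = (\<Union>y\<in>underS r x. C y)"
    if "x \<in> J" "x \<noteq> x0" "\<not> (\<exists>y\<in>J. immediate_succ r y x)" for x
    using lim'[rule_format, of x] that by simp
  have wf: "wf (r - Id)" and lin: "linear_order_on J r"
    using wo by (auto simp: well_order_on_def)
  have rJ: "r \<subseteq> J \<times> J" using lin
    by (auto simp: linear_order_on_def partial_order_on_def preorder_on_def refl_on_def)
  have antisym: "x = y" if "(x, y) \<in> r" "(y, x) \<in> r" for x y
    using lin that by (auto simp: linear_order_on_def partial_order_on_def antisym_def)
  have total: "(x, y) \<in> r \<or> (y, x) \<in> r" if "x \<in> J" "y \<in> J" for x y
    using lin that x0 by (cases "x = y")
      (auto simp: linear_order_on_def partial_order_on_def preorder_on_def refl_on_def total_on_def)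
  have "x \<in> J \<longrightarrow> (\<forall>y. (y, x) \<in> r \<longrightarrow> C y \<subseteq> C x) \<and> irr_over (C x)" for x
    using wf
  proof (induction x rule: wf_induct_rule)
    case (less x)
    show ?case
    proof
      assume x: "x \<in> J"
      have IH: "z \<in> J" "C y \<subseteq> C z" "irr_over (C z)" if "(z, x) \<in> r" "z \<noteq> x" "(y, z) \<in> r" for y z
        using less[of z] that rJ by auto
      have refl: "(z, z) \<in> r" if "z \<in> J" for z using total[OF that that] by simp
      have HC: "H \<subseteq> C z" if "(z, x) \<in> r" "z \<noteq> x" for z
        using IH(2)[OF that, of x0] x0 rJ that by auto
      consider "x = x0" | y where "x \<noteq> x0" "y \<in> J" "immediate_succ r y x"
        | "x \<noteq> x0" "\<not> (\<exists>y\<in>J. immediate_succ r y x)" by blast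
      then show "(\<forall>y. (y, x) \<in> r \<longrightarrow> C y \<subseteq> C x) \<and> irr_over (C x)"
      proof cases
        case 1
        have "y = x" if "(y, x) \<in> r" for y using that 1 x0(2)[of y] rJ antisym by blast
        then show ?thesis using 1 x0(3) irr_over_H by auto
      next
        case 2
        have yx: "(y, x) \<in> r" "y \<noteq> x" "\<And>z. (y, z) \<in> r \<Longrightarrow> (z, x) \<in> r \<Longrightarrow> z = y \<or> z = x"
          using 2 by (auto simp: immediate_succ_def)
        \<comment> \<open>\<open>x1\<close> is the last element, while \<open>y\<close> has a
          successor.\<close>
        have "y \<noteq> x1" using yx antisym x1(2)[OF x] by blast
        then have nor: "C y \<lhd> G\<lparr>carrier := C x\<rparr>" using succ 2 x by blast
        have sy: "subgroup (C y) G" and sx: "subgroup (C x) G" using sub 2 x by auto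
        have sub': "C y \<subseteq> C x" using nor normal_imp_subgroup subgroup.subset by fastforce
        have conj: "inv l \<otimes> k \<otimes> l \<in> C y" if "k \<in> C y" "l \<in> C x" for k l
          using normal.inv_op_closed1[OF nor, of l k] that
            V.grp.m_inv_consistent[OF sx that(2)] by simp
        have "irr_over (C x)"
          using IH(3)[OF yx(1,2) refl] 2
          by (intro irr_over_normal[OF sy HC[OF yx(1,2)] sx sub' conj]) auto
        moreover have "C z \<subseteq> C x" if z: "(z, x) \<in> r" for z
        proof (cases "z = x")
          case False
          \<comment> \<open>As \<open>x\<close> is the immediate successor of \<open>y\<close>,
            whatever lies strictly below \<open>x\<close> is at most \<open>y\<close>.\<close>
          have "(z, y) \<in> r"
            using total[of z y] z rJ 2 yx(3)[of z] False refl by blast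
          then show ?thesis using IH(2)[OF yx(1,2)] sub' by blast
        qed simp
        ultimately show ?thesis by blast
      next
        case 3
        have Cx: "C x = (\<Union>y\<in>underS r x. C y)" using lim x 3 by blast
        have u: "y \<in> J" "(y, x) \<in> r" "y \<noteq> x" if "y \<in> underS r x" for y
          using that rJ by (auto simp: underS_def)
        have "irr_over (\<Union>y\<in>underS r x. C y)"
        proof (rule irr_over_Union)
          show "underS r x \<noteq> {}" using x0(2)[OF x] 3 by (auto simp: underS_def)
          show "subgroup (C y) G" if "y \<in> underS r x" for y using sub u that by blast
          show "H \<subseteq> C y" if "y \<in> underS r x" for y using HC u that by blast
          show "C i \<subseteq> C k \<or> C k \<subseteq> C i" if "i \<in> underS r x" "k \<in> underS r x" for i k
            using total[of i k] u[OF that(1)] u[OF that(2)] IH(2) by blast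
          show "irr_over (C y)" if "y \<in> underS r x" for y
            using u[OF that] IH(3)[of y y] refl by blast
          show "subgroup (\<Union>y\<in>underS r x. C y) G" using sub[OF x] Cx by simp
        qed
        moreover have "C z \<subseteq> C x" if z: "(z, x) \<in> r" for z
          using z Cx by (cases "z = x") (auto simp: underS_def)
        ultimately show ?thesis using Cx by auto
      qed
    qed
  qed
  then show ?thesis using x1 by metis
qed

end

section \<open>Isotypic modules and inertia groups\<close>

context mackey_gmodule
begin

text \<open>In the second case of the proof, \<open>u\<close> gives an isomorphism of nonzero \<open>N\<close>-submodules of \<open>W\<close> and
  \<open>\<^sup>xW\<close> with \<open>x \<notin> H\<close>. Since \<open>W\<close> is a sum of copies of \<open>W\<^sub>0\<close>, this puts \<open>x\<close> in the inertia group.\<close>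

lemma irr_over_inertia_group:
  fixes W0 :: "('g, 'f, 'u, 'r) gmodule_scheme"
  assumes nor: "N \<lhd> G" and NH: "N \<subseteq> H" and irr: "irreducible_gmodule F (G\<lparr>carrier := N\<rparr>) W0"
    and over: "lies_over F G N W W0" and inertia: "H = inertia_group F G N W0"
  shows "irr_over (carrier G)"
proof -
  let ?N = "G\<lparr>carrier := N\<rparr>"
  have sN: "subgroup N G" using nor normal_imp_subgroup by blast
  have NG: "n \<in> carrier G" if "n \<in> N" for n using that subgroup.subset[OF sN] by blast
  have conjN: "inv x \<otimes> n \<otimes> x \<in> N" "x \<otimes> n \<otimes> inv x \<in> N" if "n \<in> N" "x \<in> carrier G" for n x
    using normal.inv_op_closed1[OF nor] normal.inv_op_closed2[OF nor] that by auto
  note W0 = irreducible_gmoduleD(1)[OF irr]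
  interpret W0: gmodule F ?N W0 by (rule W0)
  have sNH: "subgroup N (G\<lparr>carrier := H\<rparr>)" using V.grp.subgroup_incl[OF sN subgroup_H NH] .
  from W.restrict_group[OF this] have WN: "gmodule F ?N W" by simp
  interpret WN: gmodule F ?N W by (rule WN)
  interpret VN: gmodule F ?N V by (rule V.restrict_group[OF sN])
  let ?E = "embeddings F ?N W0 W"
  have Eg: "?E \<subseteq> ghom F ?N W0 W" by (auto simp: embeddings_def)
  obtain a0 where a0: "a0 \<in> carrier W0" "a0 \<noteq> \<zero>\<^bsub>W0\<^esub>"
    using irreducible_gmoduleD(2)[OF irr] W0.M.zero_closed by blast
  have nz: "j a0 \<noteq> \<zero>\<^bsub>W\<^esub>" if "j \<in> ?E" for j
  proof
    assume "j a0 = \<zero>\<^bsub>W\<^esub>"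
    then have "j a0 = j \<zero>\<^bsub>W0\<^esub>" using ghom_zero[OF W0 WN, of j] that by (auto simp: embeddings_def)
    then show False using a0 that by (auto simp: embeddings_def dest: inj_onD)
  qed
  \<comment> \<open>The isomorphism onto a submodule that \<open>lies_over\<close> provides, read as
    an embedding into \<open>W\<close>.\<close>
  obtain j0 where j0: "j0 \<in> ?E"
  proof -
    obtain U f where U: "gsubmodule F ?N U W"
      and f: "f \<in> carrier (ghom_space F ?N W0 (W\<lparr>carrier := U\<rparr>))"
      "bij_betw f (carrier W0) (carrier (W\<lparr>carrier := U\<rparr>))"
      using over unfolding lies_over_def gmodule_iso_def by blast
    have "f \<in> ghom F ?N W0 W"
      using ghomD[OF ghom_space_subset[OF f(1)]] WN.gsubmoduleD(1)[OF U]
      by (intro ghomI) auto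
    then show thesis using that f(2) by (auto simp: embeddings_def bij_betw_def)
  qed
  \<comment> \<open>Translation by \<open>h\<close> turns a copy of \<open>W0\<close> into a copy of
    a conjugate of \<open>W0\<close>; as \<open>h\<close> lies in the inertia group,
    \<open>\<psi>\<close> identifies this conjugate with \<open>W0\<close> again.\<close>
  have conj_emb: "\<exists>j'\<in>?E. j' ` carrier W0 = gact W h ` j ` carrier W0" if h: "h \<in> H" and j: "j \<in> ?E" for h j
  proof -
    note jD = ghomD[of j F ?N W0 W]
    have jg: "j \<in> ghom F ?N W0 W" using j Eg by blast
    have "h \<in> inertia_group F G N W0" using h inertia by simp
    then have "gmodule_iso F ?N (right_conj G W0 h) W0" by (simp add: inertia_group_def)
    then obtain \<psi> where \<psi>': "\<psi> \<in> carrier (ghom_space F ?N (right_conj G W0 h) W0)"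
      "bij_betw \<psi> (carrier (right_conj G W0 h)) (carrier W0)"
      unfolding gmodule_iso_def by blast
    have \<psi>: "\<psi> \<in> ghom F ?N (right_conj G W0 h) W0" "bij_betw \<psi> (carrier W0) (carrier W0)"
      using ghom_space_subset[OF \<psi>'(1)] \<psi>'(2) by (simp_all add: right_conj_def)
    have \<psi>c: "\<psi> a \<in> carrier W0" if "a \<in> carrier W0" for a
      using \<psi>(2) that by (auto simp: bij_betw_def)
    have \<psi>D: "\<psi> (a \<oplus>\<^bsub>W0\<^esub> b) = \<psi> a \<oplus>\<^bsub>W0\<^esub> \<psi> b" "\<psi> (c \<odot>\<^bsub>W0\<^esub> a) = c \<odot>\<^bsub>W0\<^esub> \<psi> a"
      if "a \<in> carrier W0" "b \<in> carrier W0" "c \<in> carrier F" for a b c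
      using ghomD(2,3)[OF \<psi>(1)] that by (simp_all add: right_conj_def)
    have \<psi>act: "\<psi> (gact W0 (h \<otimes> n \<otimes> inv h) a) = gact W0 n (\<psi> a)" if "n \<in> N" "a \<in> carrier W0" for n a
      using ghomD(4)[OF \<psi>(1), of n a] that by (simp add: right_conj_def)
    define j' where "j' a = gact W h (j (\<psi> a))" for a
    have "j' \<in> ghom F ?N W0 W"
    proof (rule ghomI)
      fix a b assume "a \<in> carrier W0" "b \<in> carrier W0"
      then show "j' (a \<oplus>\<^bsub>W0\<^esub> b) = j' a \<oplus>\<^bsub>W\<^esub> j' b"
        using \<psi>c \<psi>D(1)[of a b "\<one>\<^bsub>F\<^esub>"] jD[OF jg] h W.act_add[of h] by (simp add: j'_def)
    next
      fix c a assume "c \<in> carrier F" "a \<in> carrier W0"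
      then show "j' (c \<odot>\<^bsub>W0\<^esub> a) = c \<odot>\<^bsub>W\<^esub> j' a"
        using \<psi>c \<psi>D(2)[of a a c] jD[OF jg] h W.act_smult[of h] by (simp add: j'_def)
    next
      fix n a assume n: "n \<in> carrier ?N" and a: "a \<in> carrier W0"
      let ?n = "inv h \<otimes> n \<otimes> h"
      have nN: "n \<in> N" "n \<in> carrier G" using n NG by auto
      have n': "?n \<in> N" using conjN(1)[OF nN(1)] h by simp
      have e: "h \<otimes> ?n \<otimes> inv h = n" "h \<otimes> ?n = n \<otimes> h"
        using nN h by (simp_all add: V.grp.m_assoc V.grp.mult_inv_mult_cancel)
      have "\<psi> (gact W0 n a) = gact W0 ?n (\<psi> a)" using \<psi>act[OF n' a] e by simp
      then have "j (\<psi> (gact W0 n a)) = gact W ?n (j (\<psi> a))" using jD(4)[OF jg, of ?n] n' \<psi>c[OF a] by simp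
      then have "j' (gact W0 n a) = gact W (h \<otimes> ?n) (j (\<psi> a))"
        using actH_mult[of h ?n "j (\<psi> a)"] h n' NH jD(1)[OF jg \<psi>c[OF a]] by (auto simp: j'_def)
      also have "\<dots> = gact W n (j' a)"
        unfolding e(2) using actH_mult[of n h "j (\<psi> a)"] h nN NH jD(1)[OF jg \<psi>c[OF a]]
        by (auto simp: j'_def)
      finally show "j' (gact W0 n a) = gact W n (j' a)" .
    qed (use jD(1)[OF jg] \<psi>c h in \<open>auto simp: j'_def\<close>)
    moreover have "inj_on j' (carrier W0)"
    proof (rule inj_onI)
      fix a b assume ab: "a \<in> carrier W0" "b \<in> carrier W0" "j' a = j' b"
      have "j (\<psi> a) = j (\<psi> b)"
      proof -
        have "gact W h (j (\<psi> a)) = gact W h (j (\<psi> b))" using ab(3) by (simp add: j'_def)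
        moreover have "j (\<psi> a) \<in> carrier W" "j (\<psi> b) \<in> carrier W" "h \<in> carrier (G\<lparr>carrier := H\<rparr>)"
          using jD(1)[OF jg \<psi>c] ab h by auto
        ultimately show ?thesis by (metis W.act_inv_act)
      qed
      then have "\<psi> a = \<psi> b" using j \<psi>c ab by (auto simp: embeddings_def dest: inj_onD)
      then show "a = b" using \<psi>(2) ab by (auto simp: bij_betw_def dest: inj_onD)
    qed
    moreover have "j' ` carrier W0 = gact W h ` j ` \<psi> ` carrier W0" by (auto simp: j'_def)
    ultimately show ?thesis using \<psi>(2) by (auto simp: embeddings_def bij_betw_def)
  qed
  \<comment> \<open>The sum of all copies of \<open>W0\<close> in \<open>W\<close>. It is stable
    under \<open>H\<close> by \<open>conj_emb\<close> and nonzero by \<open>j0\<close>, so it is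
    \<open>W\<close>: this is the part of Clifford's theorem by which \<open>W\<close> is isotypic
    over \<open>N\<close>.\<close>
  define Q where "Q = {w. \<exists>js. set js \<subseteq> ?E \<and> w \<in> image_sum W (carrier W0) js}"
  have sums: "gsubmodule F ?N (image_sum W (carrier W0) js) W" if "set js \<subseteq> ?E" for js
    using that Eg by (intro gsubmodule_image_sum[OF W0 WN]) auto
  have QW: "w \<in> carrier W" if "w \<in> Q" for w
    using that sums WN.gsubmoduleD(1) by (fastforce simp: Q_def)
  have Q: "gsubmodule F (G\<lparr>carrier := H\<rparr>) Q W"
  proof (rule W.gsubmoduleI)
    show "Q \<subseteq> carrier W" using QW by blast
    show "\<zero>\<^bsub>W\<^esub> \<in> Q" by (auto simp: Q_def intro!: exI[of _ "[]"])
  next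
    fix u v assume "u \<in> Q" "v \<in> Q"
    then obtain js ks where "set js \<subseteq> ?E" "u \<in> image_sum W (carrier W0) js"
      "set ks \<subseteq> ?E" "v \<in> image_sum W (carrier W0) ks" by (auto simp: Q_def)
    moreover from this have "u \<oplus>\<^bsub>W\<^esub> v \<in> image_sum W (carrier W0) (js @ ks)"
      using Eg by (intro image_sum_append[OF WN W0]) auto
    ultimately show "u \<oplus>\<^bsub>W\<^esub> v \<in> Q" unfolding Q_def by (intro CollectI exI[of _ "js @ ks"]) auto
  next
    fix c u assume "c \<in> carrier F" "u \<in> Q"
    then show "c \<odot>\<^bsub>W\<^esub> u \<in> Q" using WN.gsubmoduleD(4)[OF sums] by (auto simp: Q_def)
  next
    fix h w assume "h \<in> carrier (G\<lparr>carrier := H\<rparr>)" "w \<in> Q"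
    then obtain js where h: "h \<in> H" and js: "set js \<subseteq> ?E" "w \<in> image_sum W (carrier W0) js"
      by (auto simp: Q_def)
    have "\<exists>ks. set ks \<subseteq> ?E \<and> gact W h w \<in> image_sum W (carrier W0) ks"
      using js
    proof (induction js arbitrary: w)
      case Nil
      then show ?case using W.act_zero[of h] h by (intro exI[of _ "[]"]) simp
    next
      case (Cons j js)
      then obtain a b where *: "w = j a \<oplus>\<^bsub>W\<^esub> b" "a \<in> carrier W0" "b \<in> image_sum W (carrier W0) js"
        by auto
      obtain ks where ks: "set ks \<subseteq> ?E" "gact W h b \<in> image_sum W (carrier W0) ks"
        using Cons.IH[OF _ *(3)] Cons.prems(1) by (meson set_subset_Cons subset_trans)
      obtain j' where j': "j' \<in> ?E" "j' ` carrier W0 = gact W h ` j ` carrier W0"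
        using conj_emb[OF h, of j] Cons.prems by auto
      then have "gact W h (j a) \<in> j' ` carrier W0" using *(2) by blast
      then obtain a' where a': "a' \<in> carrier W0" "gact W h (j a) = j' a'" by blast
      have js: "set js \<subseteq> ?E" and j: "j \<in> ?E" using Cons.prems(1) by simp_all
      have "b \<in> Q" unfolding Q_def using js *(3) by blast
      then have "b \<in> carrier W" by (rule QW)
      moreover have "j a \<in> carrier W" using ghomD(1)[OF subsetD[OF Eg j] *(2)] .
      ultimately have "gact W h w = j' a' \<oplus>\<^bsub>W\<^esub> gact W h b"
        using * a' h W.act_add[of h "j a" b] by simp
      then show ?case using ks j' a' by (intro exI[of _ "j' # ks"]) auto
    qed
    then show "gact W h w \<in> Q" by (auto simp: Q_def)
  qed
  have "j0 a0 = j0 a0 \<oplus>\<^bsub>W\<^esub> \<zero>\<^bsub>W\<^esub>" using ghomD(1)[OF subsetD[OF Eg j0] a0(1)] by simp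
  then have "j0 a0 \<in> image_sum W (carrier W0) [j0]" using a0(1) unfolding image_sum.simps by blast
  moreover have "set [j0] \<subseteq> ?E" using j0 by simp
  ultimately have "j0 a0 \<in> Q" unfolding Q_def by blast
  from irreducible_gmoduleD(3)[OF irreducible_W Q this nz[OF j0]] have QW: "Q = carrier W" .
  \<comment> \<open>Every \<open>m\<close> lies in a finite sum of copies of \<open>W0\<close>,
    which is what \<open>embedding_into_submodule\<close> asks for.\<close>
  have sub_emb: "\<exists>j\<in>?E. j ` carrier W0 \<subseteq> M"
    if M: "gsubmodule F ?N M W" "m \<in> M" "m \<noteq> \<zero>\<^bsub>W\<^esub>" for M m
  proof -
    have "m \<in> Q" using M WN.gsubmoduleD(1)[OF M(1)] QW by blast
    then show ?thesis using embedding_into_submodule[OF irr WN _ M(1,2) _ M(3)] by (auto simp: Q_def)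
  qed
  show ?thesis
    unfolding irr_over_def
  proof (intro allI impI)
    fix U assume U: "gsubmodule F (G\<lparr>carrier := carrier G\<rparr>) U V" "U \<subseteq> supported (carrier G)" "U \<noteq> {\<zero>\<^bsub>V\<^esub>}"
    have sG: "subgroup (carrier G) G" by (rule V.grp.subgroup_self)
    have GU: "gsubmodule F G U V" using U(1) by simp
    note UD = V.gsubmoduleD[OF GU]
    obtain u where u: "u \<in> U" "\<pi> \<one> u \<noteq> \<zero>\<^bsub>W\<^esub>"
      and min: "\<And>m. m \<in> U \<Longrightarrow> csupp H m \<subset> csupp H u \<Longrightarrow> m = \<zero>\<^bsub>V\<^esub>"
      using minimal_support[OF subgroup_H subset_refl sG U] by blast
    have uV: "u \<in> carrier V" using u UD(1) by blast
    define M where "M = {m \<in> U. csupp H m \<subseteq> csupp H u}"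
    have M: "gsubmodule F ?N M V"
      unfolding M_def
      by (rule gsubmodule_csupp[OF subgroup_H sG sN _ _ U(1,2)]) (use NG conjN NH in auto)
    note MD = VN.gsubmoduleD[OF M]
    have MV: "m \<in> carrier V" if "m \<in> M" for m using that MD(1) by blast
    have uM: "u \<in> M" using u by (simp add: M_def)
    \<comment> \<open>A vanishing component at a coset of the support of \<open>u\<close> removes
      that coset from the support, so each component map at such a coset is injective on
      \<open>M\<close>.\<close>
    have zero: "m = \<zero>\<^bsub>V\<^esub>"
      if m: "m \<in> M" and y: "y \<in> carrier G" "\<pi> y u \<noteq> \<zero>\<^bsub>W\<^esub>" "\<pi> y m = \<zero>\<^bsub>W\<^esub>" for m y
    proof (rule min)
      show "m \<in> U" using m by (simp add: M_def)
      have "y <# H \<in> csupp H u" using y by (auto simp: csupp_def)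
      moreover have "y <# H \<notin> csupp H m"
      proof
        assume "y <# H \<in> csupp H m"
        then obtain x where x: "x \<in> carrier G" "\<pi> x m \<noteq> \<zero>\<^bsub>W\<^esub>" "y <# H = x <# H"
          by (auto simp: csupp_def)
        then have h: "inv y \<otimes> x \<in> H" using V.grp.l_coset_eq_iff[OF subgroup_H y(1) x(1)] by simp
        have "x = y \<otimes> (inv y \<otimes> x)" using x y by (simp add: V.grp.mult_inv_mult_cancel)
        then have "\<pi> x m = gact W (inv (inv y \<otimes> x)) (\<pi> y m)"
          using coord_right[OF MV[OF m] y(1) h] by simp
        then show False using x y H_inv[OF h] W.act_zero[of "inv (inv y \<otimes> x)"] by simp
      qed
      ultimately show "csupp H m \<subset> csupp H u" using m by (auto simp: M_def)
    qed
    show "\<iota> ` carrier W \<subseteq> U"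
    proof (cases "\<forall>x\<in>carrier G - H. \<pi> x u = \<zero>\<^bsub>W\<^esub>")
      \<comment> \<open>With support in \<open>H\<close> alone the claim reduces to the
        irreducibility of \<open>W\<close>.\<close>
      case True
      interpret VH: gmodule F "G\<lparr>carrier := H\<rparr>" V by (rule V.restrict_group[OF subgroup_H])
      have "gsubmodule F (G\<lparr>carrier := H\<rparr>) (U \<inter> supported H) V"
        by (rule VH.gsubmodule_Int[OF gsubmodule_mono[OF U(1)] gsubmodule_supported[OF subgroup_H]]) auto
      moreover have "u \<in> U \<inter> supported H" using True u(1) uV by (simp add: supported_def)
      moreover have "u \<noteq> \<zero>\<^bsub>V\<^esub>" using u(2) coord_zero[of \<one>] by auto
      ultimately show ?thesis using irr_overD[OF irr_over_H, of "U \<inter> supported H"] by blast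
    next
      case False
      then obtain x where x: "x \<in> carrier G" "x \<notin> H" "\<pi> x u \<noteq> \<zero>\<^bsub>W\<^esub>" by blast
      have act1: "\<pi> \<one> (gact V n v) = gact W n (\<pi> \<one> v)" if "n \<in> N" "v \<in> carrier V" for n v
        using coord_act_conj[of v \<one> n] that NG NH by auto
      \<comment> \<open>\<open>N\<close> acts on components at \<open>\<one>\<close> as it does on
        \<open>W\<close>. These components form a submodule, nonzero because of \<open>u\<close>,
        which therefore contains a copy of \<open>W0\<close>.\<close>
      have "gsubmodule F ?N (\<pi> \<one> ` M) W"
      proof (rule WN.gsubmoduleI)
        show "\<zero>\<^bsub>W\<^esub> \<in> \<pi> \<one> ` M" using MD(2) coord_zero[of \<one>] by (metis V.grp.one_closed imageI)
      next
        fix p q assume "p \<in> \<pi> \<one> ` M" "q \<in> \<pi> \<one> ` M"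
        then show "p \<oplus>\<^bsub>W\<^esub> q \<in> \<pi> \<one> ` M" using MD(3) MV by (auto simp: coord_add[symmetric])
      next
        fix c p assume "c \<in> carrier F" "p \<in> \<pi> \<one> ` M"
        then show "c \<odot>\<^bsub>W\<^esub> p \<in> \<pi> \<one> ` M" using MD(4) MV by (auto simp: coord_smult[symmetric])
      next
        fix n p assume "n \<in> carrier ?N" "p \<in> \<pi> \<one> ` M"
        then show "gact W n p \<in> \<pi> \<one> ` M" using MD(5) MV by (auto simp: act1[symmetric])
      qed (use MV in auto)
      from sub_emb[OF this imageI[OF uM] u(2)]
      obtain j where j: "j \<in> ?E" "j ` carrier W0 \<subseteq> \<pi> \<one> ` M" by blast
      note jD = ghomD[OF subsetD[OF Eg j(1)]]
      \<comment> \<open>\<open>\<mu>\<close> will lift the embedding \<open>j\<close> from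
        components at \<open>\<one>\<close> to elements of \<open>M\<close>.\<close>
      define R where "R a m \<longleftrightarrow> m \<in> M \<and> \<pi> \<one> m = j a" for a m
      have "\<exists>\<mu>\<in>ghom F ?N W0 V. \<forall>a\<in>carrier W0. R a (\<mu> a)"
      proof (rule exists_ghom_of_relation[OF W0 VN.gmodule_axioms])
        show "\<exists>m. R a m" if "a \<in> carrier W0" for a
          using j(2) that by (fastforce simp: R_def)
        show "m = \<zero>\<^bsub>V\<^esub>" if "R \<zero>\<^bsub>W0\<^esub> m" for m
          using that u ghom_zero[OF W0 WN subsetD[OF Eg j(1)]] by (intro zero[of m \<one>]) (auto simp: R_def)
      qed (use MD(3-5) MV act1 jD in \<open>auto simp: R_def coord_add coord_smult\<close>)
      then obtain \<mu> where \<mu>: "\<mu> \<in> ghom F ?N W0 V" and R: "\<And>a. a \<in> carrier W0 \<Longrightarrow> R a (\<mu> a)" by blast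
      note \<mu>D = ghomD[OF \<mu>]
      \<comment> \<open>The component of the same lift at \<open>x\<close>. There \<open>N\<close>
        acts through conjugation by \<open>x\<close>, and \<open>zero\<close>, applied at
        \<open>x\<close>, makes \<open>\<theta>\<close> injective.\<close>
      define \<theta> where "\<theta> a = \<pi> x (\<mu> a)" for a
      have lc: "gmodule F ?N (left_conj G x W)"
        by (rule gmodule_left_conj[OF WN V.group sN sN x(1)]) (use conjN x in auto)
      have \<theta>: "\<theta> \<in> ghom F ?N W0 (left_conj G x W)"
      proof (rule ghomI)
        fix n a assume "n \<in> carrier ?N" "a \<in> carrier W0"
        then show "\<theta> (gact W0 n a) = gact (left_conj G x W) n (\<theta> a)"
          using \<mu>D(1)[of a] \<mu>D(4)[of n a] x(1) NG conjN(1) NH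
            coord_act_conj[of "\<mu> a" x n] by (auto simp: \<theta>_def left_conj_def)
      qed (use \<mu>D x(1) in \<open>auto simp: \<theta>_def left_conj_def coord_add coord_smult\<close>)
      note \<theta>D = ghomD[OF \<theta>]
      have \<theta>0: "\<theta> \<zero>\<^bsub>W0\<^esub> = \<zero>\<^bsub>W\<^esub>" using ghom_zero[OF W0 lc \<theta>] by (simp add: left_conj_def)
      have \<theta>inj: "inj_on \<theta> (carrier W0)"
      proof (rule ghom_inj_onI[OF W0 lc \<theta>])
        fix a assume a: "a \<in> carrier W0" "\<theta> a = \<zero>\<^bsub>left_conj G x W\<^esub>"
        then have "\<mu> a = \<zero>\<^bsub>V\<^esub>"
          using R[OF a(1)] x by (intro zero[of _ x]) (auto simp: R_def \<theta>_def left_conj_def)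
        then have "j a = j \<zero>\<^bsub>W0\<^esub>"
          using R[OF a(1)] ghom_zero[OF W0 WN subsetD[OF Eg j(1)]] by (simp add: R_def)
        then show "a = \<zero>\<^bsub>W0\<^esub>" using a j(1) by (auto simp: embeddings_def dest: inj_onD)
      qed
      have lcc: "carrier (left_conj G x W) = carrier W" "add (left_conj G x W) = add W"
        "smult (left_conj G x W) = smult W" "zero (left_conj G x W) = zero W"
        "gact (left_conj G x W) n = gact W (inv x \<otimes> n \<otimes> x)" for n
        by (simp_all add: left_conj_def)
      let ?S = "\<theta> ` carrier W0"
      interpret LC: gmodule F ?N "left_conj G x W" by (rule lc)
      \<comment> \<open>A subspace stable under the conjugated action is stable under the original
        one, since conjugation by \<open>x\<close> maps \<open>N\<close> onto itself.\<close>
      have S: "gsubmodule F ?N ?S W"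
      proof -
        note SD = LC.gsubmoduleD[OF gsubmodule_image[OF W0 lc \<theta>], unfolded lcc]
        show ?thesis
        proof (rule WN.gsubmoduleI)
          fix n s assume n: "n \<in> carrier ?N" and s: "s \<in> ?S"
          have "inv x \<otimes> (x \<otimes> n \<otimes> inv x) \<otimes> x = n"
            using n x(1) NG by (simp add: V.grp.m_assoc V.grp.mult_inv_mult_cancel)
          then show "gact W n s \<in> ?S" using SD(5)[of "x \<otimes> n \<otimes> inv x" s] conjN(2)[of n x] n s x(1) by simp
        qed (use SD in blast)+
      qed
      have "\<theta> a0 \<noteq> \<zero>\<^bsub>W\<^esub>"
        using \<theta>0 \<theta>inj a0 by (metis W0.M.zero_closed inj_onD)
      from sub_emb[OF S imageI[OF a0(1)] this]
      obtain j2 where j2: "j2 \<in> ?E" "j2 ` carrier W0 \<subseteq> ?S" by blast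
      note j2D = ghomD[OF subsetD[OF Eg j2(1)]]
      have rc: "gmodule F ?N (right_conj G W0 (inv x))"
        using gmodule_left_conj[OF W0 V.group sN sN x(1)] conjN x(1)
          right_conj_eq_left_conj[OF V.group, of "inv x" W0] by simp
      have rcc: "carrier (right_conj G W0 (inv x)) = carrier W0" "add (right_conj G W0 (inv x)) = add W0"
        "smult (right_conj G W0 (inv x)) = smult W0" "zero (right_conj G W0 (inv x)) = zero W0"
        "gact (right_conj G W0 (inv x)) n = gact W0 (inv x \<otimes> n \<otimes> x)" for n
        using x(1) by (simp_all add: right_conj_def)
      \<comment> \<open>The graph of the inverse of \<open>\<theta>\<close> after \<open>j2\<close>.
        Of these two maps only \<open>\<theta>\<close> twists the action, so the composite compares
        \<open>W0\<close> with its conjugate by \<open>inv x\<close>.\<close>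
      define R2 where "R2 a b \<longleftrightarrow> b \<in> carrier W0 \<and> \<theta> b = j2 a" for a b
      have "\<exists>f\<in>ghom F ?N (right_conj G W0 (inv x)) W0. \<forall>a\<in>carrier (right_conj G W0 (inv x)). R2 a (f a)"
      proof (rule exists_ghom_of_relation[OF rc W0])
        show "\<exists>b. R2 a b" if "a \<in> carrier (right_conj G W0 (inv x))" for a
        proof -
          have "j2 a \<in> \<theta> ` carrier W0" using that j2(2) unfolding rcc by blast
          then show ?thesis unfolding R2_def by force
        qed
        show "b = \<zero>\<^bsub>W0\<^esub>" if "R2 \<zero>\<^bsub>right_conj G W0 (inv x)\<^esub> b" for b
          using that inj_onD[OF \<theta>inj, of b "\<zero>\<^bsub>W0\<^esub>"] \<theta>0 ghom_zero[OF W0 WN subsetD[OF Eg j2(1)]]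
          by (simp add: R2_def rcc)
        show "R2 (gact (right_conj G W0 (inv x)) n a) (gact W0 n b)"
          if "n \<in> carrier ?N" "a \<in> carrier (right_conj G W0 (inv x))" "R2 a b" for n a b
        proof -
          have n: "n \<in> N" "inv x \<otimes> n \<otimes> x \<in> N" using that conjN x(1) by auto
          have a: "a \<in> carrier W0" and b: "b \<in> carrier W0" "\<theta> b = j2 a"
            using that by (auto simp: R2_def rcc)
          have "\<theta> (gact W0 n b) = gact W (inv x \<otimes> n \<otimes> x) (j2 a)"
            using \<theta>D(4)[of n b] n b by (simp add: lcc)
          also have "\<dots> = j2 (gact W0 (inv x \<otimes> n \<otimes> x) a)"
            using j2D(4)[of "inv x \<otimes> n \<otimes> x" a] n a by simp
          finally show ?thesis using n b by (simp add: R2_def rcc)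
        qed
      qed (use \<theta>D j2D in \<open>auto simp: R2_def rcc lcc\<close>)
      then obtain f where f: "f \<in> ghom F ?N (right_conj G W0 (inv x)) W0"
        and R2: "\<And>a. a \<in> carrier W0 \<Longrightarrow> R2 a (f a)" by (auto simp: rcc)
      have finj: "inj_on f (carrier W0)"
      proof (rule inj_onI)
        fix a b assume "a \<in> carrier W0" "b \<in> carrier W0" "f a = f b"
        then have "j2 a = j2 b" using R2[of a] R2[of b] by (simp add: R2_def)
        then show "a = b" using j2(1) \<open>a \<in> carrier W0\<close> \<open>b \<in> carrier W0\<close>
          by (auto simp: embeddings_def dest: inj_onD)
      qed
      have im: "gsubmodule F ?N (f ` carrier W0) W0" using gsubmodule_image[OF rc W0 f] by (simp add: rcc)
      have "f a0 \<noteq> \<zero>\<^bsub>W0\<^esub>"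
      proof
        assume "f a0 = \<zero>\<^bsub>W0\<^esub>"
        then have "j2 a0 = \<zero>\<^bsub>W\<^esub>" using R2[OF a0(1)] \<theta>0 by (simp add: R2_def)
        then show False using nz[OF j2(1)] by simp
      qed
      \<comment> \<open>Surjectivity comes from the irreducibility of \<open>W0\<close>; together
        with injectivity it puts \<open>inv x\<close>, hence \<open>x\<close>, into the inertia
        group.\<close>
      then have "f ` carrier W0 = carrier W0"
        using irreducible_gmoduleD(3)[OF irr im imageI[OF a0(1)]] by simp
      then have "bij_betw (restrict f (carrier W0)) (carrier W0) (carrier W0)"
        using finj by (simp add: bij_betw_def inj_on_restrict_eq)
      moreover have "restrict f (carrier W0) \<in> carrier (ghom_space F ?N (right_conj G W0 (inv x)) W0)"
        using ghom_restrict[OF rc, of f W0] f by (simp add: rcc)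
      ultimately have "gmodule_iso F ?N (right_conj G W0 (inv x)) W0"
        unfolding gmodule_iso_def rcc(1) by blast
      then have "inv x \<in> inertia_group F G N W0" using x(1) by (simp add: inertia_group_def)
      then have "inv x \<in> H" using inertia by simp
      then have "x \<in> H" using H_inv[of "inv x"] x(1) by simp
      then show ?thesis using x by simp
    qed
  qed
qed

end

section \<open>Complete reducibility\<close>

text \<open>Zorn's lemma applies in any dimension: a subspace maximal among those that meet
  \<open>U\<close> trivially is a complement. Linear subspaces are encoded as submodules for the
  trivial subgroup, so that the module lemmas apply to them.\<close>

lemma (in gmodule) exists_complement:
  assumes U: "gsubmodule F G U V"
  shows "\<exists>C. gsubmodule F (G\<lparr>carrier := {\<one>\<^bsub>G\<^esub>}\<rparr>) C V \<and> C \<inter> U = {\<zero>\<^bsub>V\<^esub>} \<and>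
    (\<forall>v\<in>carrier V. \<exists>u\<in>U. v \<ominus>\<^bsub>V\<^esub> u \<in> C)"
proof -
  let ?K = "G\<lparr>carrier := {\<one>\<^bsub>G\<^esub>}\<rparr>"
  interpret K: gmodule F ?K V by (rule restrict_group[OF grp.triv_subgroup])
  note UD = gsubmoduleD[OF U]
  have UV: "u \<in> carrier V" if "u \<in> U" for u using UD(1) that by blast
  let ?A = "{C. gsubmodule F ?K C V \<and> C \<inter> U = {\<zero>\<^bsub>V\<^esub>}}"
  have "\<exists>C\<in>?A. \<forall>X\<in>?A. C \<subseteq> X \<longrightarrow> X = C"
  proof (rule subset_Zorn_nonempty)
    have "gsubmodule F ?K {\<zero>\<^bsub>V\<^esub>} V" by (rule K.gsubmoduleI) auto
    then show "?A \<noteq> {}" using UD(2) by blast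
  next
    fix \<C> assume \<C>: "\<C> \<noteq> {}" "subset.chain ?A \<C>"
    have mem: "gsubmodule F ?K C V" "C \<inter> U = {\<zero>\<^bsub>V\<^esub>}" if "C \<in> \<C>" for C
      using \<C>(2) that unfolding subset_chain_def by blast+
    have "gsubmodule F ?K (\<Union>\<C>) V"
    proof (rule K.gsubmoduleI)
      show "\<Union>\<C> \<subseteq> carrier V" using mem(1) K.gsubmoduleD(1) by blast
      show "\<zero>\<^bsub>V\<^esub> \<in> \<Union>\<C>" using \<C>(1) mem(1) K.gsubmoduleD(2) by blast
      show "u \<oplus>\<^bsub>V\<^esub> v \<in> \<Union>\<C>" if uv: "u \<in> \<Union>\<C>" "v \<in> \<Union>\<C>" for u v
      proof -
        obtain C D where CD: "C \<in> \<C>" "D \<in> \<C>" "u \<in> C" "v \<in> D" using uv by blast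
        then have "C \<subseteq> D \<or> D \<subseteq> C" using \<C>(2) unfolding subset_chain_def by blast
        then obtain E where "E \<in> \<C>" "u \<in> E" "v \<in> E" using CD by blast
        then show ?thesis using K.gsubmoduleD(3)[OF mem(1)] by blast
      qed
      show "c \<odot>\<^bsub>V\<^esub> u \<in> \<Union>\<C>" if "c \<in> carrier F" "u \<in> \<Union>\<C>" for c u
        using that K.gsubmoduleD(4)[OF mem(1)] by blast
      show "gact V g u \<in> \<Union>\<C>" if "g \<in> carrier ?K" "u \<in> \<Union>\<C>" for g u
        using that K.gsubmoduleD(5)[OF mem(1)] by blast
    qed
    moreover have "\<Union>\<C> \<inter> U = {\<zero>\<^bsub>V\<^esub>}" using \<C>(1) mem(2) by blast
    ultimately show "\<Union>\<C> \<in> ?A" by blast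
  qed
  then obtain C where "C \<in> ?A" and max: "\<forall>X\<in>?A. C \<subseteq> X \<longrightarrow> X = C" by (rule bexE)
  then have C: "gsubmodule F ?K C V" "C \<inter> U = {\<zero>\<^bsub>V\<^esub>}" by simp_all
  note CD = K.gsubmoduleD[OF C(1)]
  have CV: "c \<in> carrier V" if "c \<in> C" for c using CD(1) that by blast
  have "\<exists>u\<in>U. v \<ominus>\<^bsub>V\<^esub> u \<in> C" if v: "v \<in> carrier V" for v
  proof (rule ccontr)
    assume no: "\<not> (\<exists>u\<in>U. v \<ominus>\<^bsub>V\<^esub> u \<in> C)"
    \<comment> \<open>\<open>C\<close> enlarged by \<open>v\<close>. It meets \<open>U\<close>
      trivially, as otherwise division by the coefficient of \<open>v\<close> would give a
      \<open>u\<close> in \<open>U\<close> excluded by \<open>no\<close>; maximality then forces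
      \<open>v\<close> into \<open>C\<close>.\<close>
    define X where "X = {c \<oplus>\<^bsub>V\<^esub> a \<odot>\<^bsub>V\<^esub> v | c a. c \<in> C \<and> a \<in> carrier F}"
    have XI: "c \<oplus>\<^bsub>V\<^esub> a \<odot>\<^bsub>V\<^esub> v \<in> X" if "c \<in> C" "a \<in> carrier F" for c a using that unfolding X_def by blast
    have X: "gsubmodule F ?K X V"
    proof (rule K.gsubmoduleI)
      show "X \<subseteq> carrier V" using CV v by (auto simp: X_def)
      have "\<zero>\<^bsub>V\<^esub> \<oplus>\<^bsub>V\<^esub> \<zero>\<^bsub>F\<^esub> \<odot>\<^bsub>V\<^esub> v = \<zero>\<^bsub>V\<^esub>" using v by simp
      then show "\<zero>\<^bsub>V\<^esub> \<in> X" using XI[OF CD(2), of "\<zero>\<^bsub>F\<^esub>"] by simp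
    next
      fix x y assume "x \<in> X" "y \<in> X"
      then obtain c d a b where *: "c \<in> C" "d \<in> C" "a \<in> carrier F" "b \<in> carrier F"
        "x = c \<oplus>\<^bsub>V\<^esub> a \<odot>\<^bsub>V\<^esub> v" "y = d \<oplus>\<^bsub>V\<^esub> b \<odot>\<^bsub>V\<^esub> v" unfolding X_def by blast
      then have "x \<oplus>\<^bsub>V\<^esub> y = (c \<oplus>\<^bsub>V\<^esub> d) \<oplus>\<^bsub>V\<^esub> (a \<oplus>\<^bsub>F\<^esub> b) \<odot>\<^bsub>V\<^esub> v"
        using CV v by (simp add: smult_l_distr M.a_ac)
      then show "x \<oplus>\<^bsub>V\<^esub> y \<in> X" using XI CD(3) * by simp
    next
      fix e x assume e: "e \<in> carrier F" and "x \<in> X"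
      then obtain c a where *: "c \<in> C" "a \<in> carrier F" "x = c \<oplus>\<^bsub>V\<^esub> a \<odot>\<^bsub>V\<^esub> v"
        unfolding X_def by blast
      then have "e \<odot>\<^bsub>V\<^esub> x = e \<odot>\<^bsub>V\<^esub> c \<oplus>\<^bsub>V\<^esub> (e \<otimes>\<^bsub>F\<^esub> a) \<odot>\<^bsub>V\<^esub> v"
        using CV v e by (simp add: smult_r_distr smult_assoc1)
      then show "e \<odot>\<^bsub>V\<^esub> x \<in> X" using XI CD(4) * e by simp
    next
      fix g x assume "g \<in> carrier ?K" and x: "x \<in> X"
      then have "g = \<one>\<^bsub>G\<^esub>" by simp
      moreover have "x \<in> carrier V" using x CV v by (auto simp: X_def)
      ultimately show "gact V g x \<in> X" using x gact_one by simp
    qed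
    have "X \<inter> U \<subseteq> {\<zero>\<^bsub>V\<^esub>}"
    proof
      fix u assume "u \<in> X \<inter> U"
      then obtain c a where *: "c \<in> C" "a \<in> carrier F" "u = c \<oplus>\<^bsub>V\<^esub> a \<odot>\<^bsub>V\<^esub> v" "u \<in> U"
        unfolding X_def by blast
      show "u \<in> {\<zero>\<^bsub>V\<^esub>}"
      proof (cases "a = \<zero>\<^bsub>F\<^esub>")
        case True
        then have "u = c" using * CV v by simp
        then show ?thesis using C(2) * by blast
      next
        case False
        then have ai: "inv\<^bsub>F\<^esub> a \<in> carrier F" "inv\<^bsub>F\<^esub> a \<otimes>\<^bsub>F\<^esub> a = \<one>\<^bsub>F\<^esub>" using *(2) field_Units by auto
        have "inv\<^bsub>F\<^esub> a \<odot>\<^bsub>V\<^esub> u = inv\<^bsub>F\<^esub> a \<odot>\<^bsub>V\<^esub> c \<oplus>\<^bsub>V\<^esub> v"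
          using * CV v ai smult_assoc1[of "inv\<^bsub>F\<^esub> a" a v] by (simp add: smult_r_distr)
        moreover define u' c' where "u' = inv\<^bsub>F\<^esub> a \<odot>\<^bsub>V\<^esub> u" and "c' = inv\<^bsub>F\<^esub> a \<odot>\<^bsub>V\<^esub> c"
        moreover have u': "u' \<in> U" and c': "c' \<in> C" using UD(4) CD(4) ai(1) * by (simp_all add: u'_def c'_def)
        ultimately have e: "u' = c' \<oplus>\<^bsub>V\<^esub> v" by simp
        have "v \<ominus>\<^bsub>V\<^esub> u' = \<ominus>\<^bsub>V\<^esub> c'"
        proof -
          have "v \<ominus>\<^bsub>V\<^esub> u' = \<ominus>\<^bsub>V\<^esub> c' \<oplus>\<^bsub>V\<^esub> (v \<oplus>\<^bsub>V\<^esub> \<ominus>\<^bsub>V\<^esub> v)"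
            using v CV[OF c'] unfolding e a_minus_def
            by (simp add: M.minus_add M.a_ac del: M.r_neg)
          then show ?thesis using v CV[OF c'] by (simp add: M.r_neg)
        qed
        also have "\<dots> \<in> C" using CD(4)[OF _ c', of "\<ominus>\<^bsub>F\<^esub> \<one>\<^bsub>F\<^esub>"] minus_eq_smult[OF CV[OF c']] by simp
        finally show ?thesis using no u' by blast
      qed
    qed
    moreover have "\<zero>\<^bsub>V\<^esub> \<in> X" using K.gsubmoduleD(2)[OF X] .
    ultimately have XU: "X \<inter> U = {\<zero>\<^bsub>V\<^esub>}" using UD(2) by blast
    have "C \<subseteq> X"
    proof
      fix c assume c: "c \<in> C"
      then show "c \<in> X" using XI[OF c, of "\<zero>\<^bsub>F\<^esub>"] CV v by simp
    qed
    then have "X = C" using max[rule_format, of X] X XU by simp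
    moreover have "v \<in> X" using XI[OF CD(2), of "\<one>\<^bsub>F\<^esub>"] v by simp
    ultimately have "v \<in> C" by blast
    \<comment> \<open>So the zero vector of \<open>U\<close> is itself a witness against
      \<open>no\<close>.\<close>
    moreover have "v \<ominus>\<^bsub>V\<^esub> \<zero>\<^bsub>V\<^esub> = v" using v by (simp add: a_minus_def)
    ultimately have "v \<ominus>\<^bsub>V\<^esub> \<zero>\<^bsub>V\<^esub> \<in> C" by (rule ssubst[rotated])
    then show False using no UD(2) by blast
  qed
  then show ?thesis using C by blast
qed

text \<open>\<open>p v\<close> is the element of \<open>U\<close> that differs from \<open>v\<close>
  by an element of the complement. The map is merely linear; equivariance will come from
  averaging.\<close>

lemma (in gmodule) exists_projection:
  assumes U: "gsubmodule F G U V"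
  shows "\<exists>p\<in>module_hom F V V. (\<forall>v\<in>carrier V. p v \<in> U) \<and> (\<forall>u\<in>U. p u = u)"
proof -
  let ?K = "G\<lparr>carrier := {\<one>\<^bsub>G\<^esub>}\<rparr>"
  interpret K: gmodule F ?K V by (rule restrict_group[OF grp.triv_subgroup])
  obtain C where C: "gsubmodule F ?K C V" "C \<inter> U = {\<zero>\<^bsub>V\<^esub>}"
    and span: "\<And>v. v \<in> carrier V \<Longrightarrow> \<exists>u\<in>U. v \<ominus>\<^bsub>V\<^esub> u \<in> C" using exists_complement[OF U] by blast
  note UD = gsubmoduleD[OF U] and CD = K.gsubmoduleD[OF C(1)]
  have UV: "u \<in> carrier V" if "u \<in> U" for u using UD(1) that by blast
  have CV: "c \<in> carrier V" if "c \<in> C" for c using CD(1) that by blast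
  have meet: "u = \<zero>\<^bsub>V\<^esub>" if "u \<in> U" "u \<in> C" for u using C(2) that by blast
  define R where "R v u \<longleftrightarrow> u \<in> U \<and> v \<ominus>\<^bsub>V\<^esub> u \<in> C" for v u
  have "\<exists>p\<in>ghom F ?K V V. \<forall>v\<in>carrier V. R v (p v)"
  proof (rule exists_ghom_of_relation[OF K.gmodule_axioms K.gmodule_axioms])
    show "\<exists>u. R v u" if "v \<in> carrier V" for v using span[OF that] by (auto simp: R_def)
    show "u \<in> carrier V" if "R v u" for v u using that UV by (simp add: R_def)
    show "u = \<zero>\<^bsub>V\<^esub>" if "R \<zero>\<^bsub>V\<^esub> u" for u
    proof -
      have u: "u \<in> U" "\<zero>\<^bsub>V\<^esub> \<ominus>\<^bsub>V\<^esub> u \<in> C" using that by (simp_all add: R_def)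
      have "\<zero>\<^bsub>V\<^esub> \<ominus>\<^bsub>V\<^esub> (\<zero>\<^bsub>V\<^esub> \<ominus>\<^bsub>V\<^esub> u) \<in> C" by (rule K.gsubmodule_minus[OF C(1) CD(2) u(2)])
      then show ?thesis using u(1) UV[OF u(1)] by (intro meet) (simp_all add: a_minus_def)
    qed
  next
    fix v v' u u' assume v: "v \<in> carrier V" "v' \<in> carrier V" and R: "R v u" "R v' u'"
    then have u: "u \<in> U" "u' \<in> U" by (simp_all add: R_def)
    have "(v \<oplus>\<^bsub>V\<^esub> v') \<ominus>\<^bsub>V\<^esub> (u \<oplus>\<^bsub>V\<^esub> u') = (v \<ominus>\<^bsub>V\<^esub> u) \<oplus>\<^bsub>V\<^esub> (v' \<ominus>\<^bsub>V\<^esub> u')"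
      using v UV u by (simp add: a_minus_def M.minus_add M.a_ac)
    then show "R (v \<oplus>\<^bsub>V\<^esub> v') (u \<oplus>\<^bsub>V\<^esub> u')" using R CD(3) UD(3) by (simp add: R_def)
  next
    fix a v u assume a: "a \<in> carrier F" and v: "v \<in> carrier V" and R: "R v u"
    then have u: "u \<in> carrier V" using UV by (simp add: R_def)
    have "a \<odot>\<^bsub>V\<^esub> v \<ominus>\<^bsub>V\<^esub> a \<odot>\<^bsub>V\<^esub> u = a \<odot>\<^bsub>V\<^esub> (v \<ominus>\<^bsub>V\<^esub> u)"
      using a v u by (simp add: a_minus_def smult_r_distr smult_r_minus)
    then show "R (a \<odot>\<^bsub>V\<^esub> v) (a \<odot>\<^bsub>V\<^esub> u)" using R CD(4) UD(4) a by (simp add: R_def)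
  next
    fix g v u assume "g \<in> carrier ?K" "v \<in> carrier V" and R: "R v u"
    then show "R (gact V g v) (gact V g u)" using UV[of u] gact_one by (simp add: R_def)
  qed
  then obtain p where p: "p \<in> ghom F ?K V V" and R: "\<And>v. v \<in> carrier V \<Longrightarrow> R v (p v)" by blast
  have "p u = u" if u: "u \<in> U" for u
  proof -
    have pu: "p u \<in> U" "u \<ominus>\<^bsub>V\<^esub> p u \<in> C" using R[OF UV[OF u]] by (simp_all add: R_def)
    then have "u \<ominus>\<^bsub>V\<^esub> p u = \<zero>\<^bsub>V\<^esub>" using meet gsubmodule_minus[OF U u] by blast
    then show ?thesis using eq_if_minus_eq_zero UV u pu by metis
  qed
  moreover have "p v \<in> U" if "v \<in> carrier V" for v using R[OF that] by (simp add: R_def)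
  moreover have "p \<in> module_hom F V V" using p by (simp add: ghom_def)
  ultimately show ?thesis by blast
qed

section \<open>Averaging over a finite group\<close>

lemma (in gmodule) add_group_F: "group (add_monoid F)"
  by (rule abelian_group.a_group[OF ring.axioms(1)[OF cring.axioms(1)[OF module.axioms(1)[OF module_axioms]]]])

text \<open>The natural number \<open>n\<close> as an element of \<open>F\<close>, written as a
  power in the additive monoid to match \<open>ring_char\<close>, which is defined through
  \<open>group.ord\<close>.\<close>

lemma (in gmodule) nat_multiple_one_closed:
  "\<one>\<^bsub>F\<^esub> [^]\<^bsub>add_monoid F\<^esub> (n::nat) \<in> carrier F"
proof -
  have "\<one>\<^bsub>F\<^esub> \<in> carrier (add_monoid F)" by simp
  from monoid.nat_pow_closed[OF group.is_monoid[OF add_group_F] this, of n]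
  show ?thesis unfolding partial_object.select_convs .
qed

lemma (in gmodule) finsum_const:
  assumes "finite A" and v: "v \<in> carrier V"
  shows "(\<Oplus>\<^bsub>V\<^esub>a\<in>A. v) = (\<one>\<^bsub>F\<^esub> [^]\<^bsub>add_monoid F\<^esub> card A) \<odot>\<^bsub>V\<^esub> v"
  using assms(1)
proof (induction A rule: finite_induct)
  case empty
  have "\<one>\<^bsub>F\<^esub> [^]\<^bsub>add_monoid F\<^esub> (0::nat) = \<zero>\<^bsub>F\<^esub>" by (simp add: nat_pow_def)
  then show ?case using v by simp
next
  case (insert a A)
  let ?n = "\<one>\<^bsub>F\<^esub> [^]\<^bsub>add_monoid F\<^esub> card A"
  have cl: "?n \<in> carrier F" by (rule nat_multiple_one_closed)
  have "(\<Oplus>\<^bsub>V\<^esub>a\<in>insert a A. v) = v \<oplus>\<^bsub>V\<^esub> (\<Oplus>\<^bsub>V\<^esub>a\<in>A. v)" using insert(1,2) v by simp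
  also have "\<dots> = v \<oplus>\<^bsub>V\<^esub> ?n \<odot>\<^bsub>V\<^esub> v" unfolding insert.IH ..
  also have "\<dots> = (?n \<oplus>\<^bsub>F\<^esub> \<one>\<^bsub>F\<^esub>) \<odot>\<^bsub>V\<^esub> v"
    using v cl by (simp add: smult_l_distr M.a_comm)
  also have "?n \<oplus>\<^bsub>F\<^esub> \<one>\<^bsub>F\<^esub> = \<one>\<^bsub>F\<^esub> [^]\<^bsub>add_monoid F\<^esub> card (insert a A)"
    using insert(1,2) by (simp add: nat_pow_def)
  finally show ?case .
qed

lemma (in gmodule) act_finsum:
  assumes "finite A" "g \<in> carrier G" "f \<in> A \<rightarrow> carrier V"
  shows "gact V g (\<Oplus>\<^bsub>V\<^esub>a\<in>A. f a) = (\<Oplus>\<^bsub>V\<^esub>a\<in>A. gact V g (f a))"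
  using assms(1,3)
proof (induction A rule: finite_induct)
  case (insert a A)
  then have "f a \<in> carrier V" "f \<in> A \<rightarrow> carrier V" "(\<lambda>a. gact V g (f a)) \<in> A \<rightarrow> carrier V"
    using assms(2) by auto
  then show ?case using insert assms(2) by (simp add: act_add)
qed (use assms(2) in simp)

text \<open>Maschke's averaging without division: the averaged projection \<open>e\<close> is a
  scalar \<open>c\<close> by \<open>endomorphism_scalar\<close>. On \<open>U\<close> it is
  multiplication by the group order, so \<open>c\<close> is nonzero; its values lie in
  \<open>U\<close>, so every \<open>v\<close> does.\<close>

lemma (in mackey_gmodule) irreducible_V_finite:
  assumes fin: "finite (carrier G)" and char: "\<not> ring_char F dvd order G"
  shows "irreducible_gmodule F G V"
proof -
  have "U = carrier V" if U: "gsubmodule F G U V" "U \<noteq> {\<zero>\<^bsub>V\<^esub>}" for U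
  proof -
    note UD = V.gsubmoduleD[OF U(1)]
    have UV: "u \<in> carrier V" if "u \<in> U" for u using UD(1) that by blast
    obtain p where p: "p \<in> module_hom F V V" "\<And>v. v \<in> carrier V \<Longrightarrow> p v \<in> U" "\<And>u. u \<in> U \<Longrightarrow> p u = u"
      using V.exists_projection[OF U(1)] by blast
    note pD = module_hom_eqs[OF p(1)]
    define e where "e v = (\<Oplus>\<^bsub>V\<^esub>g\<in>carrier G. gact V g (p (gact V (inv g) v)))" for v
    have cl: "gact V g (p (gact V (inv g) v)) \<in> carrier V" if "g \<in> carrier G" "v \<in> carrier V" for g v
      using that pD(1) by simp
    have "e \<in> ghom F G V V"
    proof (rule ghomI)
      show "e v \<in> carrier V" if "v \<in> carrier V" for v
        unfolding e_def using cl that by (intro V.M.finsum_closed) auto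
    next
      fix u v assume uv: "u \<in> carrier V" "v \<in> carrier V"
      have "e (u \<oplus>\<^bsub>V\<^esub> v) = (\<Oplus>\<^bsub>V\<^esub>g\<in>carrier G.
          gact V g (p (gact V (inv g) u)) \<oplus>\<^bsub>V\<^esub> gact V g (p (gact V (inv g) v)))"
        unfolding e_def using uv cl pD by (intro V.M.finsum_cong') (auto simp: V.act_add)
      also have "\<dots> = e u \<oplus>\<^bsub>V\<^esub> e v"
        unfolding e_def using uv cl by (intro V.M.finsum_addf) auto
      finally show "e (u \<oplus>\<^bsub>V\<^esub> v) = e u \<oplus>\<^bsub>V\<^esub> e v" .
    next
      fix c v assume cv: "c \<in> carrier F" "v \<in> carrier V"
      have "c \<odot>\<^bsub>V\<^esub> e v = (\<Oplus>\<^bsub>V\<^esub>g\<in>carrier G. c \<odot>\<^bsub>V\<^esub> gact V g (p (gact V (inv g) v)))"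
        unfolding e_def using cv cl fin by (intro V.finsum_smult_ldistr) auto
      also have "\<dots> = e (c \<odot>\<^bsub>V\<^esub> v)"
        unfolding e_def using cv cl pD by (intro V.M.finsum_cong') (auto simp: V.act_smult)
      finally show "e (c \<odot>\<^bsub>V\<^esub> v) = c \<odot>\<^bsub>V\<^esub> e v" by simp
    next
      fix k v assume k: "k \<in> carrier G" and v: "v \<in> carrier V"
      let ?f = "\<lambda>g. gact V g (p (gact V (inv g) (gact V k v)))"
      have bij: "(\<lambda>g. k \<otimes> g) ` carrier G = carrier G" "inj_on (\<lambda>g. k \<otimes> g) (carrier G)"
        using k V.grp.surj_const_mult V.grp.inj_on_cmult by (auto simp: inj_on_def)
      \<comment> \<open>Substituting \<open>k \<otimes> g\<close> for \<open>g\<close> moves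
        \<open>k\<close> out of the sum.\<close>
      have "e (gact V k v) = (\<Oplus>\<^bsub>V\<^esub>g\<in>(\<lambda>g. k \<otimes> g) ` carrier G. ?f g)" unfolding e_def bij(1) ..
      also have "\<dots> = (\<Oplus>\<^bsub>V\<^esub>g\<in>carrier G. ?f (k \<otimes> g))"
        using bij k v cl[of _ "gact V k v"] by (intro V.M.add.finprod_reindex) auto
      also have "\<dots> = (\<Oplus>\<^bsub>V\<^esub>g\<in>carrier G. gact V k (gact V g (p (gact V (inv g) v))))"
      proof (rule V.M.finsum_cong')
        fix g assume g: "g \<in> carrier G"
        have "gact V (inv (k \<otimes> g)) (gact V k v) = gact V (inv g) v"
          using g k v by (simp add: V.grp.inv_mult_group V.gact_mult)
        then show "?f (k \<otimes> g) = gact V k (gact V g (p (gact V (inv g) v)))"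
          using g k v pD(1) by (simp add: V.gact_mult)
      qed (use k v cl in auto)
      also have "\<dots> = gact V k (e v)"
        unfolding e_def using k v cl fin by (intro V.act_finsum[symmetric]) auto
      finally show "e (gact V k v) = gact V k (e v)" .
    qed
    from endomorphism_scalar[OF this]
    obtain c where c: "c \<in> carrier F" "\<And>v. v \<in> carrier V \<Longrightarrow> e v = c \<odot>\<^bsub>V\<^esub> v" by blast
    let ?n = "\<one>\<^bsub>F\<^esub> [^]\<^bsub>add_monoid F\<^esub> order G"
    note n = V.nat_multiple_one_closed[of "order G"]
    \<comment> \<open>\<open>group.pow_eq_id\<close> turns vanishing of this multiple into
      divisibility by the additive order of the unit; in characteristic \<open>0\<close> that order
      is \<open>0\<close>, which divides only \<open>0\<close>.\<close>
    have n0: "?n \<noteq> \<zero>\<^bsub>F\<^esub>"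
      using char group.pow_eq_id[OF V.add_group_F, of "\<one>\<^bsub>F\<^esub>" "order G"]
      by (simp add: ring_char_def)
    have eU: "e u = ?n \<odot>\<^bsub>V\<^esub> u" if u: "u \<in> U" for u
    proof -
      have "e u = (\<Oplus>\<^bsub>V\<^esub>g\<in>carrier G. u)"
        unfolding e_def using UV[OF u] u UD(5) p(3) by (intro V.M.finsum_cong') auto
      then show ?thesis using V.finsum_const[OF fin UV[OF u]] by (simp add: order_def)
    qed
    obtain u where u: "u \<in> U" "u \<noteq> \<zero>\<^bsub>V\<^esub>" using U(2) UD(2) by blast
    have c0: "c \<noteq> \<zero>\<^bsub>F\<^esub>"
    proof
      assume "c = \<zero>\<^bsub>F\<^esub>"
      then have "?n \<odot>\<^bsub>V\<^esub> u = \<zero>\<^bsub>V\<^esub>" using eU[OF u(1)] c(2) UV[OF u(1)] by simp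
      then show False using V.smult_left_imp_zero[OF n UV[OF u(1)]] u n0 by blast
    qed
    then have ci: "inv\<^bsub>F\<^esub> c \<in> carrier F" "inv\<^bsub>F\<^esub> c \<otimes>\<^bsub>F\<^esub> c = \<one>\<^bsub>F\<^esub>"
      using c(1) V.field_Units by auto
    have "v \<in> U" if v: "v \<in> carrier V" for v
    proof -
      have terms: "gact V g (p (gact V (inv g) v)) \<in> U" if "g \<in> carrier G" for g
        using UD(5)[OF that p(2)] that v by simp
      have "(\<Oplus>\<^bsub>V\<^esub>g\<in>S. gact V g (p (gact V (inv g) v))) \<in> U" if "S \<subseteq> carrier G" for S
        using finite_subset[OF that fin] that
      proof (induction S rule: finite_induct)
        case (insert g S)
        then show ?case using terms cl[OF _ v] UD(3) by (subst V.M.finsum_insert) auto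
      qed (use UD(2) in simp)
      from this[OF subset_refl] have "e v \<in> U" unfolding e_def .
      then have "c \<odot>\<^bsub>V\<^esub> v \<in> U" unfolding c(2)[OF v] .
      then have "inv\<^bsub>F\<^esub> c \<odot>\<^bsub>V\<^esub> (c \<odot>\<^bsub>V\<^esub> v) \<in> U" using UD(4) ci(1) by blast
      then show ?thesis using V.smult_assoc1[of "inv\<^bsub>F\<^esub> c" c v] ci c(1) v by simp
    qed
    then show ?thesis using UD(1) by blast
  qed
  then show ?thesis
    using V.gmodule_axioms V_nonzero by (auto simp: irreducible_gmodule_def)
qed

section \<open>The group algebra\<close>

text \<open>The element \<open>c g\<close>. Scalar multiples of the unit and group elements both
  have this form, so one family of operators covers the actions of \<open>F\<close> and of
  \<open>G\<close>.\<close>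

definition galg_single :: "('f, 'm) ring_scheme \<Rightarrow> 'f \<Rightarrow> 'g \<Rightarrow> 'g \<Rightarrow> 'f"
  where "galg_single F c g = (\<lambda>x. if x = g then c else \<zero>\<^bsub>F\<^esub>)"

lemma galg_basis_eq: "galg_basis F g = galg_single F \<one>\<^bsub>F\<^esub> g"
  by (simp add: galg_basis_def galg_single_def)

lemma galg_carrier_iff:
  "a \<in> carrier (group_algebra F G) \<longleftrightarrow>
    (\<forall>g. a g \<in> carrier F) \<and> (\<forall>g. g \<notin> carrier G \<longrightarrow> a g = \<zero>\<^bsub>F\<^esub>) \<and> finite {g. a g \<noteq> \<zero>\<^bsub>F\<^esub>}"
  by (simp add: group_algebra_def)

lemma galg_add: "a \<oplus>\<^bsub>group_algebra F G\<^esub> b = (\<lambda>g. a g \<oplus>\<^bsub>F\<^esub> b g)"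
  by (simp add: group_algebra_def)

context ring
begin

lemma galg_single_closed:
  "c \<in> carrier R \<Longrightarrow> g \<in> carrier G \<Longrightarrow> galg_single R c g \<in> carrier (group_algebra R G)"
  by (auto simp: galg_single_def galg_carrier_iff)

lemma galg_add_closed:
  assumes "a \<in> carrier (group_algebra R G)" "b \<in> carrier (group_algebra R G)"
  shows "a \<oplus>\<^bsub>group_algebra R G\<^esub> b \<in> carrier (group_algebra R G)"
proof -
  have "finite ({g. a g \<noteq> \<zero>} \<union> {g. b g \<noteq> \<zero>})" using assms by (simp add: galg_carrier_iff)
  then have "finite {g. a g \<oplus> b g \<noteq> \<zero>}" by (rule finite_subset[rotated]) auto
  then show ?thesis using assms by (simp add: galg_carrier_iff galg_add)
qed

text \<open>Finite support makes every element a sum of terms \<open>c g\<close>; the induction runs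
  over a finite set that contains the support. \<open>ne\<close> supplies the group element with
  which zero is written as such a term.\<close>

lemma galg_induct [consumes 1, case_names single add]:
  assumes a: "a \<in> carrier (group_algebra R G)" and ne: "carrier G \<noteq> {}"
    and single: "\<And>c g. c \<in> carrier R \<Longrightarrow> g \<in> carrier G \<Longrightarrow> P (galg_single R c g)"
    and add: "\<And>a b. a \<in> carrier (group_algebra R G) \<Longrightarrow> b \<in> carrier (group_algebra R G) \<Longrightarrow>
      P a \<Longrightarrow> P b \<Longrightarrow> P (a \<oplus>\<^bsub>group_algebra R G\<^esub> b)"
  shows "P a"
proof -
  have "P a" if "finite S" "{g. a g \<noteq> \<zero>} \<subseteq> S" "a \<in> carrier (group_algebra R G)" for S a
    using that
  proof (induction S arbitrary: a rule: finite_induct)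
    case empty
    obtain g where g: "g \<in> carrier G" using ne by blast
    have "a = galg_single R \<zero> g" using empty by (auto simp: galg_single_def)
    then show ?case using single[of \<zero> g] g by simp
  next
    case (insert g S)
    show ?case
    proof (cases "g \<in> carrier G")
      case True
      let ?b = "a(g := \<zero>)" and ?c = "galg_single R (a g) g"
      have ag: "a g \<in> carrier R" "\<And>x. a x \<in> carrier R" using insert.prems by (auto simp: galg_carrier_iff)
      have fin: "finite {x. ?b x \<noteq> \<zero>}"
        by (rule finite_subset[of _ "{x. a x \<noteq> \<zero>}"]) (use insert.prems in \<open>auto simp: galg_carrier_iff\<close>)
      have b: "?b \<in> carrier (group_algebra R G)"
        using insert.prems fin by (simp add: galg_carrier_iff)
      have "{x. ?b x \<noteq> \<zero>} \<subseteq> S" using insert.prems(1) by auto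
      then have "P ?b" using b by (rule insert.IH)
      then have "P (?b \<oplus>\<^bsub>group_algebra R G\<^esub> ?c)"
        by (rule add[OF b galg_single_closed[OF ag(1) True] _ single[OF ag(1) True]])
      moreover have "?b \<oplus>\<^bsub>group_algebra R G\<^esub> ?c = a"
        using ag by (auto simp: galg_add galg_single_def)
      ultimately show ?thesis by simp
    next
      case False
      then have "a g = \<zero>" using insert.prems by (simp add: galg_carrier_iff)
      then have "{x. a x \<noteq> \<zero>} \<subseteq> S" using insert.prems(1) by auto
      then show ?thesis using insert.prems(2) by (rule insert.IH)
    qed
  qed
  then show ?thesis using a by (auto simp: galg_carrier_iff)
qed

end

section \<open>Products in the group algebra\<close>

locale induction_data = F: field F + G: group G + W: gmodule F "G\<lparr>carrier := H\<rparr>" W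
  for F :: "('f, 'm) ring_scheme" and G :: "('g, 'n) monoid_scheme" (structure)
    and H :: "'g set" and W :: "('g, 'f, 'w) gmodule" +
  assumes subgroup_H: "subgroup H G"
begin

abbreviation A where "A \<equiv> group_algebra F G"
abbreviation B where "B \<equiv> group_algebra F (G\<lparr>carrier := H\<rparr>)"
abbreviation single where "single \<equiv> galg_single F"

lemma H_sub: "h \<in> H \<Longrightarrow> h \<in> carrier G"
  using subgroup.subset[OF subgroup_H] by auto

lemma B_sub:
  assumes b: "b \<in> carrier B"
  shows "b \<in> carrier A"
proof -
  have "b g = \<zero>\<^bsub>F\<^esub>" if "g \<notin> carrier G" for g
  proof -
    have "g \<notin> H" using that H_sub by blast
    then show ?thesis using b by (simp add: galg_carrier_iff)
  qed
  then show ?thesis using b by (simp add: galg_carrier_iff)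
qed

lemma single_A: "c \<in> carrier F \<Longrightarrow> g \<in> carrier G \<Longrightarrow> single c g \<in> carrier A"
  by (rule F.galg_single_closed)

lemma single_B: "c \<in> carrier F \<Longrightarrow> h \<in> H \<Longrightarrow> single c h \<in> carrier B"
  using F.galg_single_closed[of c h "G\<lparr>carrier := H\<rparr>"] by simp

lemma add_A: "a \<in> carrier A \<Longrightarrow> a' \<in> carrier A \<Longrightarrow> a \<oplus>\<^bsub>A\<^esub> a' \<in> carrier A"
  by (rule F.galg_add_closed)

lemma add_BA: "b \<oplus>\<^bsub>B\<^esub> b' = b \<oplus>\<^bsub>A\<^esub> b'"
  by (simp add: galg_add)

lemma A_induct [consumes 1, case_names single add]:
  assumes "a \<in> carrier A"
    and "\<And>c g. c \<in> carrier F \<Longrightarrow> g \<in> carrier G \<Longrightarrow> P (single c g)"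
    and "\<And>a b. a \<in> carrier A \<Longrightarrow> b \<in> carrier A \<Longrightarrow> P a \<Longrightarrow> P b \<Longrightarrow> P (a \<oplus>\<^bsub>A\<^esub> b)"
  shows "P a"
  using assms(1) by (rule F.galg_induct) (use assms(2,3) G.one_closed in auto)

lemma B_induct [consumes 1, case_names single add]:
  assumes "b \<in> carrier B"
    and "\<And>c h. c \<in> carrier F \<Longrightarrow> h \<in> H \<Longrightarrow> P (single c h)"
    and "\<And>a b. a \<in> carrier B \<Longrightarrow> b \<in> carrier B \<Longrightarrow> P a \<Longrightarrow> P b \<Longrightarrow> P (a \<oplus>\<^bsub>B\<^esub> b)"
  shows "P b"
  using assms(1) by (rule F.galg_induct) (use assms(2,3) subgroup.one_closed[OF subgroup_H] in auto)

text \<open>Terms outside the support of \<open>a\<close> vanish, so the sum may run over any finite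
  set that contains it; this allows a common index set when products are added.\<close>

lemma galg_mult_eq:
  assumes a: "a \<in> carrier A" and b: "\<And>x. b x \<in> carrier F" and g: "g \<in> carrier G"
    and S: "finite S" "{x. a x \<noteq> \<zero>\<^bsub>F\<^esub>} \<subseteq> S"
  shows "(a \<otimes>\<^bsub>A\<^esub> b) g = (\<Oplus>\<^bsub>F\<^esub>x\<in>S. a x \<otimes>\<^bsub>F\<^esub> b (inv x \<otimes> g))"
proof -
  have aF: "a x \<in> carrier F" for x using a by (simp add: galg_carrier_iff)
  have "(\<Oplus>\<^bsub>F\<^esub>x\<in>{x. a x \<noteq> \<zero>\<^bsub>F\<^esub>}. a x \<otimes>\<^bsub>F\<^esub> b (inv x \<otimes> g)) = (\<Oplus>\<^bsub>F\<^esub>x\<in>S. a x \<otimes>\<^bsub>F\<^esub> b (inv x \<otimes> g))"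
    using S aF b by (intro F.add.finprod_mono_neutral_cong_left) auto
  then show ?thesis using g by (simp add: group_algebra_def)
qed

lemma galg_mult_outside: "g \<notin> carrier G \<Longrightarrow> (a \<otimes>\<^bsub>A\<^esub> b) g = \<zero>\<^bsub>F\<^esub>"
  by (simp add: group_algebra_def)

lemma galg_single_mult:
  assumes "c \<in> carrier F" "g \<in> carrier G" "b \<in> carrier A"
  shows "single c g \<otimes>\<^bsub>A\<^esub> b = (\<lambda>x. if x \<in> carrier G then c \<otimes>\<^bsub>F\<^esub> b (inv g \<otimes> x) else \<zero>\<^bsub>F\<^esub>)"
proof
  fix x
  have b: "b y \<in> carrier F" for y using assms by (simp add: galg_carrier_iff)
  show "(single c g \<otimes>\<^bsub>A\<^esub> b) x = (if x \<in> carrier G then c \<otimes>\<^bsub>F\<^esub> b (inv g \<otimes> x) else \<zero>\<^bsub>F\<^esub>)"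
  proof (cases "x \<in> carrier G")
    case True
    have "(single c g \<otimes>\<^bsub>A\<^esub> b) x = (\<Oplus>\<^bsub>F\<^esub>y\<in>{g}. single c g y \<otimes>\<^bsub>F\<^esub> b (inv y \<otimes> x))"
      using assms True b by (intro galg_mult_eq single_A) (auto simp: galg_single_def)
    also have "\<dots> = c \<otimes>\<^bsub>F\<^esub> b (inv g \<otimes> x)"
      using assms(1) b by (simp add: galg_single_def)
    finally show ?thesis using True by simp
  qed (simp add: galg_mult_outside)
qed

lemma galg_mult_add_left:
  assumes a: "a \<in> carrier A" "a' \<in> carrier A" and b: "b \<in> carrier A"
  shows "(a \<oplus>\<^bsub>A\<^esub> a') \<otimes>\<^bsub>A\<^esub> b = (a \<otimes>\<^bsub>A\<^esub> b) \<oplus>\<^bsub>A\<^esub> (a' \<otimes>\<^bsub>A\<^esub> b)"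
proof
  fix g
  have bF: "b y \<in> carrier F" "a y \<in> carrier F" "a' y \<in> carrier F" for y
    using a b by (simp_all add: galg_carrier_iff)
  show "((a \<oplus>\<^bsub>A\<^esub> a') \<otimes>\<^bsub>A\<^esub> b) g = ((a \<otimes>\<^bsub>A\<^esub> b) \<oplus>\<^bsub>A\<^esub> (a' \<otimes>\<^bsub>A\<^esub> b)) g"
  proof (cases "g \<in> carrier G")
    case True
    let ?S = "{x. a x \<noteq> \<zero>\<^bsub>F\<^esub>} \<union> {x. a' x \<noteq> \<zero>\<^bsub>F\<^esub>}"
    have fin: "finite ?S" using a by (simp add: galg_carrier_iff)
    have "((a \<oplus>\<^bsub>A\<^esub> a') \<otimes>\<^bsub>A\<^esub> b) g = (\<Oplus>\<^bsub>F\<^esub>x\<in>?S. (a \<oplus>\<^bsub>A\<^esub> a') x \<otimes>\<^bsub>F\<^esub> b (inv x \<otimes> g))"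
      using add_A[OF a] bF True fin by (intro galg_mult_eq) (auto simp: galg_add)
    also have "\<dots> = (\<Oplus>\<^bsub>F\<^esub>x\<in>?S. a x \<otimes>\<^bsub>F\<^esub> b (inv x \<otimes> g) \<oplus>\<^bsub>F\<^esub> a' x \<otimes>\<^bsub>F\<^esub> b (inv x \<otimes> g))"
      using bF by (intro F.finsum_cong') (auto simp: galg_add F.l_distr)
    also have "\<dots> = (\<Oplus>\<^bsub>F\<^esub>x\<in>?S. a x \<otimes>\<^bsub>F\<^esub> b (inv x \<otimes> g)) \<oplus>\<^bsub>F\<^esub> (\<Oplus>\<^bsub>F\<^esub>x\<in>?S. a' x \<otimes>\<^bsub>F\<^esub> b (inv x \<otimes> g))"
      using bF by (intro F.finsum_addf) auto
    also have "(\<Oplus>\<^bsub>F\<^esub>x\<in>?S. a x \<otimes>\<^bsub>F\<^esub> b (inv x \<otimes> g)) = (a \<otimes>\<^bsub>A\<^esub> b) g"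
      using a bF True fin by (intro galg_mult_eq[symmetric]) auto
    also have "(\<Oplus>\<^bsub>F\<^esub>x\<in>?S. a' x \<otimes>\<^bsub>F\<^esub> b (inv x \<otimes> g)) = (a' \<otimes>\<^bsub>A\<^esub> b) g"
      using a bF True fin by (intro galg_mult_eq[symmetric]) auto
    finally show ?thesis by (simp add: galg_add)
  qed (simp add: galg_mult_outside galg_add)
qed

lemma galg_mult_closed:
  assumes "a \<in> carrier A" and b: "b \<in> carrier A"
  shows "a \<otimes>\<^bsub>A\<^esub> b \<in> carrier A"
  using assms(1)
proof (induction rule: A_induct)
  case (single c g)
  have bF: "b y \<in> carrier F" for y using b by (simp add: galg_carrier_iff)
  have "{x. (single c g \<otimes>\<^bsub>A\<^esub> b) x \<noteq> \<zero>\<^bsub>F\<^esub>} \<subseteq> (\<lambda>y. g \<otimes> y) ` {y. b y \<noteq> \<zero>\<^bsub>F\<^esub>}"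
  proof
    fix x assume "x \<in> {x. (single c g \<otimes>\<^bsub>A\<^esub> b) x \<noteq> \<zero>\<^bsub>F\<^esub>}"
    then have x: "x \<in> carrier G" "b (inv g \<otimes> x) \<noteq> \<zero>\<^bsub>F\<^esub>"
      using single b by (auto simp: galg_single_mult split: if_splits)
    moreover have "x = g \<otimes> (inv g \<otimes> x)" using x single by (simp add: G.m_assoc[symmetric])
    ultimately show "x \<in> (\<lambda>y. g \<otimes> y) ` {y. b y \<noteq> \<zero>\<^bsub>F\<^esub>}" by blast
  qed
  moreover have "finite {y. b y \<noteq> \<zero>\<^bsub>F\<^esub>}" using b by (simp add: galg_carrier_iff)
  ultimately have "finite {x. (single c g \<otimes>\<^bsub>A\<^esub> b) x \<noteq> \<zero>\<^bsub>F\<^esub>}" by (meson finite_imageI finite_subset)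
  then show ?case using single b bF by (simp add: galg_carrier_iff[of "single c g \<otimes>\<^bsub>A\<^esub> b"]) (simp add: galg_single_mult)
next
  case (add a a')
  then show ?case using b by (simp add: galg_mult_add_left add_A)
qed

lemma galg_single_mult_single:
  assumes "c \<in> carrier F" "g \<in> carrier G" "d \<in> carrier F" "h \<in> carrier G"
  shows "single c g \<otimes>\<^bsub>A\<^esub> single d h = single (c \<otimes>\<^bsub>F\<^esub> d) (g \<otimes> h)"
proof
  fix x
  have "inv g \<otimes> x = h \<longleftrightarrow> x = g \<otimes> h" if "x \<in> carrier G"
    using that assms by (metis G.inv_solve_left)
  then show "(single c g \<otimes>\<^bsub>A\<^esub> single d h) x = single (c \<otimes>\<^bsub>F\<^esub> d) (g \<otimes> h) x"
    using assms by (auto simp: galg_single_mult single_A) (auto simp: galg_single_def)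
qed

lemma galg_single_mult_add:
  assumes "c \<in> carrier F" "g \<in> carrier G" "b \<in> carrier A" "b' \<in> carrier A"
  shows "single c g \<otimes>\<^bsub>A\<^esub> (b \<oplus>\<^bsub>A\<^esub> b') = (single c g \<otimes>\<^bsub>A\<^esub> b) \<oplus>\<^bsub>A\<^esub> (single c g \<otimes>\<^bsub>A\<^esub> b')"
proof -
  have "b y \<in> carrier F" "b' y \<in> carrier F" for y using assms by (simp_all add: galg_carrier_iff)
  then show ?thesis using assms add_A by (auto simp: galg_single_mult galg_add F.r_distr)
qed

text \<open>Left multiplication by \<open>c g\<close> shifts and scales coefficients and so commutes
  with right multiplication; this makes it respect the balancing relations of the tensor
  product.\<close>

lemma galg_single_mult_assoc:
  assumes c: "c \<in> carrier F" "g \<in> carrier G" and "a \<in> carrier A" and b: "b \<in> carrier A"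
  shows "single c g \<otimes>\<^bsub>A\<^esub> (a \<otimes>\<^bsub>A\<^esub> b) = (single c g \<otimes>\<^bsub>A\<^esub> a) \<otimes>\<^bsub>A\<^esub> b"
  using assms(3)
proof (induction rule: A_induct)
  case (single d h)
  have bF: "b y \<in> carrier F" for y using b by (simp add: galg_carrier_iff)
  have db: "single d h \<otimes>\<^bsub>A\<^esub> b \<in> carrier A" using single b by (intro galg_mult_closed single_A)
  have e: "(single d h \<otimes>\<^bsub>A\<^esub> b) y = d \<otimes>\<^bsub>F\<^esub> b (inv h \<otimes> y)" if "y \<in> carrier G" for y
    using galg_single_mult[OF single b] that by simp
  have cd: "c \<otimes>\<^bsub>F\<^esub> d \<in> carrier F" and gh: "g \<otimes> h \<in> carrier G" using c single by simp_all
  have "single c g \<otimes>\<^bsub>A\<^esub> (single d h \<otimes>\<^bsub>A\<^esub> b) =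
    (\<lambda>x. if x \<in> carrier G then c \<otimes>\<^bsub>F\<^esub> (single d h \<otimes>\<^bsub>A\<^esub> b) (inv g \<otimes> x) else \<zero>\<^bsub>F\<^esub>)"
    by (rule galg_single_mult[OF c db])
  also have "\<dots> = single (c \<otimes>\<^bsub>F\<^esub> d) (g \<otimes> h) \<otimes>\<^bsub>A\<^esub> b"
    unfolding galg_single_mult[OF cd gh b] using single c bF
    by (auto simp: e F.m_assoc G.inv_mult_group G.m_assoc)
  finally have "single c g \<otimes>\<^bsub>A\<^esub> (single d h \<otimes>\<^bsub>A\<^esub> b) = single (c \<otimes>\<^bsub>F\<^esub> d) (g \<otimes> h) \<otimes>\<^bsub>A\<^esub> b" .
  then show ?case using galg_single_mult_single[OF c single] by simp
next
  case (add a a')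
  then show ?case using b c galg_mult_closed single_A
    by (simp add: galg_mult_add_left galg_single_mult_add)
qed


section \<open>The action of \<open>FH\<close> on \<open>W\<close>\<close>

lemma galg_act_eq:
  assumes b: "b \<in> carrier B" and w: "w \<in> carrier W"
    and S: "finite S" "{h. b h \<noteq> \<zero>\<^bsub>F\<^esub>} \<subseteq> S" "S \<subseteq> H"
  shows "galg_act F W b w = (\<Oplus>\<^bsub>W\<^esub>h\<in>S. b h \<odot>\<^bsub>W\<^esub> gact W h w)"
proof -
  have bF: "b h \<in> carrier F" for h using b by (simp add: galg_carrier_iff)
  have act: "gact W h w \<in> carrier W" if "h \<in> S" for h using that S w W.act_closed[of h w] by auto
  show ?thesis unfolding galg_act_def
    using S bF act by (intro W.M.add.finprod_mono_neutral_cong_left) auto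
qed

lemma galg_act_single:
  assumes "c \<in> carrier F" "h \<in> H" "w \<in> carrier W"
  shows "galg_act F W (single c h) w = c \<odot>\<^bsub>W\<^esub> gact W h w"
proof -
  have "galg_act F W (single c h) w = (\<Oplus>\<^bsub>W\<^esub>k\<in>{h}. single c h k \<odot>\<^bsub>W\<^esub> gact W k w)"
    using assms by (intro galg_act_eq single_B) (auto simp: galg_single_def)
  then show ?thesis using assms W.act_closed[of h w] by (simp add: galg_single_def)
qed

lemma galg_act_closed:
  assumes b: "b \<in> carrier B" and w: "w \<in> carrier W"
  shows "galg_act F W b w \<in> carrier W"
proof -
  have "h \<in> H" if "b h \<noteq> \<zero>\<^bsub>F\<^esub>" for h using that b by (auto simp: galg_carrier_iff)
  then show ?thesis unfolding galg_act_def
    using b w W.act_closed by (intro W.M.finsum_closed) (auto simp: galg_carrier_iff)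
qed

lemma galg_act_add_left:
  assumes b: "b \<in> carrier B" "b' \<in> carrier B" and w: "w \<in> carrier W"
  shows "galg_act F W (b \<oplus>\<^bsub>A\<^esub> b') w = galg_act F W b w \<oplus>\<^bsub>W\<^esub> galg_act F W b' w"
proof -
  let ?S = "{x. b x \<noteq> \<zero>\<^bsub>F\<^esub>} \<union> {x. b' x \<noteq> \<zero>\<^bsub>F\<^esub>}"
  have fin: "finite ?S" and SH: "?S \<subseteq> H" using b by (auto simp: galg_carrier_iff)
  have bF: "b h \<in> carrier F" "b' h \<in> carrier F" for h using b by (simp_all add: galg_carrier_iff)
  have act: "gact W h w \<in> carrier W" if "h \<in> ?S" for h using that SH w W.act_closed[of h w] by auto
  have bb: "b \<oplus>\<^bsub>A\<^esub> b' \<in> carrier B" using F.galg_add_closed[OF b] by (simp add: add_BA)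
  have "galg_act F W (b \<oplus>\<^bsub>A\<^esub> b') w = (\<Oplus>\<^bsub>W\<^esub>h\<in>?S. (b \<oplus>\<^bsub>A\<^esub> b') h \<odot>\<^bsub>W\<^esub> gact W h w)"
    by (rule galg_act_eq[OF bb w fin _ SH]) (auto simp: galg_add)
  also have "\<dots> = (\<Oplus>\<^bsub>W\<^esub>h\<in>?S. b h \<odot>\<^bsub>W\<^esub> gact W h w \<oplus>\<^bsub>W\<^esub> b' h \<odot>\<^bsub>W\<^esub> gact W h w)"
    using bF act by (intro W.M.finsum_cong') (auto simp: galg_add W.smult_l_distr)
  also have "\<dots> = (\<Oplus>\<^bsub>W\<^esub>h\<in>?S. b h \<odot>\<^bsub>W\<^esub> gact W h w) \<oplus>\<^bsub>W\<^esub> (\<Oplus>\<^bsub>W\<^esub>h\<in>?S. b' h \<odot>\<^bsub>W\<^esub> gact W h w)"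
    using bF act by (intro W.M.finsum_addf) auto
  also have "(\<Oplus>\<^bsub>W\<^esub>h\<in>?S. b h \<odot>\<^bsub>W\<^esub> gact W h w) = galg_act F W b w"
    by (rule galg_act_eq[OF b(1) w fin _ SH, symmetric]) auto
  also have "(\<Oplus>\<^bsub>W\<^esub>h\<in>?S. b' h \<odot>\<^bsub>W\<^esub> gact W h w) = galg_act F W b' w"
    by (rule galg_act_eq[OF b(2) w fin _ SH, symmetric]) auto
  finally show ?thesis .
qed

lemma galg_act_add_right:
  assumes b: "b \<in> carrier B" and w: "w \<in> carrier W" "w' \<in> carrier W"
  shows "galg_act F W b (w \<oplus>\<^bsub>W\<^esub> w') = galg_act F W b w \<oplus>\<^bsub>W\<^esub> galg_act F W b w'"
  using b
proof (induction rule: B_induct)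
  case (single c h)
  then show ?case
    using w W.act_add[of h w w'] W.act_closed[of h] by (simp add: galg_act_single W.smult_r_distr)
next
  case (add b b')
  then show ?case
    using w by (simp add: add_BA galg_act_add_left galg_act_closed W.M.a_ac)
qed

text \<open>With \<open>b = coset_part x a\<close> in \<open>FH\<close>, the product
  \<open>x b\<close> is the part of \<open>a\<close> on the coset \<open>x <# H\<close>. Thus
  \<open>b\<close> is the coefficient of \<open>a\<close> at \<open>x\<close> when \<open>FG\<close>
  is seen as a free right \<open>FH\<close>-module on coset representatives.\<close>

definition coset_part :: "'g \<Rightarrow> ('g \<Rightarrow> 'f) \<Rightarrow> 'g \<Rightarrow> 'f"
  where "coset_part x a = (\<lambda>h. if h \<in> H then a (x \<otimes> h) else \<zero>\<^bsub>F\<^esub>)"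

lemma coset_part_closed:
  assumes x: "x \<in> carrier G" and a: "a \<in> carrier A"
  shows "coset_part x a \<in> carrier B"
proof -
  have "{h. coset_part x a h \<noteq> \<zero>\<^bsub>F\<^esub>} \<subseteq> (\<lambda>y. inv x \<otimes> y) ` {y. a y \<noteq> \<zero>\<^bsub>F\<^esub>}"
  proof
    fix h assume "h \<in> {h. coset_part x a h \<noteq> \<zero>\<^bsub>F\<^esub>}"
    then have h: "h \<in> H" "a (x \<otimes> h) \<noteq> \<zero>\<^bsub>F\<^esub>" by (auto simp: coset_part_def split: if_splits)
    moreover have "h = inv x \<otimes> (x \<otimes> h)" using x h H_sub by (simp add: G.m_assoc[symmetric])
    ultimately show "h \<in> (\<lambda>y. inv x \<otimes> y) ` {y. a y \<noteq> \<zero>\<^bsub>F\<^esub>}" by blast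
  qed
  moreover have "finite {y. a y \<noteq> \<zero>\<^bsub>F\<^esub>}" using a by (simp add: galg_carrier_iff)
  ultimately have "finite {h. coset_part x a h \<noteq> \<zero>\<^bsub>F\<^esub>}" by (meson finite_imageI finite_subset)
  then show ?thesis using a by (simp add: galg_carrier_iff) (simp add: coset_part_def)
qed

lemma coset_part_add:
  assumes "a \<in> carrier A" "a' \<in> carrier A"
  shows "coset_part x (a \<oplus>\<^bsub>A\<^esub> a') = coset_part x a \<oplus>\<^bsub>A\<^esub> coset_part x a'"
  by (auto simp: coset_part_def galg_add)

lemma coset_part_single:
  assumes "x \<in> carrier G" "g \<in> carrier G"
  shows "coset_part x (single c g) = (if inv x \<otimes> g \<in> H then single c (inv x \<otimes> g) else (\<lambda>h. \<zero>\<^bsub>F\<^esub>))"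
proof
  fix h
  have "x \<otimes> h = g \<longleftrightarrow> h = inv x \<otimes> g" if "h \<in> H"
    using that assms H_sub by (metis G.inv_solve_left)
  then show "coset_part x (single c g) h =
      (if inv x \<otimes> g \<in> H then single c (inv x \<otimes> g) else (\<lambda>h. \<zero>\<^bsub>F\<^esub>)) h"
    by (auto simp: coset_part_def galg_single_def)
qed

text \<open>If \<open>a\<close> is the sum of the products \<open>x b\<close> with
  \<open>b = coset_part x a\<close>, then each \<open>b\<close> moves across the tensor sign, so the
  component of \<open>a \<otimes> w\<close> at \<open>x\<close> has to be
  \<open>b w\<close>.\<close>

definition pair_coord :: "'g \<Rightarrow> ('g \<Rightarrow> 'f) \<Rightarrow> 'w \<Rightarrow> 'w"
  where "pair_coord x a w = galg_act F W (coset_part x a) w"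

lemma pair_coord_closed:
  "x \<in> carrier G \<Longrightarrow> a \<in> carrier A \<Longrightarrow> w \<in> carrier W \<Longrightarrow> pair_coord x a w \<in> carrier W"
  by (simp add: pair_coord_def galg_act_closed coset_part_closed)

lemma pair_coord_add_left:
  "x \<in> carrier G \<Longrightarrow> a \<in> carrier A \<Longrightarrow> a' \<in> carrier A \<Longrightarrow> w \<in> carrier W \<Longrightarrow>
    pair_coord x (a \<oplus>\<^bsub>A\<^esub> a') w = pair_coord x a w \<oplus>\<^bsub>W\<^esub> pair_coord x a' w"
  by (simp add: pair_coord_def galg_act_add_left coset_part_closed coset_part_add)

lemma pair_coord_add_right:
  "x \<in> carrier G \<Longrightarrow> a \<in> carrier A \<Longrightarrow> w \<in> carrier W \<Longrightarrow> w' \<in> carrier W \<Longrightarrow>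
    pair_coord x a (w \<oplus>\<^bsub>W\<^esub> w') = pair_coord x a w \<oplus>\<^bsub>W\<^esub> pair_coord x a w'"
  by (simp add: pair_coord_def galg_act_add_right coset_part_closed)

lemma pair_coord_single:
  assumes "x \<in> carrier G" "c \<in> carrier F" "g \<in> carrier G" "w \<in> carrier W"
  shows "pair_coord x (single c g) w =
    (if inv x \<otimes> g \<in> H then c \<odot>\<^bsub>W\<^esub> gact W (inv x \<otimes> g) w else \<zero>\<^bsub>W\<^esub>)"
proof -
  have "galg_act F W (\<lambda>h. \<zero>\<^bsub>F\<^esub>) w = \<zero>\<^bsub>W\<^esub>" by (simp add: galg_act_def)
  then show ?thesis
    using assms by (simp add: pair_coord_def coset_part_single galg_act_single)
qed

text \<open>This lets the coordinate descend to the tensor product over \<open>FH\<close>. Both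
  algebra elements are reduced to terms \<open>c g\<close> and \<open>d h\<close>, for which it is
  associativity of the action.\<close>

lemma pair_coord_balanced:
  assumes x: "x \<in> carrier G" and a: "a \<in> carrier A" and b: "b \<in> carrier B" and w: "w \<in> carrier W"
  shows "pair_coord x (a \<otimes>\<^bsub>A\<^esub> b) w = pair_coord x a (galg_act F W b w)"
  using a
proof (induction rule: A_induct)
  case (single c g)
  show ?case using b
  proof (induction rule: B_induct)
    case (single d h)
    have hG: "h \<in> carrier G" using single H_sub by simp
    have act: "gact W h w \<in> carrier W" using W.act_closed[of h w] single w by simp
    have e: "inv x \<otimes> (g \<otimes> h) = inv x \<otimes> g \<otimes> h"
      using x \<open>g \<in> carrier G\<close> hG by (simp add: G.m_assoc)
    \<comment> \<open>Right multiplication by \<open>h\<close> in \<open>H\<close> stays in the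
      coset, so the two sides vanish for the same \<open>g\<close>.\<close>
    have iff: "inv x \<otimes> g \<otimes> h \<in> H \<longleftrightarrow> inv x \<otimes> g \<in> H"
    proof
      assume "inv x \<otimes> g \<otimes> h \<in> H"
      then have "inv x \<otimes> g \<otimes> h \<otimes> inv h \<in> H"
        using single subgroup.m_closed[OF subgroup_H _ subgroup.m_inv_closed[OF subgroup_H]] by blast
      then show "inv x \<otimes> g \<in> H" using x \<open>g \<in> carrier G\<close> hG by (simp add: G.m_assoc)
    qed (use single subgroup_H in \<open>auto intro: subgroup.m_closed\<close>)
    have "pair_coord x (single c g \<otimes>\<^bsub>A\<^esub> single d h) w =
      (if inv x \<otimes> g \<in> H then (c \<otimes>\<^bsub>F\<^esub> d) \<odot>\<^bsub>W\<^esub> gact W (inv x \<otimes> g \<otimes> h) w else \<zero>\<^bsub>W\<^esub>)"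
      using \<open>c \<in> carrier F\<close> \<open>g \<in> carrier G\<close> single hG x w
      by (simp add: galg_single_mult_single pair_coord_single e iff)
    also have "\<dots> = (if inv x \<otimes> g \<in> H
        then c \<odot>\<^bsub>W\<^esub> gact W (inv x \<otimes> g) (d \<odot>\<^bsub>W\<^esub> gact W h w) else \<zero>\<^bsub>W\<^esub>)"
      using \<open>c \<in> carrier F\<close> single w act W.gact_mult[of "inv x \<otimes> g" h w]
        W.act_smult[of "inv x \<otimes> g" "gact W h w" d] W.act_closed[of "inv x \<otimes> g" "gact W h w"]
      by (simp add: W.smult_assoc1)
    also have "\<dots> = pair_coord x (single c g) (galg_act F W (single d h) w)"
      using \<open>c \<in> carrier F\<close> \<open>g \<in> carrier G\<close> single x w act
      by (simp add: pair_coord_single galg_act_single)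
    finally show ?case .
  next
    case (add b b')
    then show ?case
      using \<open>c \<in> carrier F\<close> \<open>g \<in> carrier G\<close> x w
      by (simp add: add_BA galg_single_mult_add B_sub pair_coord_add_left pair_coord_add_right
          galg_mult_closed single_A galg_act_add_left galg_act_closed)
  qed
next
  case (add a a')
  then show ?case
    using b w x
    by (simp add: galg_mult_add_left B_sub pair_coord_add_left galg_mult_closed galg_act_closed)
qed

end

section \<open>The tensor product\<close>

context induction_data
begin

abbreviation T where "T \<equiv> tensor_free F G W"
abbreviation K where "K \<equiv> tensor_relations F G H W"

sublocale T: comm_group T
  by (simp add: tensor_free_def abelian_free_Abelian_group)

lemma T_simps [simp]: "s \<otimes>\<^bsub>T\<^esub> t = s + t" "\<one>\<^bsub>T\<^esub> = 0"
  by (simp_all add: tensor_free_def)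

lemma T_carrier_iff: "t \<in> carrier T \<longleftrightarrow> Poly_Mapping.keys t \<subseteq> carrier A \<times> carrier W"
  by (simp add: tensor_free_def)

lemma T_inv: "t \<in> carrier T \<Longrightarrow> inv\<^bsub>T\<^esub> t = - t"
  by (simp add: tensor_free_def)

lemma frag_T: "a \<in> carrier A \<Longrightarrow> w \<in> carrier W \<Longrightarrow> frag_of (a, w) \<in> carrier T"
  by (simp add: T_carrier_iff)

lemma diff_T: "s \<in> carrier T \<Longrightarrow> t \<in> carrier T \<Longrightarrow> s - t \<in> carrier T"
  using keys_diff[of s t] unfolding T_carrier_iff by blast

lemma add_T: "s \<in> carrier T \<Longrightarrow> t \<in> carrier T \<Longrightarrow> s + t \<in> carrier T"
  using T.m_closed[of s t] by simp

lemma T_induct [consumes 1, case_names zero diff frag]: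
  assumes "t \<in> carrier T" and "P 0"
    and "\<And>s t. s \<in> carrier T \<Longrightarrow> t \<in> carrier T \<Longrightarrow> P s \<Longrightarrow> P t \<Longrightarrow> P (s - t)"
    and "\<And>a w. a \<in> carrier A \<Longrightarrow> w \<in> carrier W \<Longrightarrow> P (frag_of (a, w))"
  shows "P t"
  using assms(1) unfolding T_carrier_iff
  by (rule free_Abelian_group_induct) (use assms(2-4) in \<open>auto simp: T_carrier_iff\<close>)

text \<open>The generators in \<open>tensor_relations\<close>, made inductive to obtain a case rule
  for the three kinds of relation.\<close>

inductive_set gens :: "(('g \<Rightarrow> 'f) \<times> 'w \<Rightarrow>\<^sub>0 int) set" where
  left: "a \<in> carrier A \<Longrightarrow> a' \<in> carrier A \<Longrightarrow> w \<in> carrier W \<Longrightarrow>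
    frag_of (a \<oplus>\<^bsub>A\<^esub> a', w) - frag_of (a, w) - frag_of (a', w) \<in> gens"
| right: "a \<in> carrier A \<Longrightarrow> w \<in> carrier W \<Longrightarrow> w' \<in> carrier W \<Longrightarrow>
    frag_of (a, w \<oplus>\<^bsub>W\<^esub> w') - frag_of (a, w) - frag_of (a, w') \<in> gens"
| balanced: "a \<in> carrier A \<Longrightarrow> b \<in> carrier B \<Longrightarrow> w \<in> carrier W \<Longrightarrow>
    frag_of (a \<otimes>\<^bsub>A\<^esub> b, w) - frag_of (a, galg_act F W b w) \<in> gens"

lemma K_eq: "K = generate T gens"
proof -
  have "gens =
     {frag_of (a \<oplus>\<^bsub>A\<^esub> a', w) - frag_of (a, w) - frag_of (a', w) | a a' w.
        a \<in> carrier A \<and> a' \<in> carrier A \<and> w \<in> carrier W} \<union>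
     {frag_of (a, w \<oplus>\<^bsub>W\<^esub> w') - frag_of (a, w) - frag_of (a, w') | a w w'.
        a \<in> carrier A \<and> w \<in> carrier W \<and> w' \<in> carrier W} \<union>
     {frag_of (a \<otimes>\<^bsub>A\<^esub> b, w) - frag_of (a, galg_act F W b w) | a b w.
        a \<in> carrier A \<and> b \<in> carrier B \<and> w \<in> carrier W}" (is "_ = ?S")
  proof (intro equalityI subsetI)
    fix t assume "t \<in> gens" then show "t \<in> ?S" by cases blast+
  next
    fix t assume "t \<in> ?S" then show "t \<in> gens" by (blast intro: gens.intros)
  qed
  then show ?thesis unfolding tensor_relations_def Let_def by simp
qed

lemma gens_T: "gens \<subseteq> carrier T"
proof
  fix t assume "t \<in> gens"
  then show "t \<in> carrier T"
    by cases (simp_all add: diff_T frag_T add_A galg_mult_closed B_sub galg_act_closed)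
qed

lemma K_subgroup: "subgroup K T"
  unfolding K_eq by (rule T.generate_is_subgroup[OF gens_T])

lemma K_normal: "K \<lhd> T"
  by (rule T.subgroup_imp_normal[OF K_subgroup])

lemma K_T: "k \<in> K \<Longrightarrow> k \<in> carrier T"
  using subgroup.subset[OF K_subgroup] by blast

lemma gens_K: "gens \<subseteq> K"
  unfolding K_eq by (auto intro: generate.incl)

lemma K_induct [consumes 1, case_names zero gen minus add]:
  assumes "k \<in> K" and zero: "P 0" and gen: "\<And>t. t \<in> gens \<Longrightarrow> P t"
    and minus: "\<And>t. t \<in> gens \<Longrightarrow> P (- t)"
    and add: "\<And>s t. s \<in> K \<Longrightarrow> t \<in> K \<Longrightarrow> P s \<Longrightarrow> P t \<Longrightarrow> P (s + t)"
  shows "P k"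
  using assms(1) unfolding K_eq
proof (induction rule: generate.induct)
  case (inv h)
  then have "inv\<^bsub>T\<^esub> h = - h" using gens_T T_inv by blast
  then show ?case using minus inv by simp
qed (use zero gen add in \<open>simp_all add: K_eq\<close>)

section \<open>Residue classes and simple tensors\<close>

definition cl :: "(('g \<Rightarrow> 'f) \<times> 'w \<Rightarrow>\<^sub>0 int) \<Rightarrow> (('g \<Rightarrow> 'f) \<times> 'w \<Rightarrow>\<^sub>0 int) set"
  where "cl t = K #>\<^bsub>T\<^esub> t"

text \<open>The simple tensor \<open>a \<otimes> w\<close>.\<close>

definition ten :: "('g \<Rightarrow> 'f) \<Rightarrow> 'w \<Rightarrow> (('g \<Rightarrow> 'f) \<times> 'w \<Rightarrow>\<^sub>0 int) set"
  where "ten a w = cl (frag_of (a, w))"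

abbreviation V where "V \<equiv> induced F G H W"

lemma V_simps:
  "carrier V = carrier (T Mod K)" "\<zero>\<^bsub>V\<^esub> = \<one>\<^bsub>T Mod K\<^esub>" "u \<oplus>\<^bsub>V\<^esub> v = u \<otimes>\<^bsub>T Mod K\<^esub> v"
  "gact V g v = tensor_lmult F G H W (galg_basis F g) v"
  "c \<odot>\<^bsub>V\<^esub> v = tensor_lmult F G H W (c \<odot>\<^bsub>A\<^esub> \<one>\<^bsub>A\<^esub>) v"
  by (simp_all add: induced_def Let_def)

lemma abelian_group_V: "abelian_group V"
proof -
  interpret Q: comm_group "T Mod K" by (rule T.abelian_FactGroup[OF K_subgroup])
  show ?thesis
  proof (rule abelian_groupI)
    show "\<exists>u\<in>carrier V. u \<oplus>\<^bsub>V\<^esub> v = \<zero>\<^bsub>V\<^esub>" if "v \<in> carrier V" for v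
      using Q.l_inv_ex[of v] that unfolding V_simps by blast
  qed (unfold V_simps, (rule Q.m_closed Q.one_closed Q.m_assoc Q.m_comm Q.l_one; assumption)+)
qed

sublocale VA: abelian_group V
  by (rule abelian_group_V)

lemma cl_closed: "t \<in> carrier T \<Longrightarrow> cl t \<in> carrier V"
  by (auto simp: V_simps cl_def FactGroup_def RCOSETS_def)

lemma V_cases:
  assumes "v \<in> carrier V"
  obtains t where "t \<in> carrier T" "v = cl t"
  using assms by (auto simp: V_simps cl_def FactGroup_def RCOSETS_def)

lemma cl_add: "s \<in> carrier T \<Longrightarrow> t \<in> carrier T \<Longrightarrow> cl (s + t) = cl s \<oplus>\<^bsub>V\<^esub> cl t"
  using normal.rcos_sum[OF K_normal, of s t] by (simp add: V_simps cl_def)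

lemma cl_K: "k \<in> K \<Longrightarrow> cl k = \<zero>\<^bsub>V\<^esub>"
  using T.coset_join2[OF K_T K_subgroup] by (simp add: V_simps cl_def)

lemma cl_eqI:
  assumes "s \<in> carrier T" "t \<in> carrier T" "s - t \<in> K"
  shows "cl s = cl t"
proof -
  have "cl s = cl ((s - t) + t)" by simp
  also have "\<dots> = \<zero>\<^bsub>V\<^esub> \<oplus>\<^bsub>V\<^esub> cl t"
    using assms cl_add[OF K_T[OF assms(3)] assms(2)] cl_K by simp
  also have "\<dots> = cl t" using cl_closed assms by simp
  finally show ?thesis .
qed

lemma ten_closed: "a \<in> carrier A \<Longrightarrow> w \<in> carrier W \<Longrightarrow> ten a w \<in> carrier V"
  by (simp add: ten_def cl_closed frag_T)

lemma ten_add_left: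
  assumes "a \<in> carrier A" "a' \<in> carrier A" "w \<in> carrier W"
  shows "ten (a \<oplus>\<^bsub>A\<^esub> a') w = ten a w \<oplus>\<^bsub>V\<^esub> ten a' w"
proof -
  have "cl (frag_of (a \<oplus>\<^bsub>A\<^esub> a', w)) = cl (frag_of (a, w) + frag_of (a', w))"
    using assms gens.left gens_K
    by (intro cl_eqI frag_T add_T add_A) (auto simp: diff_diff_add[symmetric])
  then show ?thesis using assms by (simp add: ten_def cl_add frag_T)
qed

lemma ten_add_right:
  assumes "a \<in> carrier A" "w \<in> carrier W" "w' \<in> carrier W"
  shows "ten a (w \<oplus>\<^bsub>W\<^esub> w') = ten a w \<oplus>\<^bsub>V\<^esub> ten a w'"
proof -
  have "cl (frag_of (a, w \<oplus>\<^bsub>W\<^esub> w')) = cl (frag_of (a, w) + frag_of (a, w'))"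
    using assms gens.right gens_K
    by (intro cl_eqI frag_T add_T W.M.a_closed) (auto simp: diff_diff_add[symmetric])
  then show ?thesis using assms by (simp add: ten_def cl_add frag_T)
qed

lemma ten_balanced:
  assumes "a \<in> carrier A" "b \<in> carrier B" "w \<in> carrier W"
  shows "ten (a \<otimes>\<^bsub>A\<^esub> b) w = ten a (galg_act F W b w)"
  unfolding ten_def
proof (rule cl_eqI)
  show "frag_of (a \<otimes>\<^bsub>A\<^esub> b, w) \<in> carrier T" using assms by (simp add: frag_T galg_mult_closed B_sub)
  show "frag_of (a, galg_act F W b w) \<in> carrier T" using assms by (simp add: frag_T galg_act_closed)
  show "frag_of (a \<otimes>\<^bsub>A\<^esub> b, w) - frag_of (a, galg_act F W b w) \<in> K"
    using gens.balanced[OF assms] gens_K by blast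
qed

lemma ten_zero: "a \<in> carrier A \<Longrightarrow> ten a \<zero>\<^bsub>W\<^esub> = \<zero>\<^bsub>V\<^esub>"
  using ten_add_right[of a "\<zero>\<^bsub>W\<^esub>" "\<zero>\<^bsub>W\<^esub>"] ten_closed[of a "\<zero>\<^bsub>W\<^esub>"]
    VA.add.l_cancel_one[of "ten a \<zero>\<^bsub>W\<^esub>" "ten a \<zero>\<^bsub>W\<^esub>"] by simp

lemma cl_zero: "cl 0 = \<zero>\<^bsub>V\<^esub>"
  using cl_K subgroup.one_closed[OF K_subgroup] by simp

text \<open>Negatives of simple tensors are again simple tensors, so that \<open>V_induct\<close>
  can work with sums alone.\<close>

lemma cl_uminus_frag:
  assumes "a \<in> carrier A" "w \<in> carrier W"
  shows "cl (- frag_of (a, w)) = ten a (\<ominus>\<^bsub>W\<^esub> w)"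
proof -
  have m: "- frag_of (a, w) \<in> carrier T"
    using T.inv_closed[OF frag_T[OF assms]] T_inv[OF frag_T[OF assms]] by simp
  have n: "\<ominus>\<^bsub>W\<^esub> w \<in> carrier W" using assms by simp
  have "ten a (\<ominus>\<^bsub>W\<^esub> w) \<oplus>\<^bsub>V\<^esub> ten a w = \<zero>\<^bsub>V\<^esub>"
    using ten_add_right[OF assms(1) n assms(2)] ten_zero assms by (simp add: W.M.l_neg)
  moreover have "cl (- frag_of (a, w)) \<oplus>\<^bsub>V\<^esub> ten a w = \<zero>\<^bsub>V\<^esub>"
    using cl_add[OF m frag_T[OF assms]] cl_zero by (simp add: ten_def)
  ultimately show ?thesis
    using VA.minus_equality ten_closed[OF assms] ten_closed[OF assms(1) n] cl_closed[OF m] by metis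
qed

lemma V_induct [consumes 1, case_names ten add]:
  assumes v: "v \<in> carrier V"
    and ten: "\<And>a w. a \<in> carrier A \<Longrightarrow> w \<in> carrier W \<Longrightarrow> P (ten a w)"
    and add: "\<And>u v. u \<in> carrier V \<Longrightarrow> v \<in> carrier V \<Longrightarrow> P u \<Longrightarrow> P v \<Longrightarrow> P (u \<oplus>\<^bsub>V\<^esub> v)"
  shows "P v"
proof -
  obtain t where t: "t \<in> carrier T" "v = cl t" using V_cases[OF v] .
  have one: "single \<one>\<^bsub>F\<^esub> \<one> \<in> carrier A" by (intro single_A) auto
  have P0: "P (cl 0)" using ten[OF one W.M.zero_closed] ten_zero[OF one] cl_zero by simp
  have neg: "- s \<in> carrier T" if "s \<in> carrier T" for s
    using T.inv_closed[OF that] T_inv[OF that] by simp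
  \<comment> \<open>Induction over the free group proceeds by differences, whereas \<open>P\<close>
    is only known to pass to sums; hence the claim includes \<open>- t\<close>.\<close>
  have "P (cl t) \<and> P (cl (- t))"
    using t(1)
  proof (induction rule: T_induct)
    case zero
    then show ?case using P0 by simp
  next
    case (diff x y)
    then have "P (cl (x + - y))" "P (cl (- x + y))"
      using add[OF cl_closed cl_closed] neg cl_add by metis+
    then show ?case by (simp add: add.commute)
  next
    case (frag a w)
    then show ?case using ten[of a w] ten[of a "\<ominus>\<^bsub>W\<^esub> w"] cl_uminus_frag by (simp add: ten_def[symmetric])
  qed
  then show ?thesis using t by simp
qed

section \<open>Left multiplication on the tensor product\<close>

definition lmul :: "'f \<Rightarrow> 'g \<Rightarrow> (('g \<Rightarrow> 'f) \<times> 'w \<Rightarrow>\<^sub>0 int) \<Rightarrow> (('g \<Rightarrow> 'f) \<times> 'w \<Rightarrow>\<^sub>0 int)"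
  where "lmul c g = frag_extend (\<lambda>(a, w). frag_of (single c g \<otimes>\<^bsub>A\<^esub> a, w))"

lemma lmul_simps:
  "lmul c g (s + t) = lmul c g s + lmul c g t" "lmul c g (s - t) = lmul c g s - lmul c g t"
  "lmul c g (- t) = - lmul c g t" "lmul c g 0 = 0"
  "lmul c g (frag_of (a, w)) = frag_of (single c g \<otimes>\<^bsub>A\<^esub> a, w)"
  by (simp_all add: lmul_def frag_extend_add frag_extend_diff frag_extend_minus)

lemma lmul_T:
  assumes "c \<in> carrier F" "g \<in> carrier G" "t \<in> carrier T"
  shows "lmul c g t \<in> carrier T"
  using assms(3)
proof (induction rule: T_induct)
  case zero
  then show ?case using T.one_closed by (simp add: lmul_simps)
next
  case (diff x y)
  then show ?case by (simp add: lmul_simps diff_T)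
next
  case (frag a w)
  then show ?case using assms by (simp add: lmul_simps galg_mult_closed single_A frag_T)
qed

text \<open>Each kind of relation is carried to one of the same kind, by distributivity and by
  associativity with right factors from \<open>FH\<close>; hence left multiplication descends to the
  quotient.\<close>

lemma lmul_gens:
  assumes c: "c \<in> carrier F" "g \<in> carrier G" and t: "t \<in> gens"
  shows "lmul c g t \<in> gens"
  using t
proof cases
  case (left a a' w)
  then show ?thesis
    using c gens.left[of "single c g \<otimes>\<^bsub>A\<^esub> a" "single c g \<otimes>\<^bsub>A\<^esub> a'" w]
    by (simp add: lmul_simps galg_single_mult_add galg_mult_closed single_A)
next
  case (right a w w')
  then show ?thesis
    using c gens.right[of "single c g \<otimes>\<^bsub>A\<^esub> a" w w']
    by (simp add: lmul_simps galg_mult_closed single_A)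
next
  case (balanced a b w)
  then show ?thesis
    using c gens.balanced[of "single c g \<otimes>\<^bsub>A\<^esub> a" b w]
    by (simp add: lmul_simps galg_mult_closed single_A galg_single_mult_assoc B_sub)
qed

lemma lmul_K:
  assumes c: "c \<in> carrier F" "g \<in> carrier G" and "t \<in> K"
  shows "lmul c g t \<in> K"
  using assms(3)
proof (induction rule: K_induct)
  case zero
  then show ?case using subgroup.one_closed[OF K_subgroup] by (simp add: lmul_simps)
next
  case (gen t)
  then show ?case using lmul_gens[OF c] gens_K by blast
next
  case (minus t)
  then have "lmul c g t \<in> K" using lmul_gens[OF c] gens_K by blast
  then show ?case using subgroup.m_inv_closed[OF K_subgroup] T_inv[OF K_T] by (metis lmul_simps(3))
next
  case (add s t)
  then show ?case using subgroup.m_closed[OF K_subgroup] by (simp add: lmul_simps)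
qed

text \<open>All representatives are multiplied and then \<open>K\<close> is added. Because
  \<open>lmul\<close> maps \<open>K\<close> into \<open>K\<close>, the result is exactly one
  coset.\<close>

lemma tensor_lmult_cl:
  assumes c: "c \<in> carrier F" "g \<in> carrier G" and t: "t \<in> carrier T"
  shows "tensor_lmult F G H W (single c g) (cl t) = cl (lmul c g t)"
proof -
  have l: "frag_extend (\<lambda>(a, w). frag_of (single c g \<otimes>\<^bsub>A\<^esub> a, w)) = lmul c g" by (simp add: lmul_def)
  have r: "cl s = {k + s | k. k \<in> K}" for s by (auto simp: cl_def r_coset_def)
  have z: "0 \<in> K" using subgroup.one_closed[OF K_subgroup] by simp
  have add: "k + k' \<in> K" if "k \<in> K" "k' \<in> K" for k k' using subgroup.m_closed[OF K_subgroup that] by simp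
  show ?thesis
  proof (intro equalityI subsetI)
    fix y assume "y \<in> tensor_lmult F G H W (single c g) (cl t)"
    then obtain k k' where "k \<in> K" "k' \<in> K" "y = k + lmul c g (k' + t)"
      unfolding tensor_lmult_def set_mult_def l r by auto
    then have "y = (k + lmul c g k') + lmul c g t" "k + lmul c g k' \<in> K"
      using add lmul_K[OF c] by (simp_all add: lmul_simps add.assoc)
    then show "y \<in> cl (lmul c g t)" unfolding r by blast
  next
    fix y assume "y \<in> cl (lmul c g t)"
    then obtain k where k: "k \<in> K" "y = k + lmul c g t" unfolding r by blast
    have "t \<in> cl t" unfolding r using z by force
    then show "y \<in> tensor_lmult F G H W (single c g) (cl t)"
      unfolding tensor_lmult_def set_mult_def l using k by auto
  qed
qed

abbreviation lop :: "'f \<Rightarrow> 'g \<Rightarrow> (('g \<Rightarrow> 'f) \<times> 'w \<Rightarrow>\<^sub>0 int) set \<Rightarrow> (('g \<Rightarrow> 'f) \<times> 'w \<Rightarrow>\<^sub>0 int) set"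
  where "lop c g \<equiv> tensor_lmult F G H W (single c g)"

lemma lop_closed: "c \<in> carrier F \<Longrightarrow> g \<in> carrier G \<Longrightarrow> v \<in> carrier V \<Longrightarrow> lop c g v \<in> carrier V"
  by (elim V_cases) (simp add: tensor_lmult_cl cl_closed lmul_T)

lemma lop_add:
  assumes "c \<in> carrier F" "g \<in> carrier G" "u \<in> carrier V" "v \<in> carrier V"
  shows "lop c g (u \<oplus>\<^bsub>V\<^esub> v) = lop c g u \<oplus>\<^bsub>V\<^esub> lop c g v"
proof -
  obtain s where s: "s \<in> carrier T" "u = cl s" using V_cases[OF assms(3)] .
  obtain t where t: "t \<in> carrier T" "v = cl t" using V_cases[OF assms(4)] .
  show ?thesis
    using s t assms(1,2)
    by (simp add: cl_add[symmetric] tensor_lmult_cl add_T lmul_simps lmul_T)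
qed

lemma lop_ten:
  "c \<in> carrier F \<Longrightarrow> g \<in> carrier G \<Longrightarrow> a \<in> carrier A \<Longrightarrow> w \<in> carrier W \<Longrightarrow>
    lop c g (ten a w) = ten (single c g \<otimes>\<^bsub>A\<^esub> a) w"
  by (simp add: ten_def tensor_lmult_cl frag_T lmul_simps)

text \<open>Scalars and group elements both act through some \<open>lop c g\<close>, so this single
  law gives associativity of each action and their commutation.\<close>

lemma lop_lop:
  assumes "c \<in> carrier F" "g \<in> carrier G" "d \<in> carrier F" "h \<in> carrier G" "v \<in> carrier V"
  shows "lop c g (lop d h v) = lop (c \<otimes>\<^bsub>F\<^esub> d) (g \<otimes> h) v"
  using assms(5)
proof (induction rule: V_induct)
  case (ten a w)
  then show ?case using assms(1-4)
    by (simp add: lop_ten galg_mult_closed single_A galg_single_mult_assoc galg_single_mult_single)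
next
  case (add u v)
  then show ?case using assms(1-4) by (simp add: lop_add lop_closed)
qed

lemma smult_lop: "c \<in> carrier F \<Longrightarrow> c \<odot>\<^bsub>V\<^esub> v = lop c \<one> v"
proof -
  assume "c \<in> carrier F"
  then have "c \<odot>\<^bsub>A\<^esub> \<one>\<^bsub>A\<^esub> = single c \<one>"
    by (auto simp: group_algebra_def galg_basis_def galg_single_def)
  then show ?thesis by (simp add: V_simps)
qed

lemma gact_lop: "gact V g v = lop \<one>\<^bsub>F\<^esub> g v"
  by (simp add: V_simps galg_basis_eq)

lemma lop_one: "v \<in> carrier V \<Longrightarrow> lop \<one>\<^bsub>F\<^esub> \<one> v = v"
proof (induction rule: V_induct)
  case (ten a w)
  have "single \<one>\<^bsub>F\<^esub> \<one> \<otimes>\<^bsub>A\<^esub> a = a"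
    using ten by (auto simp: galg_single_mult galg_carrier_iff)
  then show ?case using ten by (simp add: lop_ten)
next
  case (add u v)
  then show ?case by (simp add: lop_add)
qed

lemma lop_distrib:
  assumes "c \<in> carrier F" "d \<in> carrier F" "v \<in> carrier V"
  shows "lop (c \<oplus>\<^bsub>F\<^esub> d) \<one> v = lop c \<one> v \<oplus>\<^bsub>V\<^esub> lop d \<one> v"
  using assms(3)
proof (induction rule: V_induct)
  case (ten a w)
  have e: "single (c \<oplus>\<^bsub>F\<^esub> d) \<one> = single c \<one> \<oplus>\<^bsub>A\<^esub> single d \<one>"
    by (auto simp: galg_single_def galg_add)
  have "lop (c \<oplus>\<^bsub>F\<^esub> d) \<one> (ten a w) = ten (single (c \<oplus>\<^bsub>F\<^esub> d) \<one> \<otimes>\<^bsub>A\<^esub> a) w"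
    using ten assms(1,2) by (simp add: lop_ten)
  also have "\<dots> = lop c \<one> (ten a w) \<oplus>\<^bsub>V\<^esub> lop d \<one> (ten a w)"
    unfolding e using ten assms(1,2)
    by (simp add: lop_ten galg_mult_add_left single_A ten_add_left galg_mult_closed)
  finally show ?case .
next
  case (add u v)
  note cl = lop_closed[OF assms(1) G.one_closed] lop_closed[OF assms(2) G.one_closed]
  show ?case using add cl assms by (simp add: lop_add VA.a_ac)
qed

lemma vectorspace_V: "vectorspace F V"
proof -
  have "module F V"
    by (rule moduleI)
      (simp_all add: F.is_cring abelian_group_V smult_lop lop_closed lop_lop lop_one lop_distrib lop_add)
  then show ?thesis using F.field_axioms by (simp add: vectorspace_def)
qed

lemma gmodule_V: "gmodule F G V"
proof (rule gmodule.intro)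
  show "gact V g \<in> module_hom F V V" if "g \<in> carrier G" for g
    using that by (auto simp: module_hom_def gact_lop smult_lop lop_closed lop_add lop_lop)
  show "gact V \<one> v = v" if "v \<in> carrier V" for v using that by (simp add: gact_lop lop_one)
  show "gact V (g \<otimes> h) v = gact V g (gact V h v)"
    if "g \<in> carrier G" "h \<in> carrier G" "v \<in> carrier V" for g h v
    using that by (simp add: gact_lop lop_lop)
qed (rule G.group_axioms vectorspace_V)+

text \<open>The universal property of the free abelian group extends \<open>pair_coord\<close> to
  all of \<open>T\<close>; the extension vanishes on the three kinds of relation and so factors
  through the quotient.\<close>

lemma exists_coord:
  assumes x: "x \<in> carrier G"
  shows "\<exists>p. (\<forall>v\<in>carrier V. p v \<in> carrier W) \<and>
    (\<forall>u\<in>carrier V. \<forall>v\<in>carrier V. p (u \<oplus>\<^bsub>V\<^esub> v) = p u \<oplus>\<^bsub>W\<^esub> p v) \<and>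
    (\<forall>a\<in>carrier A. \<forall>w\<in>carrier W. p (ten a w) = pair_coord x a w)"
proof -
  have cg: "comm_group (add_monoid W)" by (rule W.M.a_comm_group)
  have "(\<lambda>(a, w). pair_coord x a w) ` (carrier A \<times> carrier W) \<subseteq> carrier (add_monoid W)"
    using pair_coord_closed[OF x] by auto
  from comm_group.free_Abelian_group_universal[OF cg this]
  obtain h where h: "h \<in> hom T (add_monoid W)"
    and hf: "\<And>p. p \<in> carrier A \<times> carrier W \<Longrightarrow> h (frag_of p) = (case p of (a, w) \<Rightarrow> pair_coord x a w)"
    unfolding tensor_free_def by blast
  interpret h: group_hom T "add_monoid W" h
    using h cg by (simp add: group_hom_def group_hom_axioms_def comm_group.axioms(2))
  have hp: "h (frag_of (a, w)) = pair_coord x a w" if "a \<in> carrier A" "w \<in> carrier W" for a w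
    using hf[of "(a, w)"] that by simp
  have hadd: "h (s + t) = h s \<oplus>\<^bsub>W\<^esub> h t" if "s \<in> carrier T" "t \<in> carrier T" for s t
    using h.hom_mult[OF that] by simp
  have hcl: "h t \<in> carrier W" if "t \<in> carrier T" for t using h.hom_closed[OF that] by simp
  have hneg: "h (- t) = \<ominus>\<^bsub>W\<^esub> h t" if "t \<in> carrier T" for t
    using h.hom_inv[OF that] T_inv[OF that] by (simp add: a_inv_def)
  have hdiff: "h (s - t) = h s \<ominus>\<^bsub>W\<^esub> h t" if "s \<in> carrier T" "t \<in> carrier T" for s t
  proof -
    have "- t \<in> carrier T" using T.inv_closed[OF that(2)] T_inv[OF that(2)] by simp
    then have "h (s + - t) = h s \<oplus>\<^bsub>W\<^esub> \<ominus>\<^bsub>W\<^esub> h t"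
      unfolding hneg[OF that(2), symmetric] by (rule hadd[OF that(1)])
    moreover have "s - t = s + - t" by simp
    ultimately show ?thesis by (simp only: a_minus_def)
  qed
  \<comment> \<open>The shape that \<open>h\<close> takes on both relations of biadditivity.\<close>
  have sub3: "(u \<oplus>\<^bsub>W\<^esub> v) \<ominus>\<^bsub>W\<^esub> u \<ominus>\<^bsub>W\<^esub> v = \<zero>\<^bsub>W\<^esub>" if "u \<in> carrier W" "v \<in> carrier W" for u v
  proof -
    have "(u \<oplus>\<^bsub>W\<^esub> v) \<ominus>\<^bsub>W\<^esub> u \<ominus>\<^bsub>W\<^esub> v = (u \<oplus>\<^bsub>W\<^esub> \<ominus>\<^bsub>W\<^esub> u) \<oplus>\<^bsub>W\<^esub> (v \<oplus>\<^bsub>W\<^esub> \<ominus>\<^bsub>W\<^esub> v)"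
      unfolding a_minus_def using that by (simp add: W.M.a_ac del: W.M.r_neg)
    then show ?thesis using that by (simp add: W.M.r_neg)
  qed
  have hg: "h t = \<zero>\<^bsub>W\<^esub>" if "t \<in> gens" for t
    using that
  proof cases
    case (left a a' w)
    then show ?thesis
      using sub3 x by (simp add: hdiff hp diff_T frag_T add_A pair_coord_add_left pair_coord_closed)
  next
    case (right a w w')
    then show ?thesis
      using sub3 x by (simp add: hdiff hp diff_T frag_T pair_coord_add_right pair_coord_closed)
  next
    case (balanced a b w)
    then show ?thesis
      using x by (simp add: hdiff hp frag_T galg_mult_closed B_sub galg_act_closed
          pair_coord_balanced pair_coord_closed W.M.r_neg a_minus_def)
  qed
  have hK: "h k = \<zero>\<^bsub>W\<^esub>" if "k \<in> K" for k
    using that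
  proof (induction rule: K_induct)
    case zero
    then show ?case using h.hom_one by simp
  next
    case (minus t)
    then have "t \<in> carrier T" using gens_T by blast
    then show ?case using hneg hg[OF minus] by simp
  qed (simp_all add: hg hadd K_T)
  have "K \<subseteq> kernel T (add_monoid W) h" using hK K_T by (auto simp: kernel_def)
  from h.FactGroup_universal_kernel[OF K_normal this]
  obtain p where p: "p \<in> hom (T Mod K) (add_monoid W)" "\<And>t. t \<in> carrier T \<Longrightarrow> p (cl t) = h t"
    unfolding cl_def by blast
  have "p v \<in> carrier W" if "v \<in> carrier V" for v
    using hom_in_carrier[OF p(1), of v] that by (simp add: V_simps)
  moreover have "p (u \<oplus>\<^bsub>V\<^esub> v) = p u \<oplus>\<^bsub>W\<^esub> p v" if "u \<in> carrier V" "v \<in> carrier V" for u v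
    using hom_mult[OF p(1), of u v] that by (simp add: V_simps)
  moreover have "p (ten a w) = pair_coord x a w" if "a \<in> carrier A" "w \<in> carrier W" for a w
    using p(2)[OF frag_T[OF that]] hp[OF that] by (simp add: ten_def)
  ultimately show ?thesis by blast
qed

section \<open>Embedding and coordinates of the tensor product\<close>

definition emb :: "'w \<Rightarrow> (('g \<Rightarrow> 'f) \<times> 'w \<Rightarrow>\<^sub>0 int) set"
  where "emb w = ten (single \<one>\<^bsub>F\<^esub> \<one>) w"

text \<open>A choice justified by \<open>exists_coord\<close>. On the carrier it is determined,
  since simple tensors generate \<open>V\<close> additively.\<close>

definition coord :: "'g \<Rightarrow> (('g \<Rightarrow> 'f) \<times> 'w \<Rightarrow>\<^sub>0 int) set \<Rightarrow> 'w"
  where "coord x = (SOME p. (\<forall>v\<in>carrier V. p v \<in> carrier W) \<and>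
    (\<forall>u\<in>carrier V. \<forall>v\<in>carrier V. p (u \<oplus>\<^bsub>V\<^esub> v) = p u \<oplus>\<^bsub>W\<^esub> p v) \<and>
    (\<forall>a\<in>carrier A. \<forall>w\<in>carrier W. p (ten a w) = pair_coord x a w))"

lemma coord:
  assumes "x \<in> carrier G"
  shows "v \<in> carrier V \<Longrightarrow> coord x v \<in> carrier W"
    "u \<in> carrier V \<Longrightarrow> v \<in> carrier V \<Longrightarrow> coord x (u \<oplus>\<^bsub>V\<^esub> v) = coord x u \<oplus>\<^bsub>W\<^esub> coord x v"
    "a \<in> carrier A \<Longrightarrow> w \<in> carrier W \<Longrightarrow> coord x (ten a w) = pair_coord x a w"
  using someI_ex[OF exists_coord[OF assms], folded coord_def] by blast+

lemma one_A: "single \<one>\<^bsub>F\<^esub> \<one> \<in> carrier A"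
  by (intro single_A) auto

lemma act_emb: "g \<in> carrier G \<Longrightarrow> w \<in> carrier W \<Longrightarrow> gact V g (emb w) = ten (single \<one>\<^bsub>F\<^esub> g) w"
  by (simp add: emb_def gact_lop lop_ten one_A galg_single_mult_single)

text \<open>The multiple of the unit by \<open>c\<close> lies in \<open>FH\<close> and moves across
  the tensor sign, so translates of the image of \<open>emb\<close> already include all simple
  tensors \<open>c g \<otimes> w\<close>.\<close>

lemma ten_single:
  assumes "c \<in> carrier F" "g \<in> carrier G" "w \<in> carrier W"
  shows "ten (single c g) w = gact V g (emb (c \<odot>\<^bsub>W\<^esub> w))"
proof -
  have e: "\<one> \<in> H" by (rule subgroup.one_closed[OF subgroup_H])
  have "single \<one>\<^bsub>F\<^esub> g \<otimes>\<^bsub>A\<^esub> single c \<one> = single c g"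
    using assms by (simp add: galg_single_mult_single)
  moreover have "ten (single \<one>\<^bsub>F\<^esub> g \<otimes>\<^bsub>A\<^esub> single c \<one>) w = ten (single \<one>\<^bsub>F\<^esub> g) (galg_act F W (single c \<one>) w)"
    using assms e by (intro ten_balanced single_A single_B) auto
  moreover have "galg_act F W (single c \<one>) w = c \<odot>\<^bsub>W\<^esub> w"
    using assms e W.gact_one[of w] by (simp add: galg_act_single)
  ultimately show ?thesis using assms by (simp add: act_emb)
qed

lemma emb_ghom: "emb \<in> ghom F (G\<lparr>carrier := H\<rparr>) W V"
proof (rule ghomI)
  show "emb w \<in> carrier V" if "w \<in> carrier W" for w using that by (simp add: emb_def ten_closed one_A)
  show "emb (u \<oplus>\<^bsub>W\<^esub> w) = emb u \<oplus>\<^bsub>V\<^esub> emb w" if "u \<in> carrier W" "w \<in> carrier W" for u w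
    using that by (simp add: emb_def ten_add_right one_A)
  show "emb (c \<odot>\<^bsub>W\<^esub> w) = c \<odot>\<^bsub>V\<^esub> emb w" if "c \<in> carrier F" "w \<in> carrier W" for c w
  proof -
    have "c \<odot>\<^bsub>V\<^esub> emb w = ten (single c \<one>) w"
      using that by (simp add: emb_def smult_lop lop_ten one_A galg_single_mult_single)
    also have "\<dots> = gact V \<one> (emb (c \<odot>\<^bsub>W\<^esub> w))" using that by (simp add: ten_single)
    also have "\<dots> = emb (c \<odot>\<^bsub>W\<^esub> w)"
      using that by (simp add: gact_lop lop_one emb_def ten_closed one_A)
    finally show ?thesis by simp
  qed
  show "emb (gact W h w) = gact V h (emb w)" if "h \<in> carrier (G\<lparr>carrier := H\<rparr>)" "w \<in> carrier W" for h w
  proof -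
    have h: "h \<in> H" "h \<in> carrier G" using that H_sub by auto
    \<comment> \<open>Writing \<open>h\<close> as the product of the unit with \<open>h\<close> in
      \<open>FH\<close> allows it to move across the tensor sign.\<close>
    have "gact V h (emb w) = ten (single \<one>\<^bsub>F\<^esub> \<one> \<otimes>\<^bsub>A\<^esub> single \<one>\<^bsub>F\<^esub> h) w"
      using h that by (simp add: act_emb galg_single_mult_single)
    also have "\<dots> = ten (single \<one>\<^bsub>F\<^esub> \<one>) (galg_act F W (single \<one>\<^bsub>F\<^esub> h) w)"
      using h that by (intro ten_balanced one_A single_B) auto
    also have "\<dots> = emb (gact W h w)"
      using h that W.act_closed[of h w] by (simp add: emb_def galg_act_single)
    finally show ?thesis by simp
  qed
qed

text \<open>The tensor product enters the irreducibility arguments through this interpretation.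
  Generation holds because every simple tensor is a sum of terms treated by
  \<open>ten_single\<close>.\<close>

lemma induced_gmodule_V: "induced_gmodule F G V H W emb coord"
proof (intro induced_gmodule.intro induced_gmodule_axioms.intro)
  show "gmodule F G V" by (rule gmodule_V)
  show "gmodule F (G\<lparr>carrier := H\<rparr>) W" by (rule W.gmodule_axioms)
  show "subgroup H G" by (rule subgroup_H)
  show "emb \<in> ghom F (G\<lparr>carrier := H\<rparr>) W V" by (rule emb_ghom)
  show "coord x v \<in> carrier W" if "x \<in> carrier G" "v \<in> carrier V" for x v using coord(1) that .
  show "coord x (u \<oplus>\<^bsub>V\<^esub> v) = coord x u \<oplus>\<^bsub>W\<^esub> coord x v"
    if "x \<in> carrier G" "u \<in> carrier V" "v \<in> carrier V" for x u v using coord(2) that .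
  show "coord x (gact V g (emb w)) = (if inv x \<otimes> g \<in> H then gact W (inv x \<otimes> g) w else \<zero>\<^bsub>W\<^esub>)"
    if "x \<in> carrier G" "g \<in> carrier G" "w \<in> carrier W" for x g w
    using that W.act_closed[of "inv x \<otimes> g" w]
    by (simp add: act_emb coord(3) single_A pair_coord_single)
  show "P v" if v: "v \<in> carrier V"
    and emb: "\<And>g w. g \<in> carrier G \<Longrightarrow> w \<in> carrier W \<Longrightarrow> P (gact V g (emb w))"
    and add: "\<And>u v. u \<in> carrier V \<Longrightarrow> v \<in> carrier V \<Longrightarrow> P u \<Longrightarrow> P v \<Longrightarrow> P (u \<oplus>\<^bsub>V\<^esub> v)" for v P
    using v
  proof (induction rule: V_induct)
    case (ten a w)
    show ?case using ten(1)
    proof (induction rule: A_induct)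
      case (single c g)
      then show ?case using ten(2) emb by (simp add: ten_single)
    next
      case (add a b)
      then show ?case using ten(2) that(3) by (simp add: ten_add_left ten_closed)
    qed
  qed (rule add)
qed

end

section \<open>Irreducibility of the induced module\<close>

theorem theorem6p7:
  fixes F :: "('f, 'm) ring_scheme"
    and G :: "('g, 'n) monoid_scheme"
    and H :: "'g set"
    and W :: "('g, 'f, 'w) gmodule"
  assumes "field F"
    and "group G"
    and "subgroup H G"
    and "irreducible_gmodule F (G\<lparr>carrier := H\<rparr>) W"
    and "intertwining_number F (G\<lparr>carrier := H\<rparr>) W W = 1"
    and "\<forall>x \<in> carrier G - H.
      intertwining_number F (G\<lparr>carrier := H \<inter> (x <#\<^bsub>G\<^esub> H #>\<^bsub>G\<^esub> inv\<^bsub>G\<^esub> x)\<rparr>) W (left_conj G x W) = 0"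
    and "(\<exists>N (W\<^sub>0 :: ('g, 'f, 'u) gmodule).
            N \<lhd> G \<and> N \<subseteq> H \<and> irreducible_gmodule F (G\<lparr>carrier := N\<rparr>) W\<^sub>0 \<and>
            lies_over F G N W W\<^sub>0 \<and> H = inertia_group F G N W\<^sub>0)
       \<or> (finite (carrier G) \<and> \<not> ring_char F dvd order G)
       \<or> (\<exists>(J :: 'i set) r C. strongly_ascendant_series F G H J r C)"
  shows "irreducible_gmodule F G (induced F G H W) \<and>
    intertwining_number F G (induced F G H W) (induced F G H W) = 1"
proof -
  interpret I: induction_data F G H W
    using assms(1-3) irreducible_gmoduleD(1)[OF assms(4)]
    by (simp add: induction_data_def induction_data_axioms_def)
  interpret mackey_gmodule F G "induced F G H W" H W I.emb I.coord
  proof (intro mackey_gmodule.intro mackey_gmodule_axioms.intro)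
    show "induced_gmodule F G (induced F G H W) H W I.emb I.coord" by (rule I.induced_gmodule_V)
    show "intertwining_number F (G\<lparr>carrier := H \<inter> ((x <#\<^bsub>G\<^esub> H) #>\<^bsub>G\<^esub> inv\<^bsub>G\<^esub> x)\<rparr>) W (left_conj G x W) = 0"
      if "x \<in> carrier G - H" for x
      using assms(6) that by blast
  qed (rule assms)+
  \<comment> \<open>The three conditions are consulted for irreducibility; the intertwining number
    is supplied by \<open>intertwining_number_V\<close>.\<close>
  from assms(7) have "irreducible_gmodule F G (induced F G H W)"
  proof (elim disjE exE conjE)
    fix N and W\<^sub>0 :: "('g, 'f, 'u) gmodule"
    assume "N \<lhd> G" "N \<subseteq> H" "irreducible_gmodule F (G\<lparr>carrier := N\<rparr>) W\<^sub>0"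
      "lies_over F G N W W\<^sub>0" "H = inertia_group F G N W\<^sub>0"
    then show ?thesis by (intro irreducible_V irr_over_inertia_group)
  next
    assume "finite (carrier G)" "\<not> ring_char F dvd order G"
    then show ?thesis by (rule irreducible_V_finite)
  next
    fix J :: "'i set" and r C
    assume "strongly_ascendant_series F G H J r C"
    then show ?thesis by (intro irreducible_V irr_over_ascendant)
  qed
  then show ?thesis using intertwining_number_V by blast
qed

end
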